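(* Let $t_0>0$, $\zeta_\pi>0$, $M_1$ and $M_2>M_1^2$ be given constants. There exist a pair of target and behavior policies $\pi$ and $\pi_0$ with (C1) $\pi_a(x)/\pi_{0,a}(x)\le\exp(\zeta_\pi)$ for all $a=1,\dots,A$ and $x\in\mathcal X$, and a constant $T_l<\infty$ such that, for all $T>T_l$, writing $\mathcal I(t_0,M_1,M_2)$ for the set of all (single-unit) POMDP problems for which the following conditions hold: (C2) $\|f'P^{\pi}-fP^{\pi}\|_1\le2\exp(-1/t_0)$ and $\|f'P^{\pi_0}-fP^{\pi_0}\|_1\le2\exp(-1/t_0)$ for all distributions $f,f'$ on $\mathcal X\times\mathcal H$; (C3) $|\mathbb{E}[Y_t\mid W_t,X_t,H_t]|\le M_1$ and $\mathbb{E}[Y_t^2\mid W_t,X_t,H_t]\le M_2$ for all $W_t=1,\dots,A$, $X_t\in\mathcal X$, $H_t\in\mathcal H$, the minimax risk of evaluating $\pi$ from a single length-$T$ trajectory generated under $\pi_0$ satisfies $$\inf_{\hat V}\ \sup_{I\in\mathcal I(t_0,M_1,M_2)}\mathbb{E}^I\left[\left(\hat V-V(I)\right)^2\right]\ \ge\ C_2\,T^{-\frac{2}{t_0\zeta_\pi+2}},\qquad C_2=\frac{(M_1^2)^{t_0\zeta_\pi/(t_0\zeta_\pi+2)}}{16e\,(M_2-M_1^2)^{-2/(t_0\zeta_\pi+2)}}.$$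
   Context: Single-unit POMDP problem (instance) $I$: at times $t=1,\dots,T$ there are an observed state $X_t\in\mathcal X$, a hidden state $H_t\in\mathcal H$ (with $\mathcal X\times\mathcal H$ finite), an action $W_t\in\{1,\dots,A\}$ and an outcome $Y_t\in\mathbb{R}$. Conditionally on $(X_t,H_t,W_t)$, the triple $(Y_t,X_{t+1},H_{t+1})$ is independent of $\{X_s,H_s,W_s,Y_s\}_{s<t}$ and drawn from a time-invariant kernel depending only on $(X_t,H_t,W_t)$. A policy is a map $\pi$ from $\mathcal X$ to probability vectors in $[0,1]^A$, under which $W_t=a$ with conditional probability $\pi_a(X_t)$ given $X_1,H_1,Y_1,\dots,X_t,H_t$. $P^{\pi}$ is the induced transition operator on $(X_t,H_t)$ under $\pi$. The data $(X_t,W_t,Y_t)_{t=1}^T$ are generated under the behavior policy $\pi_0$, with the initial state drawn from the stationary distribution under $\pi_0$; $\mathbb{E}^I$ is expectation under this data-generating law. $V(I)$ is the long-term value of $\pi$ in $I$: the expectation of $Y_t$ under the stationary distribution of $(X_t,H_t,W_t,Y_t)$ under $\pi$. The infimum is over all measurable functions $\hat V$ of the observed data (policies $\pi,\pi_0$ known). *)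

theory Defs
  imports "HOL-Probability.Probability"
begin

text \<open>
  Finite sets of states are encoded as finite sets of natural numbers, so that one can quantify
  over the state spaces; the actions are \<open>1, \<dots>, n_actions I\<close>.  The kernel maps
  \<open>(x, h, w)\<close> to the joint law of \<open>(Y\<^sub>t, X\<^sub>t\<^sub>+\<^sub>1, H\<^sub>t\<^sub>+\<^sub>1)\<close> given
  \<open>X\<^sub>t = x\<close>, \<open>H\<^sub>t = h\<close>, \<open>W\<^sub>t = w\<close>.
\<close>

record pomdp =
  obs_states :: "nat set"
  hid_states :: "nat set"
  n_actions :: nat
  kernel :: "nat \<times> nat \<times> nat \<Rightarrow> (real \<times> nat \<times> nat) measure"

abbreviation actions :: "pomdp \<Rightarrow> nat set" where
  "actions I \<equiv> {1..n_actions I}"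

abbreviation states :: "pomdp \<Rightarrow> (nat \<times> nat) set" where
  "states I \<equiv> obs_states I \<times> hid_states I"

abbreviation state_space :: "pomdp \<Rightarrow> (nat \<times> nat) measure" where
  "state_space I \<equiv> count_space (obs_states I) \<Otimes>\<^sub>M count_space (hid_states I)"

definition is_pomdp :: "pomdp \<Rightarrow> bool" where
  "is_pomdp I \<longleftrightarrow>
     finite (obs_states I) \<and> obs_states I \<noteq> {} \<and>
     finite (hid_states I) \<and> hid_states I \<noteq> {} \<and>
     n_actions I \<ge> 1 \<and>
     kernel I \<in> measurable
       (count_space (obs_states I \<times> hid_states I \<times> actions I))
       (prob_algebra (borel \<Otimes>\<^sub>M state_space I))"

definition policy :: "nat set \<Rightarrow> nat \<Rightarrow> (nat \<Rightarrow> nat \<Rightarrow> real) \<Rightarrow> bool" where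
  "policy X A p \<longleftrightarrow>
     (\<forall>x\<in>X. (\<forall>a\<in>{1..A}. 0 \<le> p x a \<and> p x a \<le> 1) \<and> (\<Sum>a\<in>{1..A}. p x a) = 1)"

text \<open>Distributions are required to vanish off their carrier, so that the stationary
  distribution below can be unique as a function.\<close>

definition distribution_on :: "'s set \<Rightarrow> ('s \<Rightarrow> real) \<Rightarrow> bool" where
  "distribution_on S f \<longleftrightarrow> (\<forall>s\<in>S. 0 \<le> f s) \<and> (\<Sum>s\<in>S. f s) = 1 \<and> (\<forall>s. s \<notin> S \<longrightarrow> f s = 0)"

definition transition_prob ::
    "pomdp \<Rightarrow> (nat \<Rightarrow> nat \<Rightarrow> real) \<Rightarrow> nat \<times> nat \<Rightarrow> nat \<times> nat \<Rightarrow> real" where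
  "transition_prob I p = (\<lambda>(x, h) s'.
     \<Sum>a\<in>actions I. p x a * measure (kernel I (x, h, a)) (UNIV \<times> {s'}))"

text \<open>The row-vector action \<open>f \<mapsto> f P\<^sup>\<pi>\<close>.\<close>

definition push :: "pomdp \<Rightarrow> (nat \<Rightarrow> nat \<Rightarrow> real) \<Rightarrow> (nat \<times> nat \<Rightarrow> real) \<Rightarrow> nat \<times> nat \<Rightarrow> real" where
  "push I p f = (\<lambda>s'. \<Sum>s\<in>states I. f s * transition_prob I p s s')"

definition mixing :: "pomdp \<Rightarrow> (nat \<Rightarrow> nat \<Rightarrow> real) \<Rightarrow> real \<Rightarrow> bool" where
  "mixing I p t0 \<longleftrightarrow>
     (\<forall>f f'. distribution_on (states I) f \<longrightarrow> distribution_on (states I) f' \<longrightarrow>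
        (\<Sum>s\<in>states I. \<bar>push I p f' s - push I p f s\<bar>) \<le> 2 * exp (- 1 / t0))"

text \<open>The integrability of \<open>Y\<^sup>2\<close> (hence of \<open>Y\<close>) is part of the moment condition, because
  the Bochner integral of a non-integrable function is 0.\<close>

definition moment_bounds :: "pomdp \<Rightarrow> real \<Rightarrow> real \<Rightarrow> bool" where
  "moment_bounds I M1 M2 \<longleftrightarrow>
     (\<forall>x\<in>obs_states I. \<forall>h\<in>hid_states I. \<forall>w\<in>actions I.
        integrable (kernel I (x, h, w)) (\<lambda>z. (fst z)\<^sup>2) \<and>
        \<bar>\<integral>z. fst z \<partial>kernel I (x, h, w)\<bar> \<le> M1 \<and>
        (\<integral>z. (fst z)\<^sup>2 \<partial>kernel I (x, h, w)) \<le> M2)"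

text \<open>The mixing condition makes the stationary distribution exist and be unique.\<close>

definition stationary_dist :: "pomdp \<Rightarrow> (nat \<Rightarrow> nat \<Rightarrow> real) \<Rightarrow> nat \<times> nat \<Rightarrow> real" where
  "stationary_dist I p =
     (THE f. distribution_on (states I) f \<and> (\<forall>s\<in>states I. push I p f s = f s))"

abbreviation action_law :: "pomdp \<Rightarrow> (nat \<Rightarrow> nat \<Rightarrow> real) \<Rightarrow> nat \<Rightarrow> nat measure" where
  "action_law I p x \<equiv> point_measure (actions I) (\<lambda>a. ennreal (p x a))"

abbreviation stationary_state_law :: "pomdp \<Rightarrow> (nat \<Rightarrow> nat \<Rightarrow> real) \<Rightarrow> (nat \<times> nat) measure" where
  "stationary_state_law I p \<equiv>
     point_measure (states I) (\<lambda>s. ennreal (stationary_dist I p s))"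

abbreviation obs_space :: "pomdp \<Rightarrow> (nat \<times> nat \<times> nat \<times> real) measure" where
  "obs_space I \<equiv> count_space (obs_states I) \<Otimes>\<^sub>M count_space (hid_states I)
     \<Otimes>\<^sub>M count_space (actions I) \<Otimes>\<^sub>M borel"

text \<open>The stationary law of \<open>(X\<^sub>t, H\<^sub>t, W\<^sub>t, Y\<^sub>t)\<close> under \<open>p\<close>.\<close>

definition stationary_law ::
    "pomdp \<Rightarrow> (nat \<Rightarrow> nat \<Rightarrow> real) \<Rightarrow> (nat \<times> nat \<times> nat \<times> real) measure" where
  "stationary_law I p =
     stationary_state_law I p \<bind> (\<lambda>(x, h).
     action_law I p x \<bind> (\<lambda>w.
     kernel I (x, h, w) \<bind> (\<lambda>(y, x', h').
     return (obs_space I) (x, h, w, y))))"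

definition long_term_value :: "pomdp \<Rightarrow> (nat \<Rightarrow> nat \<Rightarrow> real) \<Rightarrow> real" where
  "long_term_value I p = (\<integral>(x, h, w, y). y \<partial>stationary_law I p)"

abbreviation traj_space ::
    "pomdp \<Rightarrow> nat \<Rightarrow> ((nat \<Rightarrow> nat \<times> nat \<times> nat \<times> real) \<times> nat \<times> nat) measure" where
  "traj_space I t \<equiv> (\<Pi>\<^sub>M s\<in>{1..t}. obs_space I) \<Otimes>\<^sub>M state_space I"

text \<open>\<open>traj_law I p t\<close> is the joint law, under \<open>p\<close> and with stationary initial state, of
  \<open>(X\<^sub>s, H\<^sub>s, W\<^sub>s, Y\<^sub>s)\<close> for \<open>s = 1, \<dots>, t\<close> together with
  \<open>(X\<^sub>t\<^sub>+\<^sub>1, H\<^sub>t\<^sub>+\<^sub>1)\<close>.\<close>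

primrec traj_law ::
    "pomdp \<Rightarrow> (nat \<Rightarrow> nat \<Rightarrow> real) \<Rightarrow> nat \<Rightarrow>
      ((nat \<Rightarrow> nat \<times> nat \<times> nat \<times> real) \<times> nat \<times> nat) measure" where
  "traj_law I p 0 = distr (stationary_state_law I p) (traj_space I 0) (\<lambda>s. (\<lambda>_. undefined, s))"
| "traj_law I p (Suc t) =
     traj_law I p t \<bind> (\<lambda>(\<omega>, x, h).
     action_law I p x \<bind> (\<lambda>w.
     kernel I (x, h, w) \<bind> (\<lambda>(y, x', h').
     return (traj_space I (Suc t)) (fun_upd \<omega> (Suc t) (x, h, w, y), x', h'))))"

abbreviation data_space :: "nat set \<Rightarrow> nat \<Rightarrow> nat \<Rightarrow> (nat \<Rightarrow> nat \<times> nat \<times> real) measure" where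
  "data_space X A T \<equiv>
     \<Pi>\<^sub>M t\<in>{1..T}. count_space X \<Otimes>\<^sub>M count_space {1..A} \<Otimes>\<^sub>M borel"

definition observed ::
    "nat \<Rightarrow> (nat \<Rightarrow> nat \<times> nat \<times> nat \<times> real) \<Rightarrow> nat \<Rightarrow> nat \<times> nat \<times> real" where
  "observed T \<omega> = (\<lambda>t\<in>{1..T}. case \<omega> t of (x, h, w, y) \<Rightarrow> (x, w, y))"

text \<open>Mean squared error for the value of \<open>p\<close> of the estimator \<open>V\<close> applied to \<open>T\<close> periods of
  data generated under \<open>p0\<close>; possibly infinite, hence the nonnegative integral.\<close>

definition mse ::
    "pomdp \<Rightarrow> (nat \<Rightarrow> nat \<Rightarrow> real) \<Rightarrow> (nat \<Rightarrow> nat \<Rightarrow> real) \<Rightarrow> nat \<Rightarrow>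
      ((nat \<Rightarrow> nat \<times> nat \<times> real) \<Rightarrow> real) \<Rightarrow> ennreal" where
  "mse I p p0 T V =
     (\<integral>\<^sup>+ z. ennreal ((V (observed T (fst z)) - long_term_value I p)\<^sup>2) \<partial>traj_law I p0 T)"

text \<open>The policies fix the observed state space and the number of actions; the hidden state
  space and the kernel range freely.\<close>

definition pomdp_class ::
    "nat set \<Rightarrow> nat \<Rightarrow> (nat \<Rightarrow> nat \<Rightarrow> real) \<Rightarrow> (nat \<Rightarrow> nat \<Rightarrow> real) \<Rightarrow>
      real \<Rightarrow> real \<Rightarrow> real \<Rightarrow> pomdp set" where
  "pomdp_class X A p p0 t0 M1 M2 =
     {I. is_pomdp I \<and> obs_states I = X \<and> n_actions I = A \<and>
         mixing I p t0 \<and> mixing I p0 t0 \<and> moment_bounds I M1 M2}"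

definition minimax_risk ::
    "nat set \<Rightarrow> nat \<Rightarrow> (nat \<Rightarrow> nat \<Rightarrow> real) \<Rightarrow> (nat \<Rightarrow> nat \<Rightarrow> real) \<Rightarrow>
      real \<Rightarrow> real \<Rightarrow> real \<Rightarrow> nat \<Rightarrow> ennreal" where
  "minimax_risk X A p p0 t0 M1 M2 T =
     (INF V\<in>borel_measurable (data_space X A T).
        SUP I\<in>pomdp_class X A p p0 t0 M1 M2. mse I p p0 T V)"

end

theory Submission
  imports Defs
begin

text \<open>
  Le Cam's two-point method for a pair of instances that differ in the sign \<open>s\<close> of one small bias.
  The target policy always plays action 1, the behavior policy plays it with probability
  \<open>exp (- \<zeta>)\<close>; every other action visibly regenerates the hidden state.  The outcome is
  \<open>\<plusminus>c\<close>, where the sign is a bit that is redrawn from time to time.  In each period the hidden state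
  is reset with probability \<open>r = 1 - exp (- 1 / t0)\<close>, which gives the mixing property.  Only after
  about \<open>L\<close> periods of action 1 without a reset are redrawn bits biased, towards \<open>s\<close>.  Under the
  target policy this shifts the long-term value by about \<open>s c \<delta> (1 - r) ^ L\<close>, whereas under the
  behavior policy a redrawn bit carries information of order \<open>\<delta>\<^sup>2 (1 - r) ^ (2 L)\<close> about \<open>s\<close>, and
  only in the fraction \<open>exp (- \<zeta> (L + 1))\<close> of the periods.  Balancing the two gives the rate.

  For this it is essential that the data do not reveal the absence of resets.  A bit that is kept
  for long would do so, because a reset forces a redraw.  Hence a state that has survived for a while
  (\<open>Late\<close>) redraws its bit spontaneously at exactly the overall rate \<open>q\<close> at which bits are redrawn,
  so that the redraws form an i.i.d. process which is independent of lateness.  Keeping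
  the bits (\<open>q < 1\<close>) is needed if \<open>t0\<close> is large: otherwise the many independent observations in one
  biased stretch would betray \<open>s\<close>.  If \<open>t0\<close> is small, \<open>q = 1\<close> allows the noisier \<open>c = sqrt M2\<close>.

  The data with the redraws revealed have an explicit filter.  Its total mass is the likelihood ratio
  to the i.i.d. base law with \<open>\<delta> = 0\<close>, and the second moment of this mass bounds the
  total variation distance of the two instances.
\<close>

section \<open>Integrals over trajectories\<close>

lemma bind_in_prob_algebra:
  assumes "M \<in> space (prob_algebra A)" "K \<in> measurable A (prob_algebra B)"
  shows "M \<bind> K \<in> space (prob_algebra B)"
  using measurable_space[OF measurable_bind_prob_space[of "\<lambda>_. M" "count_space (UNIV :: unit set)", OF _ assms(2)], of "()"]
    assms(1) by simp

lemma sets_state_fin: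
  assumes "is_pomdp I"
  shows "sets (state_space I) = Pow (states I)"
  using assms by (simp add: is_pomdp_def sets_pair_countable countable_finite
      pair_measure_countable)

lemma kernel_sets:
  assumes "is_pomdp I" "x \<in> obs_states I" "h \<in> hid_states I" "w \<in> actions I"
  shows "kernel I (x, h, w) \<in> space (prob_algebra (borel \<Otimes>\<^sub>M state_space I))"
  using assms by (auto simp: is_pomdp_def dest!: measurable_space)

lemma nn_integral_action:
  assumes "\<And>a. a \<in> actions I \<Longrightarrow> 0 \<le> p x a"
  shows "(\<integral>\<^sup>+ w. g w \<partial>action_law I p x) = (\<Sum>w\<in>actions I. ennreal (p x w) * g w)"
  by (subst nn_integral_point_measure_finite) (auto)

lemma prob_space_action:
  assumes "policy (obs_states I) (n_actions I) p" "x \<in> obs_states I"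
  shows "prob_space (action_law I p x)"
proof (rule prob_spaceI)
  have "(\<Sum>a\<in>actions I. ennreal (p x a)) = ennreal (\<Sum>a\<in>actions I. p x a)"
    using assms by (intro sum_ennreal) (auto simp: policy_def)
  then show "emeasure (action_law I p x) (space (action_law I p x)) = 1"
    using assms by (simp add: emeasure_point_measure_finite space_point_measure policy_def)
qed

text \<open>The generic period shared by \<open>traj_law\<close> and \<open>stationary_law\<close>,
  which differ only in the recording function \<open>upd\<close>. States and actions range over
  countable sets, so joint measurability reduces to measurability in the record and the outcome for
  each fixed state and action.\<close>

lemma action_step_measurable:
  fixes upd :: "'a \<times> nat \<times> nat \<Rightarrow> nat \<Rightarrow> real \<times> nat \<times> nat \<Rightarrow> 'b"
  assumes I: "is_pomdp I" and p: "policy (obs_states I) (n_actions I) p"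
    and upd: "\<And>x h w. x \<in> obs_states I \<Longrightarrow> h \<in> hid_states I \<Longrightarrow> w \<in> actions I \<Longrightarrow>
       (\<lambda>(\<omega>, z). upd (\<omega>, x, h) w z) \<in> measurable (R \<Otimes>\<^sub>M (borel \<Otimes>\<^sub>M state_space I)) S"
  shows "(\<lambda>(\<omega>, x, h). action_law I p x \<bind> (\<lambda>w. kernel I (x, h, w) \<bind> (\<lambda>z. return S (upd (\<omega>, x, h) w z))))
     \<in> measurable (R \<Otimes>\<^sub>M state_space I) (prob_algebra S)"
proof -
  let ?f = "\<lambda>(\<omega>, x, h). action_law I p x \<bind> (\<lambda>w. kernel I (x, h, w) \<bind> (\<lambda>z. return S (upd (\<omega>, x, h) w z)))"
  have inner: "(\<lambda>\<omega>. action_law I p x \<bind> (\<lambda>w. kernel I (x, h, w) \<bind> (\<lambda>z. return S (upd (\<omega>, x, h) w z))))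
      \<in> measurable R (prob_algebra S)" if x: "x \<in> obs_states I" and h: "h \<in> hid_states I" for x h
  proof (rule measurable_bind_prob_space2[where N = "count_space (actions I)"])
    have "sets (action_law I p x) = sets (count_space (actions I))" by (simp add: sets_point_measure)
    then have "action_law I p x \<in> space (prob_algebra (count_space (actions I)))"
      using prob_space_action[OF p x] by (simp add: space_prob_algebra)
    then show "(\<lambda>\<omega>. action_law I p x) \<in> measurable R (prob_algebra (count_space (actions I)))"
      by simp
    have "(\<lambda>(w, \<omega>). kernel I (x, h, w) \<bind> (\<lambda>z. return S (upd (\<omega>, x, h) w z)))
       \<in> measurable (count_space (actions I) \<Otimes>\<^sub>M R) (prob_algebra S)"
    proof (rule measurable_pair_measure_countable1)
      fix w assume w: "w \<in> actions I"
      show "(\<lambda>y. case (w, y) of (w, \<omega>) \<Rightarrow> kernel I (x, h, w) \<bind> (\<lambda>z. return S (upd (\<omega>, x, h) w z)))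
          \<in> measurable R (prob_algebra S)"
        unfolding prod.case
      proof (rule measurable_bind_prob_space2)
        show "(\<lambda>\<omega>. kernel I (x, h, w)) \<in> measurable R (prob_algebra (borel \<Otimes>\<^sub>M state_space I))"
          using kernel_sets[OF I x h w] by simp
        have "(\<lambda>z. return S ((\<lambda>(\<omega>, z). upd (\<omega>, x, h) w z) z)) \<in> measurable (R \<Otimes>\<^sub>M (borel \<Otimes>\<^sub>M state_space I)) (prob_algebra S)"
          using upd[OF x h w] by (rule measurable_compose[OF _ measurable_return_prob_space])
        then show "(\<lambda>(\<omega>, z). return S (upd (\<omega>, x, h) w z)) \<in> measurable (R \<Otimes>\<^sub>M (borel \<Otimes>\<^sub>M state_space I)) (prob_algebra S)"
          by (simp add: case_prod_unfold)
      qed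
    qed simp
    then have "(\<lambda>(w, \<omega>). kernel I (x, h, w) \<bind> (\<lambda>z. return S (upd (\<omega>, x, h) w z))) \<circ> (\<lambda>(\<omega>, w). (w, \<omega>))
       \<in> measurable (R \<Otimes>\<^sub>M count_space (actions I)) (prob_algebra S)"
      by (rule measurable_comp[rotated]) measurable
    then show "(\<lambda>(\<omega>, w). kernel I (x, h, w) \<bind> (\<lambda>z. return S (upd (\<omega>, x, h) w z)))
       \<in> measurable (R \<Otimes>\<^sub>M count_space (actions I)) (prob_algebra S)"
      by (simp add: comp_def case_prod_unfold)
  qed
  have cnt: "state_space I = count_space (states I)"
    using I by (simp add: is_pomdp_def pair_measure_countable countable_finite)
  have "(\<lambda>(s, \<omega>). ?f (\<omega>, s)) \<in> measurable (count_space (states I) \<Otimes>\<^sub>M R) (prob_algebra S)"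
  proof (rule measurable_pair_measure_countable1)
    show "countable (states I)" using I by (simp add: is_pomdp_def countable_finite)
    fix s assume "s \<in> states I"
    then show "(\<lambda>y. case (s, y) of (s, \<omega>) \<Rightarrow> ?f (\<omega>, s)) \<in> measurable R (prob_algebra S)"
      using inner by (auto simp: case_prod_unfold)
  qed
  then have "(\<lambda>(s, \<omega>). ?f (\<omega>, s)) \<circ> (\<lambda>(\<omega>, s). (s, \<omega>)) \<in> measurable (R \<Otimes>\<^sub>M state_space I) (prob_algebra S)"
    unfolding cnt by (rule measurable_comp[rotated]) measurable
  then show ?thesis by (simp add: comp_def case_prod_unfold)
qed

lemma prob_algebra_state_law:
  assumes "is_pomdp I" "distribution_on (states I) (stationary_dist I p)"
  shows "stationary_state_law I p \<in> space (prob_algebra (state_space I))"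
proof -
  have fin: "finite (states I)" using assms by (simp add: is_pomdp_def)
  have "(\<Sum>s\<in>states I. ennreal (stationary_dist I p s)) = ennreal (\<Sum>s\<in>states I. stationary_dist I p s)"
    using assms by (intro sum_ennreal) (auto simp: distribution_on_def)
  then have "prob_space (stationary_state_law I p)"
    using assms fin by (intro prob_spaceI)
      (simp add: emeasure_point_measure_finite space_point_measure distribution_on_def)
  then show ?thesis
    using sets_state_fin[OF assms(1)] by (simp add: space_prob_algebra sets_point_measure)
qed

text \<open>The action integral is a finite sum, and a bind with \<open>return\<close> is an image
  measure, so one period unfolds into an iterated integral.\<close>

lemma nn_integral_action_step:
  fixes upd :: "'a \<times> nat \<times> nat \<Rightarrow> nat \<Rightarrow> real \<times> nat \<times> nat \<Rightarrow> 'b"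
  assumes I: "is_pomdp I" and p: "policy (obs_states I) (n_actions I) p"
    and upd: "\<And>x h w. x \<in> obs_states I \<Longrightarrow> h \<in> hid_states I \<Longrightarrow> w \<in> actions I \<Longrightarrow>
       (\<lambda>(\<omega>, z). upd (\<omega>, x, h) w z) \<in> measurable (R \<Otimes>\<^sub>M (borel \<Otimes>\<^sub>M state_space I)) S"
    and M: "sets M = sets (R \<Otimes>\<^sub>M state_space I)" and F: "F \<in> borel_measurable S"
  shows "(\<integral>\<^sup>+ u. F u \<partial>(M \<bind> (\<lambda>(\<omega>, x, h). action_law I p x \<bind> (\<lambda>w. kernel I (x, h, w) \<bind>
            (\<lambda>z. return S (upd (\<omega>, x, h) w z)))))) =
         (\<integral>\<^sup>+ (\<omega>, x, h). (\<Sum>w\<in>actions I. ennreal (p x w) *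
            (\<integral>\<^sup>+ z. F (upd (\<omega>, x, h) w z) \<partial>kernel I (x, h, w))) \<partial>M)"
proof -
  let ?f = "\<lambda>(\<omega>, x, h). action_law I p x \<bind> (\<lambda>w. kernel I (x, h, w) \<bind> (\<lambda>z. return S (upd (\<omega>, x, h) w z)))"
  have meas: "?f \<in> measurable M (prob_algebra S)"
    unfolding measurable_cong_sets[OF M refl] by (rule action_step_measurable[OF I p upd])
  have "(\<integral>\<^sup>+ u. F u \<partial>(M \<bind> ?f)) = (\<integral>\<^sup>+ v. \<integral>\<^sup>+ u. F u \<partial>(?f v) \<partial>M)"
    by (rule nn_integral_bind[OF F]) (rule measurable_prob_algebraD[OF meas])
  also have "\<dots> = (\<integral>\<^sup>+ (\<omega>, x, h). (\<Sum>w\<in>actions I. ennreal (p x w) *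
            (\<integral>\<^sup>+ z. F (upd (\<omega>, x, h) w z) \<partial>kernel I (x, h, w))) \<partial>M)"
  proof (rule nn_integral_cong)
    fix v assume "v \<in> space M"
    then have "v \<in> space (R \<Otimes>\<^sub>M state_space I)" using sets_eq_imp_space_eq[OF M] by simp
    then obtain \<omega> x h where v: "v = (\<omega>, x, h)" and \<omega>: "\<omega> \<in> space R"
      and x: "x \<in> obs_states I" and h: "h \<in> hid_states I"
      by (auto simp: space_pair_measure)
    have upd1: "(\<lambda>z. upd (\<omega>, x, h) w z) \<in> measurable (kernel I (x, h, w)) S" if w: "w \<in> actions I" for w
    proof -
      have "sets (kernel I (x, h, w)) = sets (borel \<Otimes>\<^sub>M state_space I)"
        using kernel_sets[OF I x h w] by (simp add: space_prob_algebra)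
      moreover have "(\<lambda>z. upd (\<omega>, x, h) w z) \<in> measurable (borel \<Otimes>\<^sub>M state_space I) S"
        using measurable_compose[OF measurable_Pair1'[OF \<omega>] upd[OF x h w]] by simp
      ultimately show ?thesis using measurable_cong_sets by blast
    qed
    have inner: "(\<integral>\<^sup>+ u. F u \<partial>(kernel I (x, h, w) \<bind> (\<lambda>z. return S (upd (\<omega>, x, h) w z)))) =
        (\<integral>\<^sup>+ z. F (upd (\<omega>, x, h) w z) \<partial>kernel I (x, h, w))"
      and inS: "kernel I (x, h, w) \<bind> (\<lambda>z. return S (upd (\<omega>, x, h) w z)) \<in> space (prob_algebra S)"
      if w: "w \<in> actions I" for w
    proof -
      have ne: "space (kernel I (x, h, w)) \<noteq> {}" and pk: "prob_space (kernel I (x, h, w))"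
        using kernel_sets[OF I x h w] by (auto simp: space_prob_algebra dest: prob_space.not_empty)
      have eq: "kernel I (x, h, w) \<bind> (\<lambda>z. return S (upd (\<omega>, x, h) w z)) = distr (kernel I (x, h, w)) S (\<lambda>z. upd (\<omega>, x, h) w z)"
        by (rule bind_return_distr'[OF ne upd1[OF w]])
      show "(\<integral>\<^sup>+ u. F u \<partial>(kernel I (x, h, w) \<bind> (\<lambda>z. return S (upd (\<omega>, x, h) w z)))) =
        (\<integral>\<^sup>+ z. F (upd (\<omega>, x, h) w z) \<partial>kernel I (x, h, w))"
        unfolding eq by (rule nn_integral_distr[OF upd1[OF w]]) (use F in simp)
      show "kernel I (x, h, w) \<bind> (\<lambda>z. return S (upd (\<omega>, x, h) w z)) \<in> space (prob_algebra S)"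
        unfolding eq using prob_space.prob_space_distr[OF pk upd1[OF w]] by (simp add: space_prob_algebra)
    qed
    have "(\<lambda>w. kernel I (x, h, w) \<bind> (\<lambda>z. return S (upd (\<omega>, x, h) w z))) \<in> measurable (action_law I p x) (subprob_algebra S)"
      using inS by (auto simp: measurable_point_measure_eq1 space_prob_algebra space_subprob_algebra
          prob_space_imp_subprob_space)
    then have "(\<integral>\<^sup>+ u. F u \<partial>(?f v)) = (\<integral>\<^sup>+ w. \<integral>\<^sup>+ u. F u \<partial>(kernel I (x, h, w) \<bind> (\<lambda>z. return S (upd (\<omega>, x, h) w z))) \<partial>action_law I p x)"
      unfolding v prod.case by (rule nn_integral_bind[OF F])
    also have "\<dots> = (\<Sum>w\<in>actions I. ennreal (p x w) * (\<integral>\<^sup>+ z. F (upd (\<omega>, x, h) w z) \<partial>kernel I (x, h, w)))"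
      using p x inner by (subst nn_integral_action) (auto simp: policy_def)
    finally show "(\<integral>\<^sup>+ u. F u \<partial>(?f v)) = (case v of (\<omega>, x, h) \<Rightarrow> (\<Sum>w\<in>actions I. ennreal (p x w) *
            (\<integral>\<^sup>+ z. F (upd (\<omega>, x, h) w z) \<partial>kernel I (x, h, w))))"
      by (simp add: v)
  qed
  finally show ?thesis .
qed

lemma traj_upd_measurable:
  assumes x: "x \<in> obs_states I" and h: "h \<in> hid_states I" and w: "w \<in> actions I"
  shows "(\<lambda>(\<omega>, z). case z of (y, x', h') \<Rightarrow> (fun_upd \<omega> (Suc t) (x, h, w, y), x', h'))
    \<in> measurable ((\<Pi>\<^sub>M s\<in>{1..t}. obs_space I) \<Otimes>\<^sub>M (borel \<Otimes>\<^sub>M state_space I)) (traj_space I (Suc t))"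
proof -
  have eq: "{1..Suc t} = insert (Suc t) {1..t}" by auto
  have [measurable]: "x \<in> space (count_space (obs_states I))" "h \<in> space (count_space (hid_states I))"
     "w \<in> space (count_space (actions I))" using assms by auto
  show ?thesis
    unfolding eq case_prod_unfold by measurable
qed

text \<open>Supplies the space and the sigma-algebra of \<open>traj_law\<close>, which
  \<open>bind\<close> reveals only once the kernels are known to be measurable.\<close>

lemma traj_law_prob:
  assumes I: "is_pomdp I" and p: "policy (obs_states I) (n_actions I) p"
    and st: "distribution_on (states I) (stationary_dist I p)"
  shows "traj_law I p t \<in> space (prob_algebra (traj_space I t))"
proof (induction t)
  case 0
  have "(\<lambda>s. (\<lambda>_. undefined, s)) \<in> measurable (state_space I) (traj_space I 0)"
    by (simp add: space_PiM)
  moreover have "sets (stationary_state_law I p) = sets (state_space I)"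
    using prob_algebra_state_law[OF I st] by (simp add: space_prob_algebra)
  ultimately have "(\<lambda>s. (\<lambda>_. undefined, s)) \<in> measurable (stationary_state_law I p) (traj_space I 0)"
    using measurable_cong_sets by blast
  then show ?case
    using prob_algebra_state_law[OF I st]
    by (simp add: space_prob_algebra prob_space.prob_space_distr)
next
  case (Suc t)
  have "(\<lambda>(\<omega>, x, h). action_law I p x \<bind> (\<lambda>w. kernel I (x, h, w) \<bind> (\<lambda>z. return (traj_space I (Suc t))
       ((\<lambda>(\<omega>, x, h) w z. case z of (y, x', h') \<Rightarrow> (fun_upd \<omega> (Suc t) (x, h, w, y), x', h')) (\<omega>, x, h) w z))))
     \<in> measurable (traj_space I t) (prob_algebra (traj_space I (Suc t)))"
    by (rule action_step_measurable[OF I p]) (simp only: prod.case, rule traj_upd_measurable)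
  then have "(\<lambda>(\<omega>, x, h). action_law I p x \<bind> (\<lambda>w. kernel I (x, h, w) \<bind> (\<lambda>(y, x', h').
      return (traj_space I (Suc t)) (fun_upd \<omega> (Suc t) (x, h, w, y), x', h'))))
     \<in> measurable (traj_space I t) (prob_algebra (traj_space I (Suc t)))"
    by (simp add: case_prod_unfold)
  from bind_in_prob_algebra[OF Suc this] show ?case by simp
qed

lemma nn_integral_traj_law_Suc:
  assumes I: "is_pomdp I" and p: "policy (obs_states I) (n_actions I) p"
    and st: "distribution_on (states I) (stationary_dist I p)"
    and F: "F \<in> borel_measurable (traj_space I (Suc t))"
  shows "(\<integral>\<^sup>+ u. F u \<partial>traj_law I p (Suc t)) =
    (\<integral>\<^sup>+ (\<omega>, x, h). (\<Sum>w\<in>actions I. ennreal (p x w) *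
      (\<integral>\<^sup>+ (y, x', h'). F (fun_upd \<omega> (Suc t) (x, h, w, y), x', h') \<partial>kernel I (x, h, w))) \<partial>traj_law I p t)"
proof -
  have "sets (traj_law I p t) = sets (traj_space I t)"
    using traj_law_prob[OF I p st, of t] by (simp add: space_prob_algebra)
  note sets = this
  let ?upd = "\<lambda>(\<omega>, x, h) w z. case z of (y, x', h') \<Rightarrow> (fun_upd \<omega> (Suc t) (x, h, w, y), x', h')"
  have "(\<lambda>(\<omega>, z). ?upd (\<omega>, x, h) w z) \<in> measurable ((\<Pi>\<^sub>M s\<in>{1..t}. obs_space I) \<Otimes>\<^sub>M (borel \<Otimes>\<^sub>M state_space I)) (traj_space I (Suc t))"
    if "x \<in> obs_states I" "h \<in> hid_states I" "w \<in> actions I" for x h w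
    using traj_upd_measurable[OF that] by (simp only: prod.case)
  from nn_integral_action_step[OF I p this sets F] show ?thesis
    unfolding traj_law.simps case_prod_unfold by (simp only: fst_conv snd_conv prod.collapse)
qed

lemma nn_integral_state_law:
  assumes "is_pomdp I" "distribution_on (states I) (stationary_dist I p)"
  shows "(\<integral>\<^sup>+ s. F s \<partial>stationary_state_law I p) = (\<Sum>s\<in>states I. ennreal (stationary_dist I p s) * F s)"
  using assms by (subst nn_integral_point_measure_finite) (auto simp: is_pomdp_def distribution_on_def)

lemma nn_integral_traj_law_0:
  assumes I: "is_pomdp I" and st: "distribution_on (states I) (stationary_dist I p)"
    and F: "F \<in> borel_measurable (traj_space I 0)"
  shows "(\<integral>\<^sup>+ u. F u \<partial>traj_law I p 0) =
    (\<Sum>s\<in>states I. ennreal (stationary_dist I p s) * F (\<lambda>_. undefined, s))"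
proof -
  have "(\<lambda>s. (\<lambda>_. undefined, s)) \<in> measurable (state_space I) (traj_space I 0)"
    by (simp add: space_PiM)
  moreover have "sets (stationary_state_law I p) = sets (state_space I)"
    using prob_algebra_state_law[OF I st] by (simp add: space_prob_algebra)
  ultimately have m: "(\<lambda>s. (\<lambda>_. undefined, s)) \<in> measurable (stationary_state_law I p) (traj_space I 0)"
    using measurable_cong_sets by blast
  show ?thesis
    unfolding traj_law.simps
    by (subst nn_integral_distr[OF m]) (use F nn_integral_state_law[OF I st] in auto)
qed

lemma nn_integral_stationary_law:
  assumes I: "is_pomdp I" and p: "policy (obs_states I) (n_actions I) p"
    and st: "distribution_on (states I) (stationary_dist I p)"
    and F: "F \<in> borel_measurable (obs_space I)"
  shows "(\<integral>\<^sup>+ u. F u \<partial>stationary_law I p) =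
    (\<Sum>(x, h)\<in>states I. ennreal (stationary_dist I p (x, h)) * (\<Sum>w\<in>actions I. ennreal (p x w) *
      (\<integral>\<^sup>+ (y, x', h'). F (x, h, w, y) \<partial>kernel I (x, h, w))))"
    and "sets (stationary_law I p) = sets (obs_space I)"
proof -
  have sets: "sets (stationary_state_law I p) = sets (state_space I)"
    using prob_algebra_state_law[OF I st] by (simp add: space_prob_algebra)
  \<comment> \<open>A dummy unit component plays the part of the record, so that the generic period
    applies.\<close>
  let ?upd = "\<lambda>(_::unit, x::nat, h::nat) (w::nat) (y::real, x'::nat, h'::nat). (x, h, w, y)"
  have "(\<lambda>(\<omega>, z). ?upd (\<omega>, x, h) w z) \<in> measurable (return (count_space UNIV) () \<Otimes>\<^sub>M (borel \<Otimes>\<^sub>M state_space I)) (obs_space I)"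
    if "x \<in> obs_states I" "h \<in> hid_states I" "w \<in> actions I" for x h w
  proof -
    have [measurable]: "x \<in> space (count_space (obs_states I))" "h \<in> space (count_space (hid_states I))"
     "w \<in> space (count_space (actions I))" using that by auto
    show ?thesis unfolding case_prod_unfold by measurable
  qed
  note upd = this
  let ?N = "distr (stationary_state_law I p) (return (count_space UNIV) () \<Otimes>\<^sub>M state_space I) (\<lambda>s. ((), s))"
  let ?K = "\<lambda>(\<omega>, x, h). action_law I p x \<bind> (\<lambda>w. kernel I (x, h, w) \<bind> (\<lambda>z. return (obs_space I) (?upd (\<omega>, x, h) w z)))"
  have m: "(\<lambda>s. ((), s)) \<in> measurable (stationary_state_law I p) (return (count_space UNIV) () \<Otimes>\<^sub>M state_space I)"
    unfolding measurable_cong_sets[OF sets refl] by measurable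
  have Km: "?K \<in> measurable (return (count_space UNIV) () \<Otimes>\<^sub>M state_space I) (prob_algebra (obs_space I))"
    using upd by (intro action_step_measurable[OF I p])
  have eq: "stationary_law I p = ?N \<bind> ?K"
    unfolding stationary_law_def
    using prob_algebra_state_law[OF I st]
    by (subst bind_distr[OF m measurable_prob_algebraD[OF Km]])
       (auto simp: case_prod_unfold space_prob_algebra dest: prob_space.not_empty)
  have "?N \<in> space (prob_algebra (return (count_space UNIV) () \<Otimes>\<^sub>M state_space I))"
    using prob_algebra_state_law[OF I st] prob_space.prob_space_distr[OF _ m] by (simp add: space_prob_algebra)
  from bind_in_prob_algebra[OF this Km]
  show "sets (stationary_law I p) = sets (obs_space I)" unfolding eq
    by (simp only: space_prob_algebra mem_Collect_eq)
  have "(\<integral>\<^sup>+ u. F u \<partial>stationary_law I p) = (\<integral>\<^sup>+ (\<omega>, x, h). (\<Sum>w\<in>actions I. ennreal (p x w) *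
            (\<integral>\<^sup>+ z. F (?upd (\<omega>, x, h) w z) \<partial>kernel I (x, h, w))) \<partial>?N)"
    unfolding eq by (rule nn_integral_action_step[OF I p upd sets_distr F])
  also have "\<dots> = (\<integral>\<^sup>+ (x, h). (\<Sum>w\<in>actions I. ennreal (p x w) *
            (\<integral>\<^sup>+ (y, x', h'). F (x, h, w, y) \<partial>kernel I (x, h, w))) \<partial>stationary_state_law I p)"
  proof -
    have cnt: "return (count_space UNIV) () \<Otimes>\<^sub>M state_space I = return (count_space UNIV) () \<Otimes>\<^sub>M count_space (states I)"
      using I by (simp add: is_pomdp_def pair_measure_countable countable_finite)
    have "sets (return (count_space UNIV) () \<Otimes>\<^sub>M state_space I) = sets (count_space UNIV \<Otimes>\<^sub>M count_space (states I))"
      unfolding cnt by (rule sets_pair_measure_cong) simp_all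
    also have "\<dots> = sets (count_space (UNIV \<times> states I))"
      using I by (subst pair_measure_countable) (auto simp: is_pomdp_def countable_finite)
    finally have s: "sets (return (count_space UNIV) () \<Otimes>\<^sub>M state_space I) = sets (count_space (UNIV \<times> states I))" .
    have "(\<lambda>(\<omega>, x, h). \<Sum>w\<in>actions I. ennreal (p x w) * (\<integral>\<^sup>+ z. F (?upd (\<omega>, x, h) w z) \<partial>kernel I (x, h, w)))
       \<in> borel_measurable (return (count_space UNIV) () \<Otimes>\<^sub>M state_space I)"
      unfolding measurable_cong_sets[OF s refl] by simp
    then show ?thesis
      by (subst nn_integral_distr[OF m]) (simp_all add: case_prod_unfold)
  qed
  also have "\<dots> = (\<Sum>(x, h)\<in>states I. ennreal (stationary_dist I p (x, h)) * (\<Sum>w\<in>actions I. ennreal (p x w) *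
      (\<integral>\<^sup>+ (y, x', h'). F (x, h, w, y) \<partial>kernel I (x, h, w))))"
    by (subst nn_integral_state_law[OF I st]) (auto simp: case_prod_unfold intro!: sum.cong)
  finally show "(\<integral>\<^sup>+ u. F u \<partial>stationary_law I p) =
    (\<Sum>(x, h)\<in>states I. ennreal (stationary_dist I p (x, h)) * (\<Sum>w\<in>actions I. ennreal (p x w) *
      (\<integral>\<^sup>+ (y, x', h'). F (x, h, w, y) \<partial>kernel I (x, h, w))))" .
qed

section \<open>Two-action policies and recorded data\<close>

definition two_policy :: "real \<Rightarrow> nat \<Rightarrow> nat \<Rightarrow> real" where
  "two_policy a x w = (if w = 1 then a else 1 - a)"

lemma policy_two_policy: "0 \<le> a \<Longrightarrow> a \<le> 1 \<Longrightarrow> policy {0} 2 (two_policy a)"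
  by (auto simp: policy_def two_policy_def numeral_2_eq_2)

lemma sum_two: "(\<Sum>w = 1..2. f w) = f 1 + f (2 :: nat)"
  by (simp add: numeral_2_eq_2)

lemma nn_integral_bernoulli_ennreal:
  assumes "0 \<le> p" "p \<le> 1" "\<And>b. 0 \<le> f b"
  shows "(\<integral>\<^sup>+ b. ennreal (f b) \<partial>bernoulli_pmf p) = ennreal (p * f True + (1 - p) * f False)"
  using assms by (simp add: nn_integral_bernoulli_pmf mult.commute ennreal_mult)

lemma observed_measurable:
  "observed t \<in> measurable (\<Pi>\<^sub>M s\<in>{1..t}. count_space X \<Otimes>\<^sub>M count_space Y \<Otimes>\<^sub>M count_space {1..A} \<Otimes>\<^sub>M borel) (data_space X A t)"
  unfolding observed_def
proof (rule measurable_restrict)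
  fix i assume i: "i \<in> {1..t}"
  show "(\<lambda>\<omega>. case \<omega> i of (x, h, w, y) \<Rightarrow> (x, w, y)) \<in> measurable (\<Pi>\<^sub>M s\<in>{1..t}. count_space X \<Otimes>\<^sub>M count_space Y \<Otimes>\<^sub>M count_space {1..A} \<Otimes>\<^sub>M borel)
     (count_space X \<Otimes>\<^sub>M count_space {1..A} \<Otimes>\<^sub>M borel)"
    by (rule measurable_compose[OF measurable_component_singleton[OF i]]) measurable
qed

lemma observed_upd: "observed (Suc t) (fun_upd \<omega> (Suc t) (x, h, w, y)) = (observed t \<omega>)(Suc t := (x, w, y))"
  by (auto simp: observed_def fun_eq_iff)

lemma data_upd_measurable:
  assumes "x \<in> X" "w \<in> {1..A}"
  shows "(\<lambda>d. d(Suc t := (x, w, y))) \<in> measurable (data_space X A t) (data_space X A (Suc t))"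
proof -
  have eq: "{1..Suc t} = insert (Suc t) {1..t}" by auto
  have [measurable]: "x \<in> space (count_space X)" "w \<in> space (count_space {1..A})" using assms by auto
  show ?thesis unfolding eq by measurable
qed

section \<open>The construction and its filter\<close>

text \<open>
  \<open>Fresh\<close> is the state after a reset, \<open>Hold u\<close> keeps the last bit \<open>u\<close> without redrawing it, and
  \<open>Late n u\<close> redraws \<open>u\<close> with probability \<open>q\<close>, where \<open>n\<close> counts the late periods since the last action
  other than 1, up to \<open>L\<close>.  In \<open>Late 0\<close> the bit is always redrawn and the stored one is a dummy.
\<close>

datatype hid = Fresh | Hold bool | Late nat bool

instance hid :: countable
  by countable_datatype

abbreviation sgn_bit :: "bool \<Rightarrow> real" where
  "sgn_bit b \<equiv> (if b then 1 else - 1)"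

text \<open>
  A letter is an augmented observation (action 1 played?, bit redrawn?, bit).  A filter state
  \<open>(N, l, w, y)\<close> consists of the likelihood-weighted masses \<open>N\<close> of the states that are not late and
  \<open>l n\<close> of \<open>Late n _\<close> after the emission of the last letter, and of action and bit of that letter.
\<close>

type_synonym letter = "bool \<times> bool \<times> bool"
type_synonym filt = "real \<times> (nat \<Rightarrow> real) \<times> bool \<times> bool"

text \<open>\<open>Hold\<close> redraws with probability \<open>e\<close>.  This is 0 when \<open>q < 1\<close>; for \<open>q = 1\<close> the state is
  unreachable, but a bit that is kept would still violate the bound on conditional means if \<open>c > M1\<close>.\<close>

locale design =
  fixes r q \<delta> e :: real and L :: nat
  assumes r0: "0 < r" and rq: "r < q" and q1: "q \<le> 1" and e0: "0 \<le> e" and e1: "e \<le> 1"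
    and qe: "(1 - q) * e = 0" and d0: "0 \<le> \<delta>" and d1: "\<delta> \<le> 3 / 10" and L2: "2 \<le> L"
begin

definition prob_up :: "real \<Rightarrow> hid \<Rightarrow> bool \<Rightarrow> real" where
  "prob_up s h w = (case h of Fresh \<Rightarrow> 1 / 2
     | Hold u \<Rightarrow> e / 2 + (1 - e) * of_bool u
     | Late n u \<Rightarrow> (if n = 0 then 1 / 2
          else q * (1 + s * \<delta> * of_bool (n = L \<and> w)) / 2 + (1 - q) * of_bool u))"

text \<open>The expectation of \<open>G\<close> at the next hidden state. The weight
  \<open>q - r\<close> of entering lateness and the split \<open>r / q\<close> after another action
  are matched so that the share \<open>r / q\<close> of non-late states is preserved. At that share,
  a bit following action 1 is redrawn with probability \<open>q\<close>.\<close>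

definition next_op :: "hid \<Rightarrow> bool \<Rightarrow> bool \<Rightarrow> (hid \<Rightarrow> real) \<Rightarrow> real" where
  "next_op h w y G = (if w then r * G Fresh +
      (case h of Late n u \<Rightarrow> (1 - r) * G (Late (min (Suc n) L) y)
        | _ \<Rightarrow> (q - r) * G (Late 1 y) + (1 - q) * G (Hold y))
    else r / q * G Fresh + (1 - r / q) * G (Late 0 False))"

definition kern_op :: "real \<Rightarrow> hid \<Rightarrow> bool \<Rightarrow> (bool \<Rightarrow> hid \<Rightarrow> real) \<Rightarrow> real" where
  "kern_op s h w G = prob_up s h w * next_op h w True (G True)
     + (1 - prob_up s h w) * next_op h w False (G False)"

fun mass :: "filt \<Rightarrow> real" where
  "mass (N, l, w, y) = N + (\<Sum>n\<le>L. l n)"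

text \<open>The masses of the late states after the transition that follows the last letter, before
  the next bit is seen.\<close>

fun late_pred :: "filt \<Rightarrow> nat \<Rightarrow> real" where
  "late_pred (N, l, w, y) j = (if w then
     (if j = 0 \<or> j > L then 0 else (if j = 1 then (q - r) * N else 0) + (1 - r) * l (j - 1)
        + (if j = L then (1 - r) * l L else 0))
     else if j = 0 then (1 - r / q) * mass (N, l, w, y) else 0)"

text \<open>Unnormalized Bayes update: each predicted mass is multiplied by its likelihood divided
  by the base probability of the letter. Following action 1, a redraw leaves the non-late mass of
  \<open>Fresh\<close>, which is \<open>r * mass\<close> times \<open>(1 / 2) / (q / 2)\<close>; a
  kept bit leaves that of \<open>Hold\<close>, where the factors \<open>1 - q\<close>
  cancel.\<close>

fun fstep :: "real \<Rightarrow> filt \<Rightarrow> letter \<Rightarrow> filt" where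
  "fstep s (N, l, w, y) (w', m, y') =
     (if w \<and> \<not> m then N else r / q * mass (N, l, w, y),
      \<lambda>j. late_pred (N, l, w, y) j * (if j = L \<and> m \<and> w' then 1 + s * \<delta> * sgn_bit y' else 1),
      w', y')"

text \<open>The law of the next letter for \<open>\<delta> = 0\<close>. It depends on the filter
  state only through the last action and bit, which makes it a common reference for both
  signs.\<close>

fun base :: "real \<Rightarrow> filt \<Rightarrow> letter \<Rightarrow> real" where
  "base a (N, l, w, y) (w', m, y') = (if w' then a else 1 - a) *
     (if w then (if m then q / 2 else if y' = y then 1 - q else 0) else if m then 1 / 2 else 0)"

definition avg :: "real \<Rightarrow> filt \<Rightarrow> (letter \<Rightarrow> real) \<Rightarrow> real" where
  "avg a P g = (\<Sum>w\<in>UNIV. \<Sum>m\<in>UNIV. \<Sum>y\<in>UNIV. base a P (w, m, y) * g (w, m, y))"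

fun pred :: "filt \<Rightarrow> (hid \<Rightarrow> real) \<Rightarrow> real" where
  "pred (N, l, w, y) G =
     (if w then r * mass (N, l, w, y) * G Fresh + (1 - q) * N * G (Hold y)
      else r / q * mass (N, l, w, y) * G Fresh)
     + (\<Sum>j\<le>L. late_pred (N, l, w, y) j * G (Late j (w \<and> y)))"

section \<open>Prediction and Bayes' rule for the filter\<close>

lemma r1: "r < 1" using rq q1 by simp
lemma q0: "0 < q" using r0 rq by simp

lemma sum_shift: "(\<Sum>j\<le>L. (if j = 0 then 0 else f (j - 1) j)) = (\<Sum>n<L. f n (Suc n) :: real)"
proof -
  obtain k where L: "L = Suc k" using L2 by (cases L) auto
  show ?thesis unfolding L sum.atMost_Suc_shift lessThan_Suc_atMost by simp
qed

lemma sum_late_pred_mismatch: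
  assumes "\<not> w"
  shows "(\<Sum>j\<le>L. late_pred (N, l, w, y) j * X j) = (1 - r / q) * mass (N, l, w, y) * X 0"
proof -
  have "(\<Sum>j\<le>L. late_pred (N, l, w, y) j * X j) = (\<Sum>j\<le>L. if j = 0 then (1 - r / q) * mass (N, l, w, y) * X j else 0)"
    using assms by (intro sum.cong) auto
  then show ?thesis by simp
qed

text \<open>Transitions depend neither on the stored bit nor on the difference between
  \<open>Fresh\<close> and \<open>Hold\<close>. Hence prediction may start from the masses after
  emission, with representatives \<open>Fresh\<close> and \<open>Late n False\<close>.\<close>

lemma pred_post: "pred (N, l, w, y) G = N * next_op Fresh w y G + (\<Sum>n\<le>L. l n * next_op (Late n False) w y G)"
proof (cases w)
  case True
  have "(\<Sum>j\<le>L. late_pred (N, l, w, y) j * G (Late j (w \<and> y)))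
    = (\<Sum>j\<le>L. (if j = 1 then (q - r) * N * G (Late 1 y) else 0))
     + (\<Sum>j\<le>L. (if j = 0 then 0 else (1 - r) * l (j - 1) * G (Late j y)))
     + (\<Sum>j\<le>L. (if j = L then (1 - r) * l L * G (Late L y) else 0))"
    unfolding sum.distrib[symmetric] using True L2
    by (intro sum.cong) (auto simp: algebra_simps)
  also have "(\<Sum>j\<le>L. (if j = 0 then 0 else (1 - r) * l (j - 1) * G (Late j y)))
     = (\<Sum>n<L. (1 - r) * l n * G (Late (Suc n) y))"
    using sum_shift[of "\<lambda>n j. (1 - r) * l n * G (Late j y)"] by simp
  also have "\<dots> = (\<Sum>n<L. (1 - r) * l n * G (Late (min (Suc n) L) y))"
    by (intro sum.cong) (auto simp: min_def)
  finally have A: "(\<Sum>j\<le>L. late_pred (N, l, w, y) j * G (Late j (w \<and> y)))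
    = (q - r) * N * G (Late 1 y) + (\<Sum>n\<le>L. (1 - r) * l n * G (Late (min (Suc n) L) y))"
    using L2 by (simp add: lessThan_Suc_atMost[symmetric])
  show ?thesis
    unfolding pred.simps A next_op_def using True
    by (simp add: algebra_simps sum.distrib sum_distrib_left sum_subtractf)
next
  case False
  then show ?thesis
    unfolding pred.simps sum_late_pred_mismatch[OF False]
    by (simp add: next_op_def flip: sum_distrib_right) (simp add: algebra_simps add_divide_distrib)
qed

text \<open>Prediction applied to the indicator of lateness.\<close>

lemma sum_late_pred: "(\<Sum>j\<le>L. late_pred (N, l, w, y) j) =
   (if w then (q - r) * N + (1 - r) * (\<Sum>n\<le>L. l n) else (1 - r / q) * mass (N, l, w, y))"
  using pred_post[of N l w y "\<lambda>h. case h of Late n u \<Rightarrow> 1 | _ \<Rightarrow> 0"]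
  by (simp add: next_op_def sum_distrib_left mult.commute algebra_simps sum_divide_distrib sum.distrib split: if_splits)

lemma avg_expand:
  "avg a (N, l, w, y) g = (if w then
     (q / 2) * (a * g (True, True, True) + a * g (True, True, False)
       + (1 - a) * g (False, True, True) + (1 - a) * g (False, True, False))
     + (1 - q) * (a * g (True, False, y) + (1 - a) * g (False, False, y))
   else (a * g (True, True, True) + a * g (True, True, False)
       + (1 - a) * g (False, True, True) + (1 - a) * g (False, True, False)) / 2)"
  by (cases y) (auto simp: avg_def UNIV_bool algebra_simps add_divide_distrib diff_divide_distrib)

text \<open>Bayes' rule: predicting one step ahead agrees with updating by the next letter.\<close>

lemma filter_consistent:
  "pred P (\<lambda>h. a * kern_op s h True (G True) + (1 - a) * kern_op s h False (G False))
   = avg a P (\<lambda>(w, m, y). pred (fstep s P (w, m, y)) (G w y))"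
proof -
  obtain N l w y where P: "P = (N, l, w, y)" by (cases P)
  have nL: "next_op (Late j u) w y G = next_op (Late j False) w y G" for j u w y G
    by (simp add: next_op_def)
  have nH: "next_op (Hold u) w y G = next_op Fresh w y G" for u w y G
    by (simp add: next_op_def)
  let ?lp = "late_pred (N, l, w, y)"
  have pf: "pred (fstep s (N, l, w, y) (w', m, y')) G' =
     (if w \<and> \<not> m then N else r / q * mass (N, l, w, y)) * next_op Fresh w' y' G'
     + (\<Sum>j\<le>L. ?lp j * (if j = L \<and> m \<and> w' then 1 + s * \<delta> * sgn_bit y' else 1) * next_op (Late j False) w' y' G')"
    for w' m y' G'
    by (simp only: fstep.simps pred_post)
  show ?thesis
  proof (cases w)
    case True
    have L1: "late_pred (N, l, w, y) j *
        (a * kern_op s (Late j (w \<and> y)) True (G True) + (1 - a) * kern_op s (Late j (w \<and> y)) False (G False))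
      = (q / 2) * (a * (?lp j * (if j = L then 1 + s * \<delta> else 1) * next_op (Late j False) True True (G True True))
           + a * (?lp j * (if j = L then 1 - s * \<delta> else 1) * next_op (Late j False) True False (G True False))
           + (1 - a) * (?lp j * next_op (Late j False) False True (G False True))
           + (1 - a) * (?lp j * next_op (Late j False) False False (G False False)))
       + (1 - q) * (a * (?lp j * next_op (Late j False) True y (G True y))
           + (1 - a) * (?lp j * next_op (Late j False) False y (G False y)))" for j
    proof (cases "j = 0")
      case False
      then show ?thesis
        unfolding kern_op_def nL[of j "w \<and> y"] by (cases y) (auto simp: prob_up_def True field_simps)
    qed (simp add: True)
    have H: "(1 - q) * N * (a * kern_op s (Hold y) True (G True) + (1 - a) * kern_op s (Hold y) False (G False))
      = (1 - q) * (a * (N * next_op Fresh True y (G True y)) + (1 - a) * (N * next_op Fresh False y (G False y)))"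
    proof -
      \<comment> \<open>The base law never redraws a bit in \<open>Hold\<close>. This agrees with
        the kernel, since either \<open>e = 0\<close> or the mass \<open>(1 - q) * N\<close>
        vanishes.\<close>
      have "q = 1 \<or> e = 0" using qe by auto
      then show ?thesis unfolding kern_op_def nH
        by (cases y) (auto simp: prob_up_def algebra_simps)
    qed
    have F: "r * mass P * (a * kern_op s Fresh True (G True) + (1 - a) * kern_op s Fresh False (G False))
      = (q / 2) * (a * (r / q * mass P * next_op Fresh True True (G True True))
           + a * (r / q * mass P * next_op Fresh True False (G True False))
           + (1 - a) * (r / q * mass P * next_op Fresh False True (G False True))
           + (1 - a) * (r / q * mass P * next_op Fresh False False (G False False)))"
      using q0 by (simp add: kern_op_def prob_up_def field_simps)
    have sumL: "(\<Sum>j\<le>L. ?lp j *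
        (a * kern_op s (Late j (w \<and> y)) True (G True) + (1 - a) * kern_op s (Late j (w \<and> y)) False (G False)))
      = (q / 2) * (a * (\<Sum>j\<le>L. ?lp j * (if j = L then 1 + s * \<delta> else 1) * next_op (Late j False) True True (G True True))
           + a * (\<Sum>j\<le>L. ?lp j * (if j = L then 1 - s * \<delta> else 1) * next_op (Late j False) True False (G True False))
           + (1 - a) * (\<Sum>j\<le>L. ?lp j * next_op (Late j False) False True (G False True))
           + (1 - a) * (\<Sum>j\<le>L. ?lp j * next_op (Late j False) False False (G False False)))
       + (1 - q) * (a * (\<Sum>j\<le>L. ?lp j * next_op (Late j False) True y (G True y))
           + (1 - a) * (\<Sum>j\<le>L. ?lp j * next_op (Late j False) False y (G False y)))"
      unfolding L1 by (simp only: sum.distrib flip: sum_distrib_left)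
    define X where "X = r / q * mass (N, l, w, y)"
    define T where "T w' y' = (\<Sum>j\<le>L. ?lp j * next_op (Late j False) w' y' (G w' y'))" for w' y'
    define TU where "TU = (\<Sum>j\<le>L. ?lp j * (if j = L then 1 + s * \<delta> else 1) * next_op (Late j False) True True (G True True))"
    define TD where "TD = (\<Sum>j\<le>L. ?lp j * (if j = L then 1 - s * \<delta> else 1) * next_op (Late j False) True False (G True False))"
    have p: "pred (fstep s (N, l, w, y) (True, True, True)) (G True True) = X * next_op Fresh True True (G True True) + TU"
       "pred (fstep s (N, l, w, y) (True, True, False)) (G True False) = X * next_op Fresh True False (G True False) + TD"
       "pred (fstep s (N, l, w, y) (False, True, y')) (G False y') = X * next_op Fresh False y' (G False y') + T False y'"
       "pred (fstep s (N, l, w, y) (w', False, y')) (G w' y') = N * next_op Fresh w' y' (G w' y') + T w' y'" for w' y'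
      unfolding pf X_def T_def TU_def TD_def using True
      by (auto simp del: late_pred.simps mass.simps intro!: sum.cong)
    show ?thesis
      unfolding P pred.simps[of N l w y] avg_expand sumL prod.case p if_P[OF True] H F[unfolded P]
        T_def[symmetric] TU_def[symmetric] TD_def[symmetric] X_def[symmetric]
      by (simp add: algebra_simps)
  next
    case False
    \<comment> \<open>No bias can occur right after another action: all late mass then has counter
      0, and \<open>2 \<le> L\<close>.\<close>
    have S': "(\<Sum>j\<le>L. ?lp j * (if j = L \<and> b then c else 1) * X j) = (1 - r / q) * mass P * X 0" for X :: "nat \<Rightarrow> real" and b c
      using sum_late_pred_mismatch[OF False, of N l y "\<lambda>j. (if j = L \<and> b then c else 1) * X j"] L2
      by (simp add: mult.assoc P)
    define X Y where XY: "X = r / q * mass (N, l, w, y)" "Y = (1 - r / q) * mass (N, l, w, y)"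
    have K: "kern_op s Fresh w' H = (next_op Fresh w' True (H True) + next_op Fresh w' False (H False)) / 2"
      "kern_op s (Late 0 u) w' H = (next_op (Late 0 False) w' True (H True) + next_op (Late 0 False) w' False (H False)) / 2"
      for w' u H by (simp_all add: kern_op_def prob_up_def nL[of 0 u] add_divide_distrib)
    show ?thesis
      unfolding P pred.simps[of N l w y] avg_expand sum_late_pred_mismatch[OF False] prod.case pf S'[unfolded P] K
        XY[symmetric]
      using False by (simp add: algebra_simps add_divide_distrib diff_divide_distrib)
  qed
qed

subsection \<open>Second moments of the likelihood ratio: one step\<close>

text \<open>
  For \<open>\<delta> = 0\<close> a share \<open>r / q\<close> of the mass is never late, whatever the data.  \<open>weak\<close> measures the
  deviation that the biased bits cause; it contracts, so that adding its square makes the second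
  moment of the mass a Lyapunov function.
\<close>

fun weak :: "filt \<Rightarrow> real" where
  "weak (N, l, w, y) = N - r / q * mass (N, l, w, y)"

fun potential :: "filt \<Rightarrow> real" where
  "potential (N, l, w, y) = (mass (N, l, w, y))\<^sup>2 + (if w then (1 - q) * (weak (N, l, w, y))\<^sup>2 else 0)"

text \<open>Tails over the counter turn the advance by one, including the cap at \<open>L\<close>,
  into a plain shift.\<close>

definition tail_pred :: "nat \<Rightarrow> filt \<Rightarrow> real" where
  "tail_pred j P = (\<Sum>n=j..L. late_pred P n)"

fun valid :: "filt \<Rightarrow> bool" where
  "valid (N, l, w, y) \<longleftrightarrow> 0 \<le> N \<and> (\<forall>n\<le>L. 0 \<le> l n)"

lemma late_pred_nonneg:
  assumes "valid P" "n \<le> L" shows "0 \<le> late_pred P n"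
proof -
  obtain N l w y where P: "P = (N, l, w, y)" by (cases P)
  have "0 \<le> sum l {..L}" "0 \<le> N" "0 \<le> 1 - r / q" using assms rq q0 by (auto simp: P intro!: sum_nonneg)
  then show ?thesis using assms rq r1 by (auto simp: P)
qed

lemma valid_fstep:
  assumes "valid P" "\<bar>s\<bar> = 1" shows "valid (fstep s P o')"
proof -
  obtain N l w y where P: "P = (N, l, w, y)" by (cases P)
  obtain w' m y' where o: "o' = (w', m, y')" by (cases o')
  have "0 \<le> sum l {..L}" "0 \<le> N" using assms by (auto simp: P intro!: sum_nonneg)
  then have "0 \<le> r / q * mass (N, l, w, y)" using r0 q0 by simp
  moreover have "0 \<le> late_pred (N, l, w, y) n" if "n \<le> L" for n using late_pred_nonneg[OF assms(1) that] P by simp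
  moreover have "0 \<le> 1 + s * \<delta> * sgn_bit y'" using assms(2) d1 d0 by (auto simp: abs_if split: if_splits)
  ultimately show ?thesis using \<open>0 \<le> N\<close> by (simp add: P o del: late_pred.simps mass.simps)
qed

lemma mass_nonneg: "valid P \<Longrightarrow> 0 \<le> mass P"
  by (cases P) (auto intro!: add_nonneg_nonneg sum_nonneg)

lemma sum_tilt:
  assumes "k \<le> L"
  shows "(\<Sum>j=k..L. f j * (if j = L \<and> b then 1 + x else 1)) = (\<Sum>j=k..L. f j) + (if b then f L * x else (0::real))"
proof -
  have "(\<Sum>j=k..L. f j * (if j = L \<and> b then 1 + x else 1)) = (\<Sum>j=k..L. f j + (if j = L then if b then f L * x else 0 else 0))"
    by (intro sum.cong) (auto simp: algebra_simps)
  then show ?thesis using assms by (simp add: sum.distrib)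
qed

text \<open>Apart from the bias, a redraw or a kept bit changes the mass only in so far as the
  non-late share deviates from \<open>r / q\<close>. The bias adds a term that is odd in the new
  bit.\<close>

lemma mass_fstep:
  "mass (fstep s (N, l, w, y) (w', m, y')) =
     (if w then (if m then mass (N, l, w, y) - (1 - q) * weak (N, l, w, y)
        else mass (N, l, w, y) + q * weak (N, l, w, y)) else mass (N, l, w, y))
      + (if m \<and> w' then late_pred (N, l, w, y) L * (s * \<delta> * sgn_bit y') else 0)"
proof -
  have "mass (fstep s (N, l, w, y) (w', m, y')) = (if w \<and> \<not> m then N else r / q * mass (N, l, w, y)) +
     (\<Sum>j\<le>L. late_pred (N, l, w, y) j) + (if m \<and> w' then late_pred (N, l, w, y) L * (s * \<delta> * sgn_bit y') else 0)"
    using sum_tilt[of 0 "late_pred (N, l, w, y)" "m \<and> w'" "s * \<delta> * sgn_bit y'"]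
    unfolding fstep.simps mass.simps[of "if _ then _ else _"] atLeast0AtMost by simp
  then show ?thesis
    unfolding sum_late_pred using q0 by (auto simp: field_simps)
qed

text \<open>A redraw sets the non-late mass to its share of the old total, so only the change of the
  total remains; a kept bit damps the deviation by \<open>1 - r\<close>.\<close>

lemma weak_fstep:
  assumes w
  shows "weak (fstep s (N, l, w, y) (w', m, y')) =
     (if m then r / q * ((1 - q) * weak (N, l, w, y)
          - (if w' then late_pred (N, l, w, y) L * (s * \<delta> * sgn_bit y') else 0))
      else (1 - r) * weak (N, l, w, y))"
proof -
  have "weak (fstep s (N, l, w, y) (w', m, y')) = (if w \<and> \<not> m then N else r / q * mass (N, l, w, y))
     - r / q * mass (fstep s (N, l, w, y) (w', m, y'))"
    by (simp only: fstep.simps weak.simps)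
  note H = this[unfolded mass_fstep]
  have rq': "r / q * (q * x) = r * x" for x using q0 by simp
  show ?thesis
  proof (cases m)
    case True
    then show ?thesis unfolding H using assms by (simp only: if_True if_False simp_thms) (simp add: algebra_simps del: weak.simps mass.simps late_pred.simps)
  next
    case False
    have "weak (fstep s (N, l, w, y) (w', m, y')) = N - r / q * (mass (N, l, w, y) + q * weak (N, l, w, y))"
      unfolding H using assms False by simp
    also have "\<dots> = N - r / q * mass (N, l, w, y) - r * weak (N, l, w, y)"
      by (simp only: distrib_left rq' diff_diff_eq)
    also have "\<dots> = (1 - r) * weak (N, l, w, y)"
      by (simp only: weak.simps left_diff_distrib mult_1_left)
    finally show ?thesis using False by (simp only: if_False)
  qed
qed

text \<open>A counter of at least \<open>j\<close> was at least \<open>j - 1\<close> one period ago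
  and escaped the reset. For \<open>j = 1\<close> there would be an inflow from the non-late states,
  hence \<open>2 \<le> j\<close>.\<close>

lemma tail_fstep:
  assumes "2 \<le> j" "j \<le> L"
  shows "tail_pred j (fstep s (N, l, w, y) (w', m, y')) = (if w' then
     (1 - r) * (tail_pred (j - 1) (N, l, w, y) + (if m then late_pred (N, l, w, y) L * (s * \<delta> * sgn_bit y') else 0)) else 0)"
proof (cases w')
  case True
  define f where "f = (\<lambda>n. late_pred (N, l, w, y) n * (if n = L \<and> m \<and> w' then 1 + s * \<delta> * sgn_bit y' else 1))"
  obtain k where L: "L = Suc k" using L2 by (cases L) auto
  obtain i where j: "j = Suc i" using assms by (cases j) auto
  have "tail_pred j (fstep s (N, l, w, y) (w', m, y')) = (\<Sum>n=j..L. (1 - r) * f (n - 1) + (if n = L then (1 - r) * f L else 0))"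
    unfolding tail_pred_def fstep.simps f_def[symmetric]
    using True assms by (intro sum.cong) auto
  also have "\<dots> = (\<Sum>n=j..L. (1 - r) * f (n - 1)) + (1 - r) * f L"
    using assms by (simp add: sum.distrib)
  also have "(\<Sum>n=j..L. (1 - r) * f (n - 1)) = (\<Sum>n=i..k. (1 - r) * f n)"
    unfolding L j by (subst sum.shift_bounds_cl_Suc_ivl) simp
  also have "\<dots> + (1 - r) * f L = (1 - r) * (\<Sum>n=i..L. f n)"
    using assms unfolding L j by (simp add: sum_distrib_left algebra_simps)
  also have "(\<Sum>n=i..L. f n) = tail_pred i (N, l, w, y) + (if m then late_pred (N, l, w, y) L * (s * \<delta> * sgn_bit y') else 0)"
    unfolding f_def using sum_tilt[of i "late_pred (N, l, w, y)" "m \<and> w'" "s * \<delta> * sgn_bit y'"] assms True j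
    by (simp add: tail_pred_def)
  finally show ?thesis using True j by simp
next
  case False
  then show ?thesis using assms by (auto simp: tail_pred_def intro!: sum.neutral)
qed

lemma tail_pred_L: "tail_pred L P = late_pred P L"
  by (simp add: tail_pred_def)

lemma tail_mismatch: "\<not> w \<Longrightarrow> 1 \<le> j \<Longrightarrow> tail_pred j (N, l, w, y) = 0"
  by (auto simp: tail_pred_def intro!: sum.neutral)

text \<open>A likelihood ratio is a martingale under the base law: the bias cancels over the two
  values of a redrawn bit, and the \<open>weak\<close> terms cancel between redraw and keep.\<close>

lemma avg_mass: "avg a P (\<lambda>o'. mass (fstep s P o')) = mass P"
proof -
  obtain N l w y where P: "P = (N, l, w, y)" by (cases P)
  show ?thesis unfolding P avg_expand mass_fstep using L2
    by (cases w) (simp_all del: mass.simps weak.simps add: algebra_simps)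
qed

text \<open>The cross terms are odd in the redrawn bit and average out, so the squares add
  up.\<close>

lemma avg_tail:
  assumes "2 \<le> j" "j \<le> L" "\<bar>s\<bar> = 1"
  shows "avg a P (\<lambda>o'. (tail_pred j (fstep s P o'))\<^sup>2)
     = a * (1 - r)\<^sup>2 * ((tail_pred (j - 1) P)\<^sup>2 + q * \<delta>\<^sup>2 * (late_pred P L)\<^sup>2)"
proof -
  obtain N l w y where P: "P = (N, l, w, y)" by (cases P)
  have s2: "s * s = 1" "s * (s * x) = x" for x using assms(3) by (auto simp: abs_if split: if_splits)
  show ?thesis
  proof (cases w)
    case True
    then show ?thesis unfolding P avg_expand tail_fstep[OF assms(1,2)]
      by (simp del: late_pred.simps add: power2_eq_square algebra_simps s2)
  next
    case False
    then show ?thesis unfolding P avg_expand tail_fstep[OF assms(1,2)]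
      using assms L2 by (simp add: tail_mismatch)
  qed
qed

text \<open>The coefficient of the squared deviation after one period: the variance that it adds to
  the mass, plus what is left of the weighted deviation itself. The weight \<open>1 - q\<close>
  absorbs both.\<close>

lemma contraction: "(1 - q) * (q + (1 - q) * (r\<^sup>2 / q * (1 - q) + (1 - r)\<^sup>2)) \<le> 1 - q"
proof -
  have "r\<^sup>2 / q \<le> r" using r0 rq by (simp add: power2_eq_square divide_le_eq)
  moreover have "0 \<le> r\<^sup>2 / q" using q0 by simp
  ultimately have "r\<^sup>2 / q * (1 - q) \<le> r * 1" using q0 q1 r0 by (intro mult_mono) auto
  moreover have "(1 - r)\<^sup>2 \<le> 1 - r" using r0 r1 by (simp add: power2_eq_square mult_left_le_one_le)
  ultimately have "r\<^sup>2 / q * (1 - q) + (1 - r)\<^sup>2 \<le> 1" by simp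
  then have "(1 - q) * (r\<^sup>2 / q * (1 - q) + (1 - r)\<^sup>2) \<le> 1 - q"
    using q1 mult_left_le[of "r\<^sup>2 / q * (1 - q) + (1 - r)\<^sup>2" "1 - q"] by simp
  then have "q + (1 - q) * (r\<^sup>2 / q * (1 - q) + (1 - r)\<^sup>2) \<le> 1" by simp
  then show ?thesis using q1 mult_left_le[of _ "1 - q"] by simp
qed

text \<open>By \<open>contraction\<close> the terms in the deviation do not grow, so that only the
  bias injected at counter \<open>L\<close> remains.\<close>

lemma avg_potential:
  assumes "\<bar>s\<bar> = 1" "0 \<le> a" "a \<le> 1"
  shows "avg a P (\<lambda>o'. potential (fstep s P o'))
     \<le> potential P + a * ((q + (1 - q) * (r\<^sup>2 / q)) * \<delta>\<^sup>2) * (late_pred P L)\<^sup>2"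
proof -
  obtain N l w y where P: "P = (N, l, w, y)" by (cases P)
  have s2: "s * s = 1" "s * (s * x) = x" for x using assms(1) by (auto simp: abs_if split: if_splits)
  have pot: "potential (fstep s (N, l, w, y) (w', m, y')) = (mass (fstep s (N, l, w, y) (w', m, y')))\<^sup>2
     + (if w' then (1 - q) * (weak (fstep s (N, l, w, y) (w', m, y')))\<^sup>2 else 0)" for w' m y'
    by (simp only: fstep.simps potential.simps)
  show ?thesis
  proof (cases w)
    case True
    define Z D c where "Z = mass (N, l, w, y)" "D = weak (N, l, w, y)" "c = late_pred (N, l, w, y) L"
    have alg: "Z\<^sup>2 + q * (1 - q) * D\<^sup>2 + a * q * \<delta>\<^sup>2 * c\<^sup>2
       + a * (1 - q) * (X * ((1 - q)\<^sup>2 * D\<^sup>2 + \<delta>\<^sup>2 * c\<^sup>2) + (1 - q) * ((1 - r)\<^sup>2 * D\<^sup>2))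
      = Z\<^sup>2 + a * ((q + (1 - q) * (X)) * \<delta>\<^sup>2) * c\<^sup>2
         + (q * (1 - q) + a * ((1 - q) * ((1 - q) * (X * (1 - q) + (1 - r)\<^sup>2)))) * D\<^sup>2" for X :: real
      by (simp add: power2_eq_square algebra_simps)
    define R where "R = r / q"
    have "avg a P (\<lambda>o'. potential (fstep s P o')) = Z\<^sup>2 + q * (1 - q) * D\<^sup>2 + a * q * \<delta>\<^sup>2 * c\<^sup>2
       + a * (1 - q) * (q * (r / q)\<^sup>2 * ((1 - q)\<^sup>2 * D\<^sup>2 + \<delta>\<^sup>2 * c\<^sup>2) + (1 - q) * ((1 - r)\<^sup>2 * D\<^sup>2))"
      unfolding P avg_expand pot mass_fstep weak_fstep[OF True] Z_D_c_def[symmetric] R_def[symmetric] using True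
      by (simp add: power2_eq_square algebra_simps s2)
    also have "q * (r / q)\<^sup>2 = r\<^sup>2 / q" using q0 by (simp add: power2_eq_square)
    also note alg[of "r\<^sup>2 / q"]
    also have "Z\<^sup>2 + a * ((q + (1 - q) * (r\<^sup>2 / q)) * \<delta>\<^sup>2) * c\<^sup>2
         + (q * (1 - q) + a * ((1 - q) * ((1 - q) * (r\<^sup>2 / q * (1 - q) + (1 - r)\<^sup>2)))) * D\<^sup>2
       \<le> Z\<^sup>2 + a * ((q + (1 - q) * (r\<^sup>2 / q)) * \<delta>\<^sup>2) * c\<^sup>2 + (1 - q) * D\<^sup>2"
    proof -
      have "0 \<le> (1 - q) * ((1 - q) * (r\<^sup>2 / q * (1 - q) + (1 - r)\<^sup>2))" using q0 q1 by simp
      then have "a * ((1 - q) * ((1 - q) * (r\<^sup>2 / q * (1 - q) + (1 - r)\<^sup>2))) \<le> (1 - q) * ((1 - q) * (r\<^sup>2 / q * (1 - q) + (1 - r)\<^sup>2))"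
        using assms(2,3) by (intro mult_left_le_one_le)
      then have "q * (1 - q) + a * ((1 - q) * ((1 - q) * (r\<^sup>2 / q * (1 - q) + (1 - r)\<^sup>2))) \<le> 1 - q"
        using contraction by (simp add: algebra_simps)
      from mult_right_mono[OF this, of "D\<^sup>2"] show ?thesis by simp
    qed
    finally show ?thesis using True by (simp add: P Z_D_c_def del: mass.simps weak.simps late_pred.simps)
  next
    case False
    \<comment> \<open>Another action distributes all mass in the exact shares, so the deviation
      restarts at 0.\<close>
    have w0: "weak (fstep s (N, l, w, y) (w', True, y')) = 0" for w' y'
    proof -
      have "weak (fstep s (N, l, w, y) (w', True, y')) = r / q * mass (N, l, w, y)
         - r / q * mass (fstep s (N, l, w, y) (w', True, y'))"
        using False by (simp only: fstep.simps weak.simps simp_thms if_False)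
      also have "mass (fstep s (N, l, w, y) (w', True, y')) = mass (N, l, w, y)"
        unfolding mass_fstep using False L2 by simp
      finally show ?thesis by simp
    qed
    show ?thesis unfolding P avg_expand pot mass_fstep w0 using False L2
      by (simp del: mass.simps weak.simps add: algebra_simps)
  qed
qed

text \<open>The inflow from the non-late states enters with \<open>q - r \<le> 1 - r\<close>. Hence
  the whole tail is at most \<open>1 - r\<close> times the new mass, whose second moment the
  potential controls.\<close>

lemma avg_tail_1:
  assumes "\<bar>s\<bar> = 1" "0 \<le> a" "a \<le> 1" "valid P"
  shows "avg a P (\<lambda>o'. (tail_pred 1 (fstep s P o'))\<^sup>2)
     \<le> a * (1 - r)\<^sup>2 * (potential P + q * \<delta>\<^sup>2 * (late_pred P L)\<^sup>2)"
proof -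
  obtain N l w y where P: "P = (N, l, w, y)" by (cases P)
  have s2: "s * s = 1" "s * (s * x) = x" for x using assms(1) by (auto simp: abs_if split: if_splits)
  have t1: "tail_pred 1 Q = (\<Sum>j\<le>L. late_pred Q j) - late_pred Q 0" for Q
    using L2 by (simp add: tail_pred_def atMost_atLeast0 sum.atLeast_Suc_atMost)
  have ub: "(tail_pred 1 (fstep s P (w', m, y')))\<^sup>2 \<le> (if w' then (1 - r)\<^sup>2 * (mass (fstep s P (w', m, y')))\<^sup>2 else 0)" for w' m y'
  proof (cases w')
    case True
    obtain N' l' where Q: "fstep s P (w', m, y') = (N', l', w', y')" by (simp add: P)
    have v: "valid (N', l', w', y')" using valid_fstep[OF assms(4,1), of "(w', m, y')"] Q by simp
    then have nn: "0 \<le> N'" "0 \<le> sum l' {..L}" by (auto intro!: sum_nonneg)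
    have t: "tail_pred 1 (N', l', w', y') = (q - r) * N' + (1 - r) * sum l' {..L}"
      unfolding t1 sum_late_pred using True by simp
    have "(q - r) * N' \<le> (1 - r) * N'" using q1 nn by (intro mult_right_mono) auto
    then have "tail_pred 1 (N', l', w', y') \<le> (1 - r) * mass (N', l', w', y')"
      unfolding t by (simp add: algebra_simps)
    moreover have "0 \<le> tail_pred 1 (N', l', w', y')" unfolding t using nn rq r1 by simp
    ultimately have "(tail_pred 1 (N', l', w', y'))\<^sup>2 \<le> ((1 - r) * mass (N', l', w', y'))\<^sup>2"
      by (rule power_mono)
    then show ?thesis using True Q by (simp add: power_mult_distrib del: mass.simps)
  next
    case False
    then show ?thesis by (simp add: P tail_pred_def sum.neutral)
  qed
  have b: "0 \<le> base a P o'" for o' using assms q0 q1 by (cases o') (auto simp: P)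
  have "avg a P (\<lambda>o'. (tail_pred 1 (fstep s P o'))\<^sup>2) \<le> avg a P (\<lambda>(w', m, y'). if w' then (1 - r)\<^sup>2 * (mass (fstep s P (w', m, y')))\<^sup>2 else 0)"
    unfolding avg_def by (intro sum_mono mult_left_mono b) (use ub in auto)
  also have "\<dots> \<le> a * (1 - r)\<^sup>2 * (potential P + q * \<delta>\<^sup>2 * (late_pred P L)\<^sup>2)"
  proof (cases w)
    case True
    define Z D c where "Z = mass (N, l, w, y)" "D = weak (N, l, w, y)" "c = late_pred (N, l, w, y) L"
    have "avg a P (\<lambda>(w', m, y'). if w' then (1 - r)\<^sup>2 * (mass (fstep s P (w', m, y')))\<^sup>2 else 0)
      = a * (1 - r)\<^sup>2 * (Z\<^sup>2 + q * (1 - q) * D\<^sup>2 + q * \<delta>\<^sup>2 * c\<^sup>2)"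
      unfolding P avg_expand prod.case mass_fstep Z_D_c_def[symmetric] using True
      by (simp add: power2_eq_square algebra_simps s2)
    also have "\<dots> \<le> a * (1 - r)\<^sup>2 * (Z\<^sup>2 + (1 - q) * D\<^sup>2 + q * \<delta>\<^sup>2 * c\<^sup>2)"
      using assms q0 q1 by (intro mult_left_mono add_mono mult_right_mono) (auto simp: mult_left_le_one_le)
    finally show ?thesis using True by (simp add: P Z_D_c_def del: mass.simps weak.simps late_pred.simps)
  next
    case False
    then show ?thesis unfolding P avg_expand prod.case mass_fstep using L2
      by (simp del: mass.simps weak.simps)
  qed
  finally show ?thesis .
qed

subsection \<open>Second moments of the likelihood ratio: trajectories\<close>

text \<open>The stationary probability of being late with counter at least \<open>j\<close> when
  action 1 has probability \<open>a\<close>. Each further count costs \<open>a * (1 - r)\<close>;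
  the first costs only \<open>a\<close>, because the inflow from the non-late states makes up for
  the resets.\<close>

definition surv :: "real \<Rightarrow> nat \<Rightarrow> real" where
  "surv a j = (if j = 0 then 1 - r / q else (1 - r / q) * (1 - r) ^ (j - 1) * a ^ j)"

text \<open>The stationary bias of the bit emitted in \<open>Late L _\<close> under action 1; see \<open>tilt0_fix\<close> for the recursion that it solves.\<close>

definition tilt0 :: "real \<Rightarrow> real" where
  "tilt0 a = q * \<delta> * surv a L / (1 - a * (1 - r) * (1 - q))"

text \<open>The filter after the virtual letter. Only the tilt at counter \<open>L\<close> depends
  on the sign: earlier biased emissions are remembered through the stored bit alone.\<close>

fun init :: "real \<Rightarrow> real \<Rightarrow> letter \<Rightarrow> filt" where
  "init s a (w, m, y) = (r / q, \<lambda>n. if n < L then surv a n - surv a (Suc n)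
      else if n = L then surv a L + (if w then s * sgn_bit y * tilt0 a else 0) else 0, w, y)"

fun flt :: "real \<Rightarrow> real \<Rightarrow> letter list \<Rightarrow> filt" where
  "flt s a [] = (0, \<lambda>_. 0, False, False)"
| "flt s a [x] = init s a x"
| "flt s a (x # y # xs) = fstep s (flt s a (y # xs)) x"

text \<open>
  The expectation over histories (latest letter first) under the base law.  The first letter is
  virtual: it stands for the unobserved past that is encoded in the stationary initial state.
  \<open>base\<close> and \<open>avg\<close> only look at the last letter, so the sign 1 is immaterial here.
\<close>

primrec expect :: "real \<Rightarrow> nat \<Rightarrow> (letter list \<Rightarrow> real) \<Rightarrow> real" where
  "expect a 0 F = (\<Sum>w\<in>UNIV. \<Sum>y\<in>UNIV. (if w then a else 1 - a) / 2 * F [(w, True, y)])"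
| "expect a (Suc t) F = expect a t (\<lambda>\<xi>. avg a (flt 1 a \<xi>) (\<lambda>x. F (x # \<xi>)))"

section \<open>The base expectation as a positive linear functional\<close>

lemma base_cong: "snd (snd P) = snd (snd Q) \<Longrightarrow> base a P x = base a Q x"
  by (cases P; cases Q; cases x) auto

lemma avg_cong: "snd (snd P) = snd (snd Q) \<Longrightarrow> avg a P g = avg a Q g"
  unfolding avg_def by (simp only: base_cong[of P Q])

lemma snd_flt: "\<xi> \<noteq> [] \<Longrightarrow> snd (snd (flt s a \<xi>)) = (fst (hd \<xi>), snd (snd (hd \<xi>)))"
proof (induction \<xi> rule: induct_list012)
  case (3 x y xs)
  obtain N l w u where "flt s a (y # xs) = (N, l, w, u)" by (cases "flt s a (y # xs)")
  then show ?case by (cases x) (simp del: mass.simps late_pred.simps)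
qed auto

lemma avg_flt: "\<xi> \<noteq> [] \<Longrightarrow> avg a (flt s a \<xi>) g = avg a (flt s' a \<xi>) g"
  by (rule avg_cong) (simp add: snd_flt)

lemma flt_Cons: "\<xi> \<noteq> [] \<Longrightarrow> flt s a (x # \<xi>) = fstep s (flt s a \<xi>) x"
  by (cases \<xi>) auto

lemma base_nonneg: "0 \<le> a \<Longrightarrow> a \<le> 1 \<Longrightarrow> 0 \<le> base a P x"
  using q0 q1 by (cases P; cases x) auto

lemma avg_add: "avg a P (\<lambda>x. f x + g x) = avg a P f + avg a P g"
  by (simp add: avg_def sum.distrib algebra_simps)

lemma avg_cmult: "avg a P (\<lambda>x. c * f x) = c * avg a P f"
  by (simp add: avg_def sum_distrib_left algebra_simps)

lemma avg_const: "avg a P (\<lambda>x. c) = c"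
  by (cases P) (simp add: avg_expand algebra_simps)

lemma expect_cong:
  assumes "\<And>\<xi>. length \<xi> = Suc t \<Longrightarrow> F \<xi> = G \<xi>" shows "expect a t F = expect a t G"
  using assms
proof (induction t arbitrary: F G)
  case (Suc t)
  show ?case unfolding expect.simps
    by (rule Suc.IH) (simp add: Suc.prems avg_def)
qed (simp add: avg_def)

lemma expect_mono:
  assumes "0 \<le> a" "a \<le> 1" "\<And>\<xi>. length \<xi> = Suc t \<Longrightarrow> F \<xi> \<le> G \<xi>" shows "expect a t F \<le> expect a t G"
  using assms(3)
proof (induction t arbitrary: F G)
  case 0
  show ?case unfolding expect.simps
    using assms(1,2) by (intro sum_mono mult_left_mono 0) auto
next
  case (Suc t)
  show ?case unfolding expect.simps
    by (rule Suc.IH) (use assms(1,2) Suc.prems in \<open>auto simp: avg_def intro!: sum_mono mult_left_mono base_nonneg\<close>)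
qed

lemma expect_add: "expect a t (\<lambda>\<xi>. F \<xi> + G \<xi>) = expect a t F + expect a t G"
  by (induction t arbitrary: F G) (simp_all add: avg_add sum.distrib algebra_simps)

lemma expect_cmult: "expect a t (\<lambda>\<xi>. c * F \<xi>) = c * expect a t F"
  by (induction t arbitrary: F) (simp_all add: avg_cmult sum_distrib_left algebra_simps)

lemma expect_const: "expect a t (\<lambda>\<xi>. c) = c"
  by (induction t) (simp_all add: avg_const UNIV_bool algebra_simps)

lemma expect_Suc_flt:
  "expect a (Suc t) (\<lambda>\<xi>. f (flt s a \<xi>)) = expect a t (\<lambda>\<xi>. avg a (flt s a \<xi>) (\<lambda>x. f (fstep s (flt s a \<xi>) x)))"
  unfolding expect.simps
proof (rule expect_cong)
  fix \<xi> :: "letter list" assume "length \<xi> = Suc t"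
  then have "\<xi> \<noteq> []" by auto
  then show "avg a (flt 1 a \<xi>) (\<lambda>x. f (flt s a (x # \<xi>))) = avg a (flt s a \<xi>) (\<lambda>x. f (fstep s (flt s a \<xi>) x))"
    by (simp add: flt_Cons avg_flt[of \<xi> a 1 _ s])
qed

section \<open>The stationary start of the filter\<close>

lemma surv_nonneg: "0 \<le> a \<Longrightarrow> 0 \<le> surv a j"
  using q0 rq r1 by (simp add: surv_def)

lemma surv_le: "0 \<le> a \<Longrightarrow> a \<le> 1 \<Longrightarrow> 1 \<le> j \<Longrightarrow> surv a j \<le> (1 - r) ^ j * a ^ j"
proof -
  assume a: "0 \<le> a" "a \<le> 1" and j: "1 \<le> j"
  have "r \<le> r / q" using q0 q1 r0 by (simp add: le_divide_eq)
  then have "(1 - r / q) * (1 - r) ^ (j - 1) \<le> (1 - r) * (1 - r) ^ (j - 1)"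
    using r1 by (intro mult_right_mono) auto
  also have "\<dots> = (1 - r) ^ j" using j by (simp flip: power_Suc)
  finally show ?thesis using a j by (auto simp: surv_def intro!: mult_right_mono)
qed

lemma surv_mono: "0 \<le> a \<Longrightarrow> a \<le> 1 \<Longrightarrow> surv a (Suc n) \<le> surv a n"
proof -
  assume a: "0 \<le> a" "a \<le> 1"
  have p: "0 \<le> 1 - r / q" using q0 rq by simp
  show ?thesis
  proof (cases n)
    case 0
    then show ?thesis using a p mult_left_mono[of a 1 "1 - r / q"] by (simp add: surv_def)
  next
    case (Suc k)
    have "(1 - r) * a \<le> 1" using a r0 r1 by (intro mult_le_one) auto
    then have "(1 - r / q) * (1 - r) ^ k * a ^ Suc k * ((1 - r) * a) \<le> (1 - r / q) * (1 - r) ^ k * a ^ Suc k"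
      using a p r1 by (intro mult_left_le) auto
    then show ?thesis using Suc by (simp add: surv_def mult_ac)
  qed
qed

lemma tilt0_den: "0 \<le> a \<Longrightarrow> a \<le> 1 \<Longrightarrow> q \<le> 1 - a * (1 - r) * (1 - q)"
proof -
  assume a: "0 \<le> a" "a \<le> 1"
  have "a * (1 - r) \<le> 1" using a r0 r1 by (intro mult_le_one) auto
  then have "a * (1 - r) * (1 - q) \<le> 1 - q" using q1 r1 a by (intro mult_left_le_one_le) auto
  then show ?thesis by simp
qed

lemma tilt0_bounds:
  assumes "0 \<le> a" "a \<le> 1" shows "0 \<le> tilt0 a" "tilt0 a \<le> \<delta> * surv a L"
proof -
  have d: "q \<le> 1 - a * (1 - r) * (1 - q)" by (rule tilt0_den[OF assms])
  have nn: "0 \<le> \<delta> * surv a L" using d0 surv_nonneg assms by simp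
  show "0 \<le> tilt0 a" unfolding tilt0_def using d q0 d0 surv_nonneg assms by simp
  have "q * (\<delta> * surv a L) \<le> (1 - a * (1 - r) * (1 - q)) * (\<delta> * surv a L)"
    using d nn by (rule mult_right_mono)
  then show "tilt0 a \<le> \<delta> * surv a L"
    unfolding tilt0_def using d q0 by (simp add: divide_le_eq mult_ac)
qed

lemma valid_init:
  assumes "0 \<le> a" "a \<le> 1" "\<bar>s\<bar> = 1" shows "valid (init s a x)"
proof -
  obtain w m y where x: "x = (w, m, y)" by (cases x)
  have "tilt0 a \<le> surv a L"
    using tilt0_bounds[OF assms(1,2)] d1 d0 surv_nonneg[of a L] assms mult_left_le_one_le[of "surv a L" \<delta>]
    by linarith
  moreover have "\<bar>s * sgn_bit y * tilt0 a\<bar> = tilt0 a"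
    using assms tilt0_bounds[OF assms(1,2)] by (auto simp: abs_mult)
  ultimately show ?thesis using surv_mono[OF assms(1,2)] surv_nonneg[OF assms(1)] r0 q0
    by (auto simp: x abs_le_iff)
qed

lemma valid_flt: "0 \<le> a \<Longrightarrow> a \<le> 1 \<Longrightarrow> \<bar>s\<bar> = 1 \<Longrightarrow> valid (flt s a \<xi>)"
  by (induction \<xi> rule: induct_list012) (auto simp del: init.simps simp: valid_init valid_fstep)

lemma init_tail_sum:
  assumes "j \<le> L"
  shows "(\<Sum>n=j..L. if n < L then surv a n - surv a (Suc n) else if n = L then surv a L + b else 0) = surv a j + b"
proof -
  have "(\<Sum>n=j..L. if n < L then surv a n - surv a (Suc n) else if n = L then surv a L + b else 0)
    = (\<Sum>n=j..<L. surv a n - surv a (Suc n)) + (surv a L + b)"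
    using assms by (subst sum.last_plus) (auto intro!: sum.cong simp: atLeastLessThan_def)
  also have "(\<Sum>n=j..<L. surv a n - surv a (Suc n)) = surv a j - surv a L"
    using assms sum_Suc_diff'[of j L "surv a"] by (simp add: sum_subtractf)
  finally show ?thesis by simp
qed

lemma mass_init: "mass (init s a (w, m, y)) = 1 + (if w then s * sgn_bit y * tilt0 a else 0)"
  unfolding init.simps mass.simps using init_tail_sum[of 0 a]
  by (simp add: atLeast0AtMost surv_def)

lemma late_pred_shift:
  "1 \<le> j \<Longrightarrow> j \<le> L \<Longrightarrow> tail_pred j (N, l, True, y) =
     (if j = 1 then (q - r) * N else 0) + (1 - r) * (\<Sum>n=j-1..L. l n)"
proof -
  assume j: "1 \<le> j" "j \<le> L"
  obtain k where L: "L = Suc k" using L2 by (cases L) auto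
  obtain i where ji: "j = Suc i" using j by (cases j) auto
  have "tail_pred j (N, l, True, y) = (\<Sum>n=j..L. (if n = 1 then (q - r) * N else 0))
     + (\<Sum>n=j..L. (1 - r) * l (n - 1)) + (\<Sum>n=j..L. if n = L then (1 - r) * l L else 0)"
    unfolding tail_pred_def sum.distrib[symmetric] using j by (intro sum.cong) auto
  also have "(\<Sum>n=j..L. (1 - r) * l (n - 1)) = (\<Sum>n=i..k. (1 - r) * l n)"
    unfolding L ji by (subst sum.shift_bounds_cl_Suc_ivl) simp
  finally show ?thesis using j unfolding L ji by (simp add: sum_distrib_left distrib_left)
qed

text \<open>At \<open>j = 1\<close> the inflow \<open>(q - r) * (r / q)\<close> and the surviving
  late mass add up to the full late share \<open>1 - r / q\<close>.\<close>

lemma tail_init: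
  assumes "1 \<le> j" "j \<le> L"
  shows "tail_pred j (init s a (w, m, y)) = (if w then
     (if j = 1 then 1 - r / q else (1 - r) * surv a (j - 1)) + (1 - r) * (s * sgn_bit y * tilt0 a) else 0)"
proof (cases w)
  case True
  have "tail_pred j (init s a (True, m, y)) = (if j = 1 then (q - r) * (r / q) else 0)
      + (1 - r) * (surv a (j - 1) + s * sgn_bit y * tilt0 a)"
    using assms unfolding init.simps
    by (subst late_pred_shift) (use init_tail_sum[of "j - 1" a] in simp_all)
  moreover have "(q - r) * (r / q) + (1 - r) * (1 - r / q) = 1 - r / q"
    using q0 by (simp add: field_simps)
  moreover have "w = True" using True by simp
  ultimately show ?thesis by (simp add: surv_def distrib_left del: init.simps)
qed (use assms in \<open>auto simp: tail_pred_def intro!: sum.neutral\<close>)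

lemma potential_init: "potential (init s a (w, m, y)) = (1 + (if w then s * sgn_bit y * tilt0 a else 0))\<^sup>2
     + (if w then (1 - q) * (r / q * tilt0 a * s)\<^sup>2 else 0)"
proof -
  have "potential (init s a (w, m, y)) = (mass (init s a (w, m, y)))\<^sup>2
     + (if w then (1 - q) * (r / q - r / q * mass (init s a (w, m, y)))\<^sup>2 else 0)"
    by (simp only: init.simps potential.simps weak.simps)
  then show ?thesis unfolding mass_init by (simp add: power2_eq_square algebra_simps)
qed

section \<open>Second moment bound over the whole horizon\<close>

definition geo :: "nat \<Rightarrow> real" where
  "geo j = (\<Sum>i<j. ((1 - r)\<^sup>2) ^ Suc i)"

text \<open>Matches the recursion of the tails: a shift multiplies by \<open>(1 - r)\<^sup>2\<close>
  and adds one more feedback from the biased state.\<close>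

lemma geo_Suc: "geo (Suc j) = (1 - r)\<^sup>2 * (1 + geo j)"
  unfolding geo_def sum.lessThan_Suc_shift by (simp add: sum_distrib_left algebra_simps)

lemma geo_nonneg: "0 \<le> geo j"
  by (simp add: geo_def sum_nonneg)

lemma geo_le: "geo j \<le> (1 - r)\<^sup>2 / (1 - (1 - r)\<^sup>2)"
proof -
  have R: "(1 - r)\<^sup>2 < 1" using r0 r1 by (simp add: power_less_one_iff abs_square_less_1)
  show ?thesis
  proof (induction j)
    case 0
    show ?case using R by (simp add: geo_def)
  next
    case (Suc j)
    have "geo (Suc j) \<le> (1 - r)\<^sup>2 * (1 + (1 - r)\<^sup>2 / (1 - (1 - r)\<^sup>2))"
      unfolding geo_Suc using Suc by (intro mult_left_mono) auto
    also have "1 + (1 - r)\<^sup>2 / (1 - (1 - r)\<^sup>2) = 1 / (1 - (1 - r)\<^sup>2)"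
      using R by (simp add: field_simps)
    finally show ?case by simp
  qed
qed

lemma expect_init:
  "expect a 0 F = a * (F [(True, True, True)] + F [(True, True, False)]) / 2
     + (1 - a) * (F [(False, True, True)] + F [(False, True, False)]) / 2"
  by (simp add: UNIV_bool algebra_simps add_divide_distrib diff_divide_distrib)

text \<open>The tail at \<open>L\<close> drives the potential, and a tail at \<open>j\<close> goes
  back to the potential \<open>j\<close> periods earlier at the cost
  \<open>a * (1 - r)\<^sup>2\<close> per period. \<open>S\<close> limits the feedback of the bias on
  the tails, \<open>aL\<close> the stationary start, and \<open>T\<close> the growth over the
  horizon.\<close>

lemma potential_bound:
  assumes a: "0 < a" "a < 1" and s: "\<bar>s\<bar> = 1"
    and S: "q * \<delta>\<^sup>2 * ((1 - r)\<^sup>2 / (1 - (1 - r)\<^sup>2)) \<le> 9 / 20"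
    and aL: "a ^ L \<le> 1 / 4"
    and T: "real T * a ^ Suc L * ((1 - r)\<^sup>2) ^ L * ((q + (1 - q) * (r\<^sup>2 / q)) * \<delta>\<^sup>2) \<le> 9 / 100"
    and t: "t \<le> T"
  shows "expect a t (\<lambda>\<xi>. potential (flt s a \<xi>)) \<le> 5 / 4"
proof -
  define R where "R = (1 - r)\<^sup>2"
  define \<eta> where "\<eta> = (q + (1 - q) * (r\<^sup>2 / q)) * \<delta>\<^sup>2"
  define A where "A j t = expect a t (\<lambda>\<xi>. (tail_pred j (flt s a \<xi>))\<^sup>2)" for j t
  define \<Phi> where "\<Phi> t = expect a t (\<lambda>\<xi>. potential (flt s a \<xi>))" for t
  \<comment> \<open>\<open>25 / 11\<close> solves \<open>x = 5 / 4 + 9 / 20 * x\<close>: the bound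
    on the potential plus the feedback, which \<open>S\<close> limits to
    \<open>9 / 20\<close>.\<close>
  define B where "B = a ^ L * R ^ L * (25 / 11)"
  have a01: "0 \<le> a" "a \<le> 1" using a by auto
  have R0: "0 \<le> R" and R1: "R \<le> 1" using r0 r1 by (auto simp: R_def power_le_one)
  have B0: "0 \<le> B" unfolding B_def using a R0 by simp
  have \<eta>0: "0 \<le> \<eta>" unfolding \<eta>_def using q0 q1 by simp
  have s2: "s\<^sup>2 = 1" using s by (simp add: abs_square_eq_1)
  have s2': "s * s = 1" "s * (s * x) = x" for x using s2 by (auto simp: power2_eq_square simp flip: mult.assoc)
  have A_step: "A (Suc j) (Suc t) = a * R * (A j t + q * \<delta>\<^sup>2 * A L t)" if "1 \<le> j" "Suc j \<le> L" for j t
  proof -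
    have "A (Suc j) (Suc t) = expect a t (\<lambda>\<xi>. a * R * ((tail_pred j (flt s a \<xi>))\<^sup>2 + q * \<delta>\<^sup>2 * (tail_pred L (flt s a \<xi>))\<^sup>2))"
      unfolding A_def expect_Suc_flt[where f = "\<lambda>P. (tail_pred (Suc j) P)\<^sup>2"]
      using avg_tail[of "Suc j" s a] that s by (simp add: tail_pred_L R_def)
    then show ?thesis by (simp add: expect_cmult expect_add A_def)
  qed
  have A1_step: "A 1 (Suc t) \<le> a * R * (\<Phi> t + q * \<delta>\<^sup>2 * A L t)" for t
  proof -
    have "A 1 (Suc t) \<le> expect a t (\<lambda>\<xi>. a * R * (potential (flt s a \<xi>) + q * \<delta>\<^sup>2 * (tail_pred L (flt s a \<xi>))\<^sup>2))"
      unfolding A_def expect_Suc_flt[where f = "\<lambda>P. (tail_pred 1 P)\<^sup>2"]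
      using avg_tail_1[OF s a01 valid_flt[OF a01 s]] by (intro expect_mono a01) (simp add: tail_pred_L R_def)
    then show ?thesis by (simp add: expect_cmult expect_add A_def \<Phi>_def)
  qed
  have \<Phi>_step: "\<Phi> (Suc t) \<le> \<Phi> t + a * \<eta> * A L t" for t
  proof -
    have "\<Phi> (Suc t) \<le> expect a t (\<lambda>\<xi>. potential (flt s a \<xi>) + a * \<eta> * (tail_pred L (flt s a \<xi>))\<^sup>2)"
      unfolding \<Phi>_def expect_Suc_flt[where f = potential]
      using avg_potential[OF s a01] by (intro expect_mono a01) (simp add: tail_pred_L \<eta>_def)
    then show ?thesis by (simp add: expect_cmult expect_add A_def \<Phi>_def)
  qed
  define \<tau> where "\<tau> = tilt0 a"
  have \<tau>0: "0 \<le> \<tau>" and \<tau>1: "\<tau> \<le> \<delta> * surv a L" using tilt0_bounds[OF a01] by (auto simp: \<tau>_def)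
  have sL: "surv a L \<le> (1 - r) ^ L * a ^ L" using surv_le[OF a01] L2 by simp
  have \<tau>2: "\<tau>\<^sup>2 \<le> \<delta>\<^sup>2 * (R ^ L * (a ^ L)\<^sup>2)"
  proof -
    have "\<tau> \<le> \<delta> * ((1 - r) ^ L * a ^ L)" using \<tau>1 mult_left_mono[OF sL d0] by simp
    then have "\<tau>\<^sup>2 \<le> (\<delta> * ((1 - r) ^ L * a ^ L))\<^sup>2" using \<tau>0 by (rule power_mono)
    then show ?thesis by (simp add: R_def power_mult_distrib mult.commute flip: power_mult)
  qed
  have \<delta>2: "\<delta>\<^sup>2 \<le> 9 / 100" using power_mono[OF d1 d0, of 2] by (simp add: power2_eq_square)
  have aL2: "(a ^ L)\<^sup>2 \<le> 1 / 16" using power_mono[OF aL, of 2] a by (simp add: power2_eq_square)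
  have \<tau>small: "\<tau>\<^sup>2 \<le> 1 / 160"
  proof -
    have "R ^ L * (a ^ L)\<^sup>2 \<le> 1 * (1 / 16)" using aL2 R0 R1 by (intro mult_mono) (auto simp: power_le_one)
    then have "\<delta>\<^sup>2 * (R ^ L * (a ^ L)\<^sup>2) \<le> 9 / 100 * (1 / 16)" using \<delta>2 R0 by (intro mult_mono) auto
    then show ?thesis using \<tau>2 by simp
  qed
  have geo: "q * \<delta>\<^sup>2 * geo j \<le> 9 / 20" for j
    by (rule order_trans[OF mult_left_mono[OF geo_le[of j]] S]) (use q0 in auto)
  \<comment> \<open>Both bounds must advance together, as each drives the other. The start
    \<open>81 / 80\<close> and the total growth \<open>9 / 44\<close> stay below
    \<open>5 / 4\<close>.\<close>
  have claim: "\<Phi> t \<le> 81 / 80 + real t * (a * \<eta> * B) \<and>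
     (\<forall>j. 1 \<le> j \<longrightarrow> j \<le> L \<longrightarrow> A j t \<le> a ^ j * R ^ j * (5 / 4) + q * \<delta>\<^sup>2 * B * geo j)" if "t \<le> T" for t
    using that
  proof (induction t)
    case 0
    define R' where "R' = r / q"
    have "\<Phi> 0 = 1 + a * (1 + (1 - q) * (r / q)\<^sup>2) * \<tau>\<^sup>2"
      unfolding \<Phi>_def expect_init flt.simps potential_init \<tau>_def[symmetric] R'_def[symmetric]
      by (simp add: power2_eq_square algebra_simps s2' add_divide_distrib diff_divide_distrib)
    also have "\<dots> \<le> 1 + 2 * \<tau>\<^sup>2"
    proof -
      have "(r / q)\<^sup>2 \<le> 1" using r0 rq by (intro power_le_one) auto
      then have "(1 - q) * (r / q)\<^sup>2 \<le> 1" using q0 q1 by (intro mult_le_one) auto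
      then have "a * (1 + (1 - q) * (r / q)\<^sup>2) \<le> 1 * 2" using a01 q1 by (intro mult_mono) auto
      from mult_right_mono[OF this, of "\<tau>\<^sup>2"] show ?thesis by simp
    qed
    finally have "\<Phi> 0 \<le> 81 / 80" using \<tau>small by simp
    moreover have "A j 0 \<le> a ^ j * R ^ j * (5 / 4) + q * \<delta>\<^sup>2 * B * geo j" if j: "1 \<le> j" "j \<le> L" for j
    proof -
      define c where "c = (if j = 1 then 1 - r / q else (1 - r) * surv a (j - 1))"
      have "A j 0 = a * (c\<^sup>2 + R * \<tau>\<^sup>2)"
        unfolding A_def expect_init flt.simps tail_init[OF j] \<tau>_def[symmetric] c_def[symmetric] R_def
        by (simp add: power2_eq_square algebra_simps s2' add_divide_distrib diff_divide_distrib)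
      also have "\<dots> \<le> a * (R * (R ^ (j - 1) * a ^ (j - 1)) + R * (R ^ (j - 1) * a ^ (j - 1) * (1 / 4)))"
      proof (intro mult_left_mono add_mono)
        show "c\<^sup>2 \<le> R * (R ^ (j - 1) * a ^ (j - 1))"
        proof (cases "j = 1")
          case True
          have "r \<le> r / q" using q0 q1 r0 by (simp add: le_divide_eq)
          then show ?thesis using True rq q0 by (auto simp: c_def R_def intro!: power_mono)
        next
          case False
          have "(surv a (j - 1))\<^sup>2 \<le> ((1 - r) ^ (j - 1) * a ^ (j - 1))\<^sup>2"
            using False j a01 by (intro power_mono surv_le surv_nonneg) auto
          also have "\<dots> = R ^ (j - 1) * (a ^ (j - 1) * a ^ (j - 1))"
            unfolding R_def by (simp add: power_mult_distrib power2_eq_square)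
          also have "\<dots> \<le> R ^ (j - 1) * a ^ (j - 1)"
            using a01 R0 by (intro mult_left_mono mult_left_le) (auto simp: power_le_one)
          finally have "R * (surv a (j - 1))\<^sup>2 \<le> R * (R ^ (j - 1) * a ^ (j - 1))" using R0 by (rule mult_left_mono)
          then show ?thesis using False by (simp add: c_def R_def power_mult_distrib)
        qed
        have "\<tau>\<^sup>2 \<le> R ^ L * (a ^ L)\<^sup>2"
          using \<tau>2 \<delta>2 mult_right_mono[of "\<delta>\<^sup>2" 1 "R ^ L * (a ^ L)\<^sup>2"] R0 by simp
        \<comment> \<open>One factor \<open>a ^ L\<close> is weakened to \<open>a ^ (j - 1)\<close>,
          the other supplies the \<open>1 / 4\<close> that completes \<open>5 / 4\<close>.\<close>
        also have "\<dots> \<le> R ^ (j - 1) * (a ^ (j - 1) * (1 / 4))"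
        proof -
          have "R ^ L \<le> R ^ (j - 1)" using R0 R1 j by (intro power_decreasing) auto
          moreover have "a ^ L \<le> a ^ (j - 1)" using a01 j by (intro power_decreasing) auto
          then have "(a ^ L)\<^sup>2 \<le> a ^ (j - 1) * (1 / 4)"
            unfolding power2_eq_square using aL a01 by (intro mult_mono) auto
          ultimately show ?thesis using a01 R0 by (intro mult_mono) auto
        qed
        finally show "\<tau>\<^sup>2 \<le> R ^ (j - 1) * a ^ (j - 1) * (1 / 4)"
          by (simp only: mult.assoc)
      qed (use a R0 in auto)
      also have "\<dots> = a ^ j * R ^ j * (5 / 4)"
        using j by (cases j) (auto simp: algebra_simps)
      finally show ?thesis using B0 q0 geo_nonneg[of j] by (smt (verit) mult_nonneg_nonneg zero_le_power2)
    qed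
    ultimately show ?case by simp
  next
    case (Suc t)
    note IH = Suc.IH[OF Suc_leD[OF Suc.prems]]
    have TB: "real t' * (a * \<eta> * B) \<le> 9 / 44" if "t' \<le> T" for t'
    proof -
      have "real t' * (a * \<eta> * B) \<le> real T * (a * \<eta> * B)"
        using that a B0 \<eta>0 by (intro mult_right_mono) auto
      also have "\<dots> = (real T * a ^ Suc L * R ^ L * \<eta>) * (25 / 11)" by (simp add: B_def)
      also have "\<dots> \<le> 9 / 100 * (25 / 11)" using T unfolding R_def \<eta>_def by (intro mult_right_mono) auto
      finally show ?thesis by simp
    qed
    have \<Phi>t: "\<Phi> t \<le> 5 / 4" using IH TB[of t] Suc.prems by simp
    have ALB: "A L t \<le> B"
    proof -
      have "A L t \<le> a ^ L * R ^ L * (5 / 4) + B * (q * \<delta>\<^sup>2 * geo L)" using IH L2 by (simp add: mult_ac)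
      also have "\<dots> \<le> a ^ L * R ^ L * (5 / 4) + B * (9 / 20)" using geo B0 by (intro add_left_mono mult_left_mono) auto
      finally show ?thesis by (simp add: B_def mult_ac)
    qed
    have "\<Phi> (Suc t) \<le> \<Phi> t + a * \<eta> * B"
      by (rule order_trans[OF \<Phi>_step add_left_mono[OF mult_left_mono[OF ALB]]]) (use a \<eta>0 in simp)
    then have 1: "\<Phi> (Suc t) \<le> 81 / 80 + real (Suc t) * (a * \<eta> * B)" using IH by (simp add: algebra_simps)
    \<comment> \<open>One shift of the index: \<open>geo (Suc i)\<close> takes up \<open>R\<close>
      and the new feedback, and the factor \<open>a\<close> on the feedback is dropped.\<close>
    have key: "a * R * (X + q * \<delta>\<^sup>2 * A L t) \<le> a ^ Suc i * R ^ Suc i * (5 / 4) + q * \<delta>\<^sup>2 * B * geo (Suc i)"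
      if X: "X \<le> a ^ i * R ^ i * (5 / 4) + q * \<delta>\<^sup>2 * B * geo i" for X i
    proof -
      have "q * \<delta>\<^sup>2 * A L t \<le> q * \<delta>\<^sup>2 * B" using ALB q0 by (intro mult_left_mono) auto
      with X have "X + q * \<delta>\<^sup>2 * A L t \<le> a ^ i * R ^ i * (5 / 4) + q * \<delta>\<^sup>2 * B * (1 + geo i)"
        by (simp add: algebra_simps)
      then have "a * R * (X + q * \<delta>\<^sup>2 * A L t) \<le> a * R * (a ^ i * R ^ i * (5 / 4) + q * \<delta>\<^sup>2 * B * (1 + geo i))"
        using a R0 by (intro mult_left_mono) auto
      also have "\<dots> = a ^ Suc i * R ^ Suc i * (5 / 4) + a * (q * \<delta>\<^sup>2 * B * geo (Suc i))"
        unfolding geo_Suc R_def by (simp add: algebra_simps)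
      also have "\<dots> \<le> a ^ Suc i * R ^ Suc i * (5 / 4) + q * \<delta>\<^sup>2 * B * geo (Suc i)"
        using a01 q0 B0 geo_nonneg by (intro add_left_mono mult_left_le_one_le) auto
      finally show ?thesis .
    qed
    have "A j (Suc t) \<le> a ^ j * R ^ j * (5 / 4) + q * \<delta>\<^sup>2 * B * geo j" if j: "1 \<le> j" "j \<le> L" for j
    proof (cases "j = 1")
      case True
      have "\<Phi> t \<le> a ^ 0 * R ^ 0 * (5 / 4) + q * \<delta>\<^sup>2 * B * geo 0" using \<Phi>t by (simp add: geo_def)
      from key[OF this] A1_step[of t] show ?thesis using True by simp
    next
      case False
      then obtain i where i: "j = Suc i" "1 \<le> i" using j by (cases j) auto
      then have "A i t \<le> a ^ i * R ^ i * (5 / 4) + q * \<delta>\<^sup>2 * B * geo i" using IH j by simp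
      from key[OF this] A_step[of i t] show ?thesis using i j by simp
    qed
    with 1 show ?case by blast
  qed
  have "real t * (a * \<eta> * B) \<le> real T * (a * \<eta> * B)"
    using t a B0 \<eta>0 by (intro mult_right_mono) auto
  also have "\<dots> = (real T * a ^ Suc L * R ^ L * \<eta>) * (25 / 11)" by (simp add: B_def)
  also have "\<dots> \<le> 9 / 100 * (25 / 11)" using T unfolding R_def \<eta>_def by (intro mult_right_mono) auto
  finally show ?thesis using claim[OF t] unfolding \<Phi>_def by simp
qed

lemma expect_mass: "expect a t (\<lambda>\<xi>. mass (flt s a \<xi>)) = 1"
proof (induction t)
  case 0
  show ?case unfolding expect_init flt.simps mass_init by (simp add: field_simps)
next
  case (Suc t)
  then show ?case unfolding expect_Suc_flt[where f = mass] avg_mass .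
qed

text \<open>Completing the square at \<open>1 / 2\<close> bounds the absolute deviation by the
  second moment; mean 1 and potential at most \<open>5 / 4\<close> then yield
  \<open>1 / 2\<close>.\<close>

lemma expect_mass_dev:
  assumes a: "0 < a" "a < 1" and s: "\<bar>s\<bar> = 1"
    and "q * \<delta>\<^sup>2 * ((1 - r)\<^sup>2 / (1 - (1 - r)\<^sup>2)) \<le> 9 / 20"
    and "a ^ L \<le> 1 / 4"
    and "real T * a ^ Suc L * ((1 - r)\<^sup>2) ^ L * ((q + (1 - q) * (r\<^sup>2 / q)) * \<delta>\<^sup>2) \<le> 9 / 100"
  shows "expect a T (\<lambda>\<xi>. \<bar>mass (flt s a \<xi>) - 1\<bar>) \<le> 1 / 2"
proof -
  have "\<bar>mass P - 1\<bar> \<le> potential P + (- 2 * mass P + 5 / 4)" for P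
  proof -
    have "(mass P)\<^sup>2 \<le> potential P" using q1 by (cases P) auto
    moreover have "0 \<le> (\<bar>mass P - 1\<bar> - 1 / 2)\<^sup>2" by simp
    moreover have "(\<bar>mass P - 1\<bar> - 1 / 2)\<^sup>2 = (mass P)\<^sup>2 - 2 * mass P + 5 / 4 - \<bar>mass P - 1\<bar>"
      by (simp add: power2_diff) (simp add: power2_eq_square algebra_simps)
    ultimately show ?thesis by linarith
  qed
  then have "expect a T (\<lambda>\<xi>. \<bar>mass (flt s a \<xi>) - 1\<bar>) \<le> expect a T (\<lambda>\<xi>. potential (flt s a \<xi>) + (- 2 * mass (flt s a \<xi>) + 5 / 4))"
    using a by (intro expect_mono) auto
  also have "\<dots> = expect a T (\<lambda>\<xi>. potential (flt s a \<xi>)) - 3 / 4"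
    by (simp only: expect_add expect_cmult expect_const expect_mass)
  also have "\<dots> \<le> 1 / 2" using potential_bound[OF assms order_refl] by simp
  finally show ?thesis .
qed

subsection \<open>The instances\<close>

definition hids :: "hid set" where
  "hids = {Fresh, Hold True, Hold False} \<union> (\<lambda>n. Late n True) ` {..L} \<union> (\<lambda>n. Late n False) ` {..L}"

lemma finite_hids: "finite hids"
  by (simp add: hids_def)

lemma sum_hids: "(\<Sum>h\<in>hids. f h) = f Fresh + f (Hold True) + f (Hold False)
    + (\<Sum>n\<le>L. f (Late n True) + f (Late n False) :: real)"
  unfolding hids_def sum.distrib
  by (subst sum.union_disjoint; (subst sum.union_disjoint)?)
     (auto simp: sum.reindex inj_on_def)

text \<open>Successor states never leave \<open>hids\<close>, so clipping changes no integral. It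
  makes the map from the infinite type \<open>hid\<close> land in the finite state space
  pointwise.\<close>

definition clip :: "hid \<Rightarrow> hid" where
  "clip h = (if h \<in> hids then h else Fresh)"

lemma clip_in: "clip h \<in> hids"
  by (simp add: clip_def hids_def)

lemma Late_hids: "n \<le> L \<Longrightarrow> Late n u \<in> hids"
  by (cases u) (auto simp: hids_def)

lemma clip_simps: "clip Fresh = Fresh" "clip (Hold u) = Hold u" "n \<le> L \<Longrightarrow> clip (Late n u) = Late n u"
  using Late_hids by (cases u; auto simp: clip_def hids_def)+

text \<open>Given no reset, the weights \<open>q - r\<close> and \<open>1 - q\<close> become a coin
  with bias \<open>(q - r) / (1 - r)\<close>.\<close>

definition next_pmf :: "hid \<Rightarrow> bool \<Rightarrow> bool \<Rightarrow> hid pmf" where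
  "next_pmf h w y = (if w then bind_pmf (bernoulli_pmf r) (\<lambda>b. if b then return_pmf Fresh else
      (case h of Late n u \<Rightarrow> return_pmf (Late (min (Suc n) L) y)
        | _ \<Rightarrow> map_pmf (\<lambda>g. if g then Late 1 y else Hold y) (bernoulli_pmf ((q - r) / (1 - r)))))
    else map_pmf (\<lambda>b. if b then Fresh else Late 0 False) (bernoulli_pmf (r / q)))"

definition out_pmf :: "real \<Rightarrow> hid \<Rightarrow> bool \<Rightarrow> (bool \<times> hid) pmf" where
  "out_pmf s h w = bind_pmf (bernoulli_pmf (prob_up s h w)) (\<lambda>y. map_pmf (Pair y) (next_pmf h w y))"

lemma prob_up_bounds:
  assumes "\<bar>s\<bar> = 1" shows "0 \<le> prob_up s h w" "prob_up s h w \<le> 1"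
proof -
  have b: "\<bar>s * \<delta> * of_bool (n = L \<and> w)\<bar> \<le> 1" for n
    using assms d0 d1 by (auto simp: abs_mult)
  have x: "0 \<le> q * (1 + x) / 2 + (1 - q) * of_bool u \<and> q * (1 + x) / 2 + (1 - q) * of_bool u \<le> 1"
    if "\<bar>x\<bar> \<le> 1" for x u
  proof -
    have "q * (1 + x) \<le> 2 * q" using mult_left_mono[of "1 + x" 2 q] that q0 by (simp add: mult.commute)
    moreover have "0 \<le> q * (1 + x)" using that q0 by simp
    ultimately show ?thesis using q1
      by (cases u; simp only: of_bool_eq mult_1_right mult_zero_right; intro conjI; linarith)
  qed
  show "0 \<le> prob_up s h w" "prob_up s h w \<le> 1"
    using x[OF b] e0 e1 by (auto simp: prob_up_def of_bool_def split: hid.splits)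
qed

lemma next_op_nonneg: "(\<And>x. 0 \<le> G x) \<Longrightarrow> 0 \<le> next_op h w y G"
  using r0 rq q1 q0 r1 by (auto simp: next_op_def split: hid.splits intro!: add_nonneg_nonneg mult_nonneg_nonneg)

lemma kern_op_nonneg: "\<bar>s\<bar> = 1 \<Longrightarrow> (\<And>y x. 0 \<le> G y x) \<Longrightarrow> 0 \<le> kern_op s h w G"
  using prob_up_bounds[of s h w] by (auto simp: kern_op_def intro!: add_nonneg_nonneg mult_nonneg_nonneg next_op_nonneg)

lemma nn_integral_next_pmf:
  assumes G: "\<And>x. 0 \<le> G x"
  shows "(\<integral>\<^sup>+ x. ennreal (G x) \<partial>next_pmf h w y) = ennreal (next_op h w y G)"
proof -
  have g: "0 \<le> (q - r) / (1 - r)" "(q - r) / (1 - r) \<le> 1" "0 \<le> r / q" "r / q \<le> 1" "0 \<le> r" "r \<le> 1"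
    using r0 rq q1 r1 q0 by auto
  have e: "(1 - r) * ((q - r) / (1 - r)) = q - r" "(1 - r) * (1 - (q - r) / (1 - r)) = 1 - q"
    using r1 by (auto simp: field_simps)
  have nl: "r * G Fresh + (1 - r) * (G (Late 1 y) * ((q - r) / (1 - r)) + G (Hold y) * (1 - (q - r) / (1 - r)))
     = r * G Fresh + ((q - r) * G (Late 1 y) + (1 - q) * G (Hold y))"
  proof -
    have "(1 - r) * (G (Late 1 y) * ((q - r) / (1 - r)) + G (Hold y) * (1 - (q - r) / (1 - r)))
       = G (Late 1 y) * ((1 - r) * ((q - r) / (1 - r))) + G (Hold y) * ((1 - r) * (1 - (q - r) / (1 - r)))"
      by (simp only: algebra_simps)
    then show ?thesis unfolding e by (simp add: mult.commute)
  qed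
  show ?thesis
  proof (cases w)
    case True
    define H where "H b = (if b then G Fresh else case h of Late n u \<Rightarrow> G (Late (min (Suc n) L) y)
        | _ \<Rightarrow> (q - r) / (1 - r) * G (Late 1 y) + (1 - (q - r) / (1 - r)) * G (Hold y))" for b
    have H0: "0 \<le> H b" for b using g G unfolding H_def
      by (auto simp del: times_divide_eq_left split: hid.splits intro!: add_nonneg_nonneg mult_nonneg_nonneg)
    have "(\<integral>\<^sup>+ x. ennreal (G x) \<partial>next_pmf h w y) = (\<integral>\<^sup>+ b. ennreal (H b) \<partial>bernoulli_pmf r)"
    proof -
      have in1: "(\<integral>\<^sup>+ x. ennreal (G (if x then Late 1 y else Hold y)) \<partial>bernoulli_pmf ((q - r) / (1 - r)))
         = ennreal ((q - r) / (1 - r) * G (Late 1 y) + (1 - (q - r) / (1 - r)) * G (Hold y))"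
        using nn_integral_bernoulli_ennreal[of "(q - r) / (1 - r)" "\<lambda>x. G (if x then Late 1 y else Hold y)"] g G by simp
      show ?thesis
        unfolding next_pmf_def using True in1
        by (simp add: nn_integral_bind_pmf) (intro nn_integral_cong, auto simp: H_def split: hid.splits)
    qed
    also have "\<dots> = ennreal (r * H True + (1 - r) * H False)"
      using g H0 by (intro nn_integral_bernoulli_ennreal)
    also have "r * H True + (1 - r) * H False = next_op h w y G"
      using True nl by (simp add: H_def next_op_def mult_ac split: hid.splits)
    finally show ?thesis .
  next
    case False
    then show ?thesis
      using nn_integral_bernoulli_ennreal[of "r / q" "\<lambda>x. G (if x then Fresh else Late 0 False)"] g G
      by (simp add: next_pmf_def next_op_def)
  qed
qed

lemma nn_integral_out_pmf:
  assumes s: "\<bar>s\<bar> = 1" and G: "\<And>y x. 0 \<le> G y x"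
  shows "(\<integral>\<^sup>+ (y, x). ennreal (G y x) \<partial>out_pmf s h w) = ennreal (kern_op s h w G)"
  unfolding out_pmf_def kern_op_def
  using prob_up_bounds[OF s, of h w] next_op_nonneg[OF G]
    nn_integral_bernoulli_ennreal[of "prob_up s h w" "\<lambda>y. next_op h w y (G y)"]
  by (simp add: nn_integral_bind_pmf nn_integral_next_pmf[OF G])

text \<open>The observed state is constant, so that only actions and outcomes carry
  information.\<close>

definition inst :: "real \<Rightarrow> real \<Rightarrow> pomdp" where
  "inst c s = \<lparr>obs_states = {0}, hid_states = to_nat ` hids, n_actions = 2,
     kernel = (\<lambda>(x, h, w). distr (measure_pmf (out_pmf s (from_nat h) (w = 1)))
       (borel \<Otimes>\<^sub>M (count_space {0} \<Otimes>\<^sub>M count_space (to_nat ` hids)))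
       (\<lambda>(y, h'). (c * sgn_bit y, 0, to_nat (clip h'))))\<rparr>"

lemma inst_sel: "obs_states (inst c s) = {0}" "hid_states (inst c s) = to_nat ` hids" "n_actions (inst c s) = 2"
  "kernel (inst c s) (x, h, w) = distr (measure_pmf (out_pmf s (from_nat h) (w = 1)))
       (borel \<Otimes>\<^sub>M (count_space {0} \<Otimes>\<^sub>M count_space (to_nat ` hids)))
       (\<lambda>(y, h'). (c * sgn_bit y, 0, to_nat (clip h')))"
  by (simp_all add: inst_def)

lemma out_measurable: "(\<lambda>(y, h'). (c * sgn_bit y, 0, to_nat (clip h'))) \<in> measurable (measure_pmf p)
    (borel \<Otimes>\<^sub>M (count_space {0} \<Otimes>\<^sub>M count_space (to_nat ` hids)))"
  using clip_in by (auto simp: space_pair_measure)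

lemma is_pomdp_inst: "is_pomdp (inst c s)"
proof -
  have "hids \<noteq> {}" by (simp add: hids_def)
  moreover have "prob_space (distr (measure_pmf p) (borel \<Otimes>\<^sub>M (count_space {0} \<Otimes>\<^sub>M count_space (to_nat ` hids)))
       (\<lambda>(y, h'). (c * sgn_bit y, 0, to_nat (clip h'))))" for p
    by (rule measure_pmf.prob_space_distr[OF out_measurable])
  ultimately show ?thesis
    using finite_hids by (auto simp: is_pomdp_def inst_sel space_prob_algebra)
qed

lemma kern_op_clip: "kern_op s h w (\<lambda>y x. G y (clip x)) = kern_op s h w G"
  using L2 by (auto simp: kern_op_def next_op_def clip_simps split: hid.splits)

lemma nn_integral_inst:
  assumes s: "\<bar>s\<bar> = 1" and F: "F \<in> borel_measurable (borel \<Otimes>\<^sub>M (count_space {0} \<Otimes>\<^sub>M count_space (to_nat ` hids)))"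
    and G: "\<And>y h. h \<in> hids \<Longrightarrow> F (c * sgn_bit y, 0, to_nat h) = ennreal (G y h)" and G0: "\<And>y h. 0 \<le> G y h"
  shows "(\<integral>\<^sup>+ z. F z \<partial>kernel (inst c s) (x, h, w)) = ennreal (kern_op s (from_nat h) (w = 1) G)"
proof -
  have "(\<integral>\<^sup>+ z. F z \<partial>kernel (inst c s) (x, h, w)) =
      (\<integral>\<^sup>+ (y, x). ennreal (G y (clip x)) \<partial>out_pmf s (from_nat h) (w = 1))"
    unfolding inst_sel by (subst nn_integral_distr[OF out_measurable]) (use F G clip_in in \<open>auto simp: case_prod_unfold\<close>)
  also have "\<dots> = ennreal (kern_op s (from_nat h) (w = 1) (\<lambda>y x. G y (clip x)))"
    using G0 by (intro nn_integral_out_pmf[OF s])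
  finally show ?thesis by (simp add: kern_op_clip)
qed

lemma states_inst: "(\<Sum>z\<in>states (inst c s). f z) = (\<Sum>h\<in>hids. f (0, to_nat h))"
proof -
  have "states (inst c s) = (\<lambda>h. (0, to_nat h)) ` hids" by (auto simp: inst_sel)
  then show ?thesis by (simp add: sum.reindex inj_on_def)
qed

section \<open>Transition matrix and mixing\<close>

definition hid_trans :: "real \<Rightarrow> real \<Rightarrow> hid \<Rightarrow> hid \<Rightarrow> real" where
  "hid_trans s a h h' = a * kern_op s h True (\<lambda>_ x. of_bool (x = h')) + (1 - a) * kern_op s h False (\<lambda>_ x. of_bool (x = h'))"

lemma transition_prob_inst:
  assumes s: "\<bar>s\<bar> = 1" and h': "h' \<in> hids"
  shows "transition_prob (inst c s) (two_policy a) (0, to_nat h) (0, to_nat h') = hid_trans s a h h'"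
proof -
  have "measure (kernel (inst c s) (0, to_nat h, w)) (UNIV \<times> {(0, to_nat h')}) = kern_op s h (w = 1) (\<lambda>_ x. of_bool (x = h'))" for w
  proof -
    let ?A = "UNIV \<times> {(0 :: nat, to_nat h')} :: (real \<times> nat \<times> nat) set"
    have c: "count_space {0 :: nat} \<Otimes>\<^sub>M count_space (to_nat ` hids :: nat set) = count_space ({0} \<times> to_nat ` hids)"
      using finite_hids by (simp add: pair_measure_countable countable_finite)
    have A: "?A \<in> sets (borel \<Otimes>\<^sub>M (count_space {0} \<Otimes>\<^sub>M count_space (to_nat ` hids)))"
      unfolding c using h' by (intro pair_measureI) auto
    have "emeasure (kernel (inst c s) (0, to_nat h, w)) ?A = (\<integral>\<^sup>+ z. indicator ?A z \<partial>kernel (inst c s) (0, to_nat h, w))"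
      using A by (subst nn_integral_indicator) (simp_all add: inst_sel)
    also have "\<dots> = ennreal (kern_op s (from_nat (to_nat h)) (w = 1) (\<lambda>_ x. of_bool (x = h')))"
      using A by (intro nn_integral_inst[OF s]) (auto simp: indicator_def)
    finally have "emeasure (kernel (inst c s) (0, to_nat h, w)) ?A = ennreal (kern_op s h (w = 1) (\<lambda>_ x. of_bool (x = h')))" by simp
    then show ?thesis using kern_op_nonneg[OF s] by (simp add: measure_def)
  qed
  note M = this
  show ?thesis
    unfolding transition_prob_def prod.case inst_sel(3) sum_two M two_policy_def hid_trans_def by simp
qed

lemma push_inst:
  assumes "\<bar>s\<bar> = 1" "h' \<in> hids"
  shows "push (inst c s) (two_policy a) f (0, to_nat h') = (\<Sum>h\<in>hids. f (0, to_nat h) * hid_trans s a h h')"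
  unfolding push_def states_inst using assms by (simp add: transition_prob_inst)

text \<open>A Doeblin minorant common to all states: the reset under action 1, and the whole
  transition under the other action, which ignores the current state.\<close>

definition restart :: "real \<Rightarrow> hid \<Rightarrow> real" where
  "restart a h' = a * (r * of_bool (h' = Fresh)) + (1 - a) * (r / q * of_bool (h' = Fresh) + (1 - r / q) * of_bool (h' = Late 0 False))"

lemma trans_restart:
  assumes s: "\<bar>s\<bar> = 1" and a: "0 \<le> a" "a \<le> 1"
  shows "restart a h' \<le> hid_trans s a h h'"
    and "(\<Sum>h'\<in>hids. hid_trans s a h h' - restart a h') = a * (1 - r)"
proof -
  have n: "next_op h True y (\<lambda>x. of_bool (x = h')) = r * of_bool (h' = Fresh) +
      (case h of Late n u \<Rightarrow> (1 - r) * of_bool (h' = Late (min (Suc n) L) y)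
        | _ \<Rightarrow> (q - r) * of_bool (h' = Late 1 y) + (1 - q) * of_bool (h' = Hold y))" for y h'
    by (auto simp: next_op_def split: hid.splits)
  let ?X = "\<lambda>y h'. (case h of Late n u \<Rightarrow> (1 - r) * of_bool (h' = Late (min (Suc n) L) y)
        | _ \<Rightarrow> (q - r) * of_bool (h' = Late 1 y) + (1 - q) * of_bool (h' = Hold y)) :: real"
  have t: "hid_trans s a h h' - restart a h' = a * (prob_up s h True * ?X True h' + (1 - prob_up s h True) * ?X False h')" for h'
    unfolding hid_trans_def kern_op_def n restart_def
    by (auto simp: next_op_def algebra_simps add_divide_distrib diff_divide_distrib)
  have X0: "0 \<le> ?X y h'" for y h' using rq q1 r1 by (auto split: hid.splits)
  have "0 \<le> prob_up s h True * ?X True h' + (1 - prob_up s h True) * ?X False h'"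
    using prob_up_bounds[OF s] X0 by (intro add_nonneg_nonneg mult_nonneg_nonneg) auto
  then show "restart a h' \<le> hid_trans s a h h'" using t[of h'] a by (smt (verit) mult_nonneg_nonneg)
  have X1: "(\<Sum>h'\<in>hids. ?X y h') = 1 - r" for y
  proof -
    have d: "(\<Sum>h'\<in>hids. of_bool (h' = k)) = (1 :: real)" if "k \<in> hids" for k
      using that finite_hids by (simp add: of_bool_def)
    have m: "Late (min (Suc n) L) y \<in> hids" "Late 1 y \<in> hids" "Hold y \<in> hids" for n
      using L2 by (auto intro!: Late_hids) (cases y; simp add: hids_def)
    show ?thesis
      by (cases h) (simp_all only: hid.case sum.distrib d[OF m(1)] d[OF m(2)] d[OF m(3)] flip: sum_distrib_left, simp_all)
  qed
  show "(\<Sum>h'\<in>hids. hid_trans s a h h' - restart a h') = a * (1 - r)"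
    unfolding t by (simp only: sum.distrib X1 flip: sum_distrib_left) (simp add: algebra_simps)
qed

text \<open>A signed measure of total 0 does not see the common part \<open>restart\<close>; what is
  left of each row has mass \<open>a * (1 - r)\<close>.\<close>

lemma push_contract:
  assumes s: "\<bar>s\<bar> = 1" and a: "0 \<le> a" "a \<le> 1" and g: "(\<Sum>h\<in>hids. g h) = 0"
  shows "(\<Sum>h'\<in>hids. \<bar>\<Sum>h\<in>hids. g h * hid_trans s a h h'\<bar>) \<le> a * (1 - r) * (\<Sum>h\<in>hids. \<bar>g h\<bar>)"
proof -
  have "\<bar>\<Sum>h\<in>hids. g h * hid_trans s a h h'\<bar> \<le> (\<Sum>h\<in>hids. \<bar>g h\<bar> * (hid_trans s a h h' - restart a h'))" for h'
  proof -
    have eq: "(\<Sum>h\<in>hids. g h * hid_trans s a h h') = (\<Sum>h\<in>hids. g h * (hid_trans s a h h' - restart a h'))"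
      using g by (simp add: right_diff_distrib sum_subtractf flip: sum_distrib_right)
    have "(\<Sum>h\<in>hids. \<bar>g h * (hid_trans s a h h' - restart a h')\<bar>) = (\<Sum>h\<in>hids. \<bar>g h\<bar> * (hid_trans s a h h' - restart a h'))"
      using trans_restart(1)[OF s a] by (intro sum.cong) (auto simp: abs_mult)
    then show ?thesis
      unfolding eq using sum_abs[of "\<lambda>h. g h * (hid_trans s a h h' - restart a h')" hids] by simp
  qed
  then have "(\<Sum>h'\<in>hids. \<bar>\<Sum>h\<in>hids. g h * hid_trans s a h h'\<bar>) \<le> (\<Sum>h'\<in>hids. \<Sum>h\<in>hids. \<bar>g h\<bar> * (hid_trans s a h h' - restart a h'))"
    by (rule sum_mono)
  also have "\<dots> = (\<Sum>h\<in>hids. \<bar>g h\<bar> * (a * (1 - r)))"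
    by (subst sum.swap) (simp only: trans_restart(2)[OF s a] flip: sum_distrib_left)
  finally show ?thesis by (simp add: mult.commute flip: sum_distrib_right)
qed

text \<open>The target policy \<open>a = 1\<close> is the critical case, with contraction factor
  \<open>1 - r\<close>; two distributions are at most 2 apart.\<close>

lemma mixing_inst:
  assumes s: "\<bar>s\<bar> = 1" and a: "0 \<le> a" "a \<le> 1" and r: "1 - r = exp (- 1 / t0)"
  shows "mixing (inst c s) (two_policy a) t0"
  unfolding mixing_def
proof (intro allI impI)
  fix f f' assume f: "distribution_on (states (inst c s)) f" and f': "distribution_on (states (inst c s)) f'"
  let ?g = "\<lambda>h. f' (0, to_nat h) - f (0, to_nat h)"
  have one: "(\<Sum>h\<in>hids. k (0, to_nat h)) = 1" and nn: "h \<in> hids \<Longrightarrow> 0 \<le> k (0, to_nat h)"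
    if "distribution_on (states (inst c s)) k" for k h
    using that by (auto simp: distribution_on_def states_inst[of k c s, symmetric] inst_sel)
  have "(\<Sum>z\<in>states (inst c s). \<bar>push (inst c s) (two_policy a) f' z - push (inst c s) (two_policy a) f z\<bar>)
     = (\<Sum>h'\<in>hids. \<bar>\<Sum>h\<in>hids. ?g h * hid_trans s a h h'\<bar>)"
    unfolding states_inst
    by (intro sum.cong refl) (simp add: push_inst[OF s] left_diff_distrib sum_subtractf)
  also have "\<dots> \<le> a * (1 - r) * (\<Sum>h\<in>hids. \<bar>?g h\<bar>)"
    using one[OF f] one[OF f'] by (intro push_contract s a) (simp add: sum_subtractf)
  also have "\<dots> \<le> 1 * (1 - r) * (\<Sum>h\<in>hids. \<bar>?g h\<bar>)"
    using a r1 by (intro mult_right_mono sum_nonneg) auto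
  also have "(\<Sum>h\<in>hids. \<bar>?g h\<bar>) \<le> (\<Sum>h\<in>hids. f' (0, to_nat h) + f (0, to_nat h))"
    using nn[OF f] nn[OF f'] by (intro sum_mono) (auto simp: abs_le_iff)
  also have "\<dots> = 2" using one[OF f] one[OF f'] by (simp add: sum.distrib)
  finally show "(\<Sum>z\<in>states (inst c s). \<bar>push (inst c s) (two_policy a) f' z - push (inst c s) (two_policy a) f z\<bar>) \<le> 2 * exp (- 1 / t0)"
    using r r1 by (simp add: mult.commute)
qed

subsection \<open>Stationary distributions\<close>

text \<open>The law of the state predicted from the virtual letter. The stored bit is fair except at
  counter \<open>L\<close>, which inherits the bias \<open>tilt0\<close> of the previous period
  times the probability \<open>a * (1 - r)\<close> of action 1 without a reset.\<close>

definition stat_hid :: "real \<Rightarrow> real \<Rightarrow> hid \<Rightarrow> real" where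
  "stat_hid s a h = (case h of Fresh \<Rightarrow> (1 - a) * (r / q) + a * r
     | Hold u \<Rightarrow> a * (1 - q) * (r / q) / 2
     | Late n u \<Rightarrow> if n = 0 then (if u then 0 else (1 - a) * (1 - r / q))
         else if n < L then (surv a n - surv a (Suc n)) / 2
         else if n = L then (surv a L + s * sgn_bit u * (a * (1 - r) * tilt0 a)) / 2 else 0)"

lemma surv_step: "1 \<le> j \<Longrightarrow> surv a (Suc j) = a * (1 - r) * surv a j"
  by (cases j) (auto simp: surv_def)

lemma tail_init_scaled:
  assumes "1 \<le> j" "j \<le> L"
  shows "a * tail_pred j (init s a (True, m, y)) = surv a j + a * (1 - r) * (s * sgn_bit y * tilt0 a)"
proof -
  have "a * (if j = 1 then 1 - r / q else (1 - r) * surv a (j - 1)) = surv a j"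
    using assms surv_step[of "j - 1" a] by (auto simp: surv_def)
  then show ?thesis unfolding tail_init[OF assms] if_True by (simp only: distrib_left mult.assoc)
qed

lemma late_pred_init_scaled:
  assumes "j \<le> L"
  shows "a * late_pred (init s a (True, m, y)) j = (if j = 0 then 0 else if j < L then surv a j - surv a (Suc j)
      else surv a L + a * (1 - r) * (s * sgn_bit y * tilt0 a))"
proof -
  consider "j = 0" | "1 \<le> j" "j < L" | "1 \<le> j" "j = L" using assms by linarith
  then show ?thesis
  proof cases
    case 2
    have "late_pred (init s a (True, m, y)) j = tail_pred j (init s a (True, m, y)) - tail_pred (Suc j) (init s a (True, m, y))"
      using 2 unfolding tail_pred_def by (subst sum.atLeast_Suc_atMost) auto
    then show ?thesis using 2 tail_init_scaled[of j a s m y] tail_init_scaled[of "Suc j" a s m y]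
      by (simp del: init.simps add: right_diff_distrib)
  next
    case 3
    then show ?thesis using tail_init_scaled[of L a s m y] by (simp add: tail_pred_L del: init.simps)
  qed simp
qed

text \<open>Identifies the start of the chain with the filter after the virtual letter; this is the
  base case of the induction over time.\<close>

lemma stat_pred: "(\<Sum>h\<in>hids. stat_hid s a h * G h) = expect a 0 (\<lambda>\<xi>. pred (flt s a \<xi>) G)"
proof -
  have T: "a * pred (init s a (True, True, y)) G = a * r * (1 + s * sgn_bit y * tilt0 a) * G Fresh
      + a * ((1 - q) * (r / q)) * G (Hold y)
      + (\<Sum>j\<le>L. (if j = 0 then 0 else if j < L then surv a j - surv a (Suc j)
          else surv a L + a * (1 - r) * (s * sgn_bit y * tilt0 a)) * G (Late j y))" for y
  proof -
    have "a * pred (init s a (True, True, y)) G = a * (r * mass (init s a (True, True, y)) * G Fresh + (1 - q) * (r / q) * G (Hold y))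
       + (\<Sum>j\<le>L. a * late_pred (init s a (True, True, y)) j * G (Late j y))"
      unfolding init.simps pred.simps by (simp add: distrib_left sum_distrib_left mult.assoc del: mass.simps late_pred.simps)
    also have "(\<Sum>j\<le>L. a * late_pred (init s a (True, True, y)) j * G (Late j y)) =
       (\<Sum>j\<le>L. (if j = 0 then 0 else if j < L then surv a j - surv a (Suc j)
          else surv a L + a * (1 - r) * (s * sgn_bit y * tilt0 a)) * G (Late j y))"
      by (intro sum.cong refl) (simp only: late_pred_init_scaled atMost_iff)
    finally show ?thesis unfolding mass_init if_True
      by (simp only: distrib_left distrib_right mult.assoc mult_1_right)
  qed
  have F: "pred (init s a (False, True, y)) G = r / q * G Fresh + (1 - r / q) * G (Late 0 False)" for y
  proof -
    have "pred (init s a (False, True, y)) G = r / q * mass (init s a (False, True, y)) * G Fresh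
        + (1 - r / q) * mass (init s a (False, True, y)) * G (Late 0 False)"
      unfolding init.simps pred.simps using sum_late_pred_mismatch[of False] by simp
    then show ?thesis unfolding mass_init by simp
  qed
  let ?l = "\<lambda>y j. (if j = 0 then 0 else if j < L then surv a j - surv a (Suc j)
          else surv a L + a * (1 - r) * (s * sgn_bit y * tilt0 a)) * G (Late j y)"
  define A where "A y = (\<Sum>j\<le>L. ?l y j)" for y
  have E: "expect a 0 (\<lambda>\<xi>. pred (flt s a \<xi>) G) =
      (a * pred (init s a (True, True, True)) G + a * pred (init s a (True, True, False)) G) / 2
      + (1 - a) * (r / q * G Fresh + (1 - r / q) * G (Late 0 False))"
    unfolding expect_init flt.simps F
    by (simp add: algebra_simps add_divide_distrib diff_divide_distrib del: init.simps)
  have S: "(\<Sum>n\<le>L. stat_hid s a (Late n True) * G (Late n True) + stat_hid s a (Late n False) * G (Late n False))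
     = (A True + A False) / 2 + (1 - a) * (1 - r / q) * G (Late 0 False)"
  proof -
    have "(\<Sum>n\<le>L. stat_hid s a (Late n True) * G (Late n True) + stat_hid s a (Late n False) * G (Late n False))
     = (\<Sum>n\<le>L. (?l True n + ?l False n) / 2 + (if n = 0 then (1 - a) * (1 - r / q) * G (Late 0 False) else 0))"
      using L2 by (intro sum.cong) (auto simp: stat_hid_def field_simps)
    then show ?thesis unfolding sum.distrib sum_divide_distrib[symmetric] A_def by simp
  qed
  show ?thesis
    unfolding sum_hids S E T[folded A_def]
    by (simp add: stat_hid_def algebra_simps add_divide_distrib diff_divide_distrib)
qed

lemma tilt0_fix:
  assumes "0 \<le> a" "a \<le> 1" shows "q * \<delta> * surv a L + (1 - q) * (a * (1 - r) * tilt0 a) = tilt0 a"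
proof -
  have "1 - a * (1 - r) * (1 - q) > 0" using tilt0_den[OF assms] q0 by linarith
  then have "tilt0 a * (1 - a * (1 - r) * (1 - q)) = q * \<delta> * surv a L"
    unfolding tilt0_def by simp
  then show ?thesis by (simp add: algebra_simps)
qed

text \<open>One period from the stationary law leads to what the virtual letter predicts. Averaged
  over the action, this is invariance.\<close>

lemma kern_stat:
  assumes a: "0 \<le> a" "a \<le> 1"
  shows "(\<Sum>h\<in>hids. stat_hid s a h * kern_op s h w (\<lambda>_. G)) =
    (pred (init s a (w, True, True)) G + pred (init s a (w, True, False)) G) / 2"
proof -
  have nL: "next_op (Late j u) w y G = next_op (Late j False) w y G" for j u y
    by (simp add: next_op_def)
  have nH: "next_op (Hold u) w y G = next_op Fresh w y G" for u y
    by (simp add: next_op_def)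
  define l where "l y n = (if n < L then surv a n - surv a (Suc n)
      else if n = L then surv a L + (if w then s * sgn_bit y * tilt0 a else 0) else 0)" for y :: bool and n
  have R: "pred (init s a (w, True, y)) G = r / q * next_op Fresh w y G + (\<Sum>n\<le>L. l y n * next_op (Late n False) w y G)" for y
    unfolding init.simps pred_post l_def by simp
  have late: "stat_hid s a (Late n True) * kern_op s (Late n True) w (\<lambda>_. G)
      + stat_hid s a (Late n False) * kern_op s (Late n False) w (\<lambda>_. G)
      = (l True n * next_op (Late n False) w True G + l False n * next_op (Late n False) w False G) / 2"
    if n: "n \<le> L" for n
  proof -
    define x y where xy: "x = next_op (Late n False) w True G" "y = next_op (Late n False) w False G"
    consider "n = 0" | "1 \<le> n" "n < L" | "n = L" "n \<noteq> 0" using n by linarith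
    then show ?thesis
    proof cases
      case 1
      define R where "R = r / q"
      show ?thesis using 1 L2 unfolding kern_op_def nL[of n True] xy[symmetric]
        by (simp add: stat_hid_def prob_up_def l_def surv_def R_def[symmetric])
           (simp add: algebra_simps add_divide_distrib diff_divide_distrib)
    next
      case 2
      then show ?thesis unfolding kern_op_def nL[of n True] xy[symmetric]
        by (simp add: stat_hid_def prob_up_def l_def) (simp add: algebra_simps add_divide_distrib diff_divide_distrib)
    next
      case 3
      define t k where tk: "t = a * (1 - r) * tilt0 a" "k = surv a L"
      \<comment> \<open>Under action 1 the kept part of the old bias and the new bias add up to
        \<open>tilt0\<close>.\<close>
      have tf: "tilt0 a = q * \<delta> * k + (1 - q) * t" using tilt0_fix[OF a] by (simp add: tk)
      show ?thesis
      proof (cases w)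
        case True
        then show ?thesis using 3 unfolding kern_op_def nL[of n True] xy[symmetric] l_def
          by (simp add: stat_hid_def prob_up_def tk[symmetric])
             (simp add: tf algebra_simps add_divide_distrib diff_divide_distrib)
      next
        case False
        \<comment> \<open>Another action erases the emitted bit, so the bias of the stored bit
          cancels.\<close>
        then have "x = y" by (simp add: xy next_op_def)
        then show ?thesis using 3 False unfolding kern_op_def nL[of n True] xy[symmetric] l_def
          by (simp add: stat_hid_def prob_up_def tk[symmetric])
             (simp add: algebra_simps add_divide_distrib diff_divide_distrib)
      qed
    qed
  qed
  have F: "stat_hid s a Fresh * kern_op s Fresh w (\<lambda>_. G)
     + stat_hid s a (Hold True) * kern_op s (Hold True) w (\<lambda>_. G) + stat_hid s a (Hold False) * kern_op s (Hold False) w (\<lambda>_. G)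
     = (r / q * next_op Fresh w True G + r / q * next_op Fresh w False G) / 2"
  proof -
    define x y R where xy: "x = next_op Fresh w True G" "y = next_op Fresh w False G" "R = r / q"
    have rR: "r = q * R" using q0 by (simp add: xy)
    show ?thesis
      unfolding kern_op_def nH xy[symmetric] stat_hid_def hid.case prob_up_def
      by (subst rR) (simp add: algebra_simps add_divide_distrib diff_divide_distrib)
  qed
  have "(\<Sum>n\<le>L. stat_hid s a (Late n True) * kern_op s (Late n True) w (\<lambda>_. G)
      + stat_hid s a (Late n False) * kern_op s (Late n False) w (\<lambda>_. G))
     = (\<Sum>n\<le>L. (l True n * next_op (Late n False) w True G + l False n * next_op (Late n False) w False G) / 2)"
    by (intro sum.cong late) auto
  then show ?thesis unfolding sum_hids R F by (simp add: sum.distrib add_divide_distrib flip: sum_divide_distrib)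
qed

lemma stat_invariant:
  assumes "0 \<le> a" "a \<le> 1" "h' \<in> hids"
  shows "(\<Sum>h\<in>hids. stat_hid s a h * hid_trans s a h h') = stat_hid s a h'"
proof -
  let ?G = "\<lambda>x. of_bool (x = h') :: real"
  have "(\<Sum>h\<in>hids. stat_hid s a h * hid_trans s a h h') =
     a * (\<Sum>h\<in>hids. stat_hid s a h * kern_op s h True (\<lambda>_. ?G)) + (1 - a) * (\<Sum>h\<in>hids. stat_hid s a h * kern_op s h False (\<lambda>_. ?G))"
    by (simp add: hid_trans_def sum_distrib_left sum.distrib sum_subtractf algebra_simps)
  also have "\<dots> = expect a 0 (\<lambda>\<xi>. pred (flt s a \<xi>) ?G)"
    unfolding kern_stat[OF assms(1,2)] expect_init flt.simps by (simp del: init.simps)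
  also have "\<dots> = (\<Sum>h\<in>hids. stat_hid s a h * ?G h)" by (rule stat_pred[symmetric])
  also have "\<dots> = stat_hid s a h'" using assms(3) finite_hids by (simp add: of_bool_def if_distrib cong: if_cong)
  finally show ?thesis .
qed

lemma stat_nonneg:
  assumes "0 \<le> a" "a \<le> 1" "\<bar>s\<bar> = 1" shows "0 \<le> stat_hid s a h"
proof -
  have "a * (1 - r) * tilt0 a \<le> tilt0 a"
    using assms r0 r1 tilt0_bounds[OF assms(1,2)] by (intro mult_left_le_one_le) (auto intro: mult_le_one)
  also have "\<dots> \<le> surv a L"
    using tilt0_bounds[OF assms(1,2)] d1 d0 surv_nonneg[of a L] assms mult_left_le_one_le[of "surv a L" \<delta>]
    by linarith
  finally have "a * (1 - r) * tilt0 a \<le> surv a L" .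
  moreover have "\<bar>s * sgn_bit u * (a * (1 - r) * tilt0 a)\<bar> = a * (1 - r) * tilt0 a" for u
    using assms r1 tilt0_bounds[OF assms(1,2)] by (auto simp: abs_mult)
  ultimately have "0 \<le> surv a L + s * sgn_bit u * (a * (1 - r) * tilt0 a)" for u
    by (smt (verit))
  from this[of True] this[of False] show ?thesis
    using assms surv_mono[OF assms(1,2)] q0 q1 rq r0 by (auto simp: stat_hid_def split: hid.splits)
qed

lemma stat_total: "(\<Sum>h\<in>hids. stat_hid s a h) = 1"
proof -
  have "(\<Sum>h\<in>hids. stat_hid s a h * 1) = expect a 0 (\<lambda>\<xi>. mass (flt s a \<xi>))"
    unfolding stat_pred
  proof (rule expect_cong)
    fix \<xi> :: "letter list"
    obtain N l w y where P: "flt s a \<xi> = (N, l, w, y)" by (cases "flt s a \<xi>")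
    show "pred (flt s a \<xi>) (\<lambda>_. 1) = mass (flt s a \<xi>)"
      unfolding P pred_post by (cases w) (simp_all add: next_op_def sum_distrib_left)
  qed
  then show ?thesis by (simp add: expect_mass)
qed

definition stat :: "real \<Rightarrow> real \<Rightarrow> nat \<times> nat \<Rightarrow> real" where
  "stat s a z = (if z \<in> {0} \<times> to_nat ` hids then stat_hid s a (from_nat (snd z)) else 0)"

lemma stat_eq: "h \<in> hids \<Longrightarrow> stat s a (0, to_nat h) = stat_hid s a h"
  by (simp add: stat_def)

text \<open>Existence is \<open>stat_invariant\<close>. Uniqueness follows from
  \<open>push_contract\<close>: the difference of two invariant laws shrinks by the factor
  \<open>1 - r < 1\<close> and yet is unchanged.\<close>

lemma stationary_dist_inst:
  assumes s: "\<bar>s\<bar> = 1" and a: "0 \<le> a" "a \<le> 1"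
  shows "stationary_dist (inst c s) (two_policy a) = stat s a"
    and "distribution_on (states (inst c s)) (stationary_dist (inst c s) (two_policy a))"
proof -
  have dist: "distribution_on (states (inst c s)) (stat s a)"
    unfolding distribution_on_def states_inst
  proof (intro conjI)
    show "\<forall>z\<in>states (inst c s). 0 \<le> stat s a z" using stat_nonneg[OF a s] by (simp add: stat_def)
    show "(\<Sum>h\<in>hids. stat s a (0, to_nat h)) = 1" using stat_total[of s a] by (simp add: stat_eq)
    show "\<forall>z. z \<notin> states (inst c s) \<longrightarrow> stat s a z = 0" by (auto simp: inst_sel stat_def)
  qed
  have inv: "\<forall>z\<in>states (inst c s). push (inst c s) (two_policy a) (stat s a) z = stat s a z"
  proof
    fix z assume "z \<in> states (inst c s)"
    then obtain h where h: "h \<in> hids" "z = (0, to_nat h)" by (auto simp: inst_sel)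
    have "push (inst c s) (two_policy a) (stat s a) z = (\<Sum>h'\<in>hids. stat_hid s a h' * hid_trans s a h' h)"
      unfolding h(2) push_inst[OF s h(1)] by (intro sum.cong refl) (simp only: stat_eq)
    then show "push (inst c s) (two_policy a) (stat s a) z = stat s a z"
      unfolding stat_invariant[OF a h(1)] using h by (simp only: stat_eq)
  qed
  have uniq: "f = stat s a" if f: "distribution_on (states (inst c s)) f"
      and fi: "\<forall>z\<in>states (inst c s). push (inst c s) (two_policy a) f z = f z" for f
  proof -
    define g where "g h = f (0, to_nat h) - stat_hid s a h" for h
    have "(\<Sum>h\<in>hids. f (0, to_nat h)) = 1" using f by (simp add: distribution_on_def states_inst)
    then have g0: "(\<Sum>h\<in>hids. g h) = 0" by (simp add: g_def sum_subtractf stat_total)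
    have gi: "(\<Sum>h\<in>hids. g h * hid_trans s a h h') = g h'" if "h' \<in> hids" for h'
    proof -
      have "(0, to_nat h') \<in> states (inst c s)" using that by (auto simp: inst_sel)
      then have "(\<Sum>h\<in>hids. f (0, to_nat h) * hid_trans s a h h') = f (0, to_nat h')"
        using fi push_inst[OF s that, of c a f] by metis
      then show ?thesis
        by (simp only: g_def left_diff_distrib sum_subtractf stat_invariant[OF a that])
    qed
    have "(\<Sum>h\<in>hids. \<bar>g h\<bar>) = (\<Sum>h'\<in>hids. \<bar>\<Sum>h\<in>hids. g h * hid_trans s a h h'\<bar>)"
      by (intro sum.cong refl) (simp only: gi)
    also have "\<dots> \<le> a * (1 - r) * (\<Sum>h\<in>hids. \<bar>g h\<bar>)" by (rule push_contract[OF s a g0])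
    also have "\<dots> \<le> (1 - r) * (\<Sum>h\<in>hids. \<bar>g h\<bar>)"
      using a r1 by (intro mult_right_mono mult_left_le_one_le sum_nonneg) auto
    finally have "r * (\<Sum>h\<in>hids. \<bar>g h\<bar>) \<le> 0" by (simp add: algebra_simps)
    then have "(\<Sum>h\<in>hids. \<bar>g h\<bar>) \<le> 0"
      using r0 by (simp add: mult_le_0_iff)
    then have "(\<Sum>h\<in>hids. \<bar>g h\<bar>) = 0"
      by (rule antisym) (rule sum_nonneg, simp)
    then have "\<forall>h\<in>hids. g h = 0" using finite_hids by (simp add: sum_nonneg_eq_0_iff)
    then have on: "f (0, to_nat h) = stat_hid s a h" if "h \<in> hids" for h using that by (simp add: g_def)
    show ?thesis
    proof
      fix z
      show "f z = stat s a z"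
      proof (cases "z \<in> states (inst c s)")
        case True
        then obtain h where "h \<in> hids" "z = (0, to_nat h)" by (auto simp: inst_sel)
        then show ?thesis using on by (simp add: stat_eq)
      next
        case False
        have "\<forall>z. z \<notin> states (inst c s) \<longrightarrow> f z = 0"
          using f unfolding distribution_on_def by (elim conjE)
        from this[rule_format, OF False] have "f z = 0" .
        then show ?thesis using False by (auto simp: stat_def inst_sel)
      qed
    qed
  qed
  show st: "stationary_dist (inst c s) (two_policy a) = stat s a"
    unfolding stationary_dist_def
  proof (rule the_equality)
    show "distribution_on (states (inst c s)) (stat s a) \<and>
        (\<forall>z\<in>states (inst c s). push (inst c s) (two_policy a) (stat s a) z = stat s a z)"
      by (rule conjI[OF dist inv])
  qed (elim conjE, rule uniq)
  show "distribution_on (states (inst c s)) (stationary_dist (inst c s) (two_policy a))"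
    unfolding st by (rule dist)
qed

subsection \<open>Moments and long-term values\<close>

lemma next_op_const: "next_op h w y (\<lambda>_. k) = k"
  by (auto simp: next_op_def algebra_simps split: hid.splits)

lemma kern_op_const: "kern_op s h w (\<lambda>y _. g y) = prob_up s h w * g True + (1 - prob_up s h w) * g False"
  by (simp add: kern_op_def next_op_const)

lemma pred_const: "pred P (\<lambda>_. k) = mass P * k"
proof -
  obtain N l w y where P: "P = (N, l, w, y)" by (cases P)
  show ?thesis unfolding P pred_post next_op_const by (simp add: algebra_simps sum_distrib_left)
qed

text \<open>The second moment is always \<open>c\<^sup>2\<close>. The mean is largest in
  \<open>Hold\<close>, where it has size \<open>c * (1 - e)\<close>, or in a late state, where a
  kept bit and a biased redraw add up.\<close>

lemma moment_bounds_inst: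
  assumes s: "\<bar>s\<bar> = 1" and c: "0 \<le> c" "c * (1 - e) \<le> M1" "c * (q * \<delta> + (1 - q)) \<le> M1" "0 \<le> M1" "c\<^sup>2 \<le> M2"
  shows "moment_bounds (inst c s) M1 M2"
proof -
  have main: "integrable (kernel (inst c s) (x, h, w)) (\<lambda>z. (fst z)\<^sup>2)
    \<and> \<bar>\<integral>z. fst z \<partial>kernel (inst c s) (x, h, w)\<bar> \<le> M1 \<and> (\<integral>z. (fst z)\<^sup>2 \<partial>kernel (inst c s) (x, h, w)) \<le> M2" for x h w
  proof -
    let ?p = "out_pmf s (from_nat h) (w = 1)" and ?N = "borel \<Otimes>\<^sub>M (count_space {0} \<Otimes>\<^sub>M count_space (to_nat ` hids)) :: (real \<times> nat \<times> nat) measure"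
    define p where "p = prob_up s (from_nat h) (w = 1)"
    have sg2: "(sgn_bit b)\<^sup>2 = 1" for b by simp
    have m1: "(\<lambda>z. fst z) \<in> borel_measurable ?N" "(\<lambda>z. (fst z)\<^sup>2) \<in> borel_measurable ?N" by measurable
    have "integrable (kernel (inst c s) (x, h, w)) (\<lambda>z. (fst z)\<^sup>2)"
      unfolding inst_sel
      by (subst integrable_distr_eq[OF out_measurable m1(2)]) (simp add: case_prod_unfold power_mult_distrib sg2)
    moreover have "(\<integral>z. (fst z)\<^sup>2 \<partial>kernel (inst c s) (x, h, w)) = c\<^sup>2"
    proof -
      have "(\<integral>z. (fst z)\<^sup>2 \<partial>kernel (inst c s) (x, h, w)) = (\<integral>z. c\<^sup>2 \<partial>?p)"
        unfolding inst_sel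
        by (subst integral_distr[OF out_measurable m1(2)]) (simp add: case_prod_unfold power_mult_distrib sg2)
      then show ?thesis by simp
    qed
    moreover have "(\<integral>z. fst z \<partial>kernel (inst c s) (x, h, w)) = c * (2 * p - 1)"
    proof -
      have fstp: "map_pmf fst ?p = bernoulli_pmf p"
        by (simp add: out_pmf_def p_def map_bind_pmf map_pmf_comp o_def bind_return_pmf')
      have "(\<integral>z. fst z \<partial>kernel (inst c s) (x, h, w)) = (\<integral>z. c * sgn_bit (fst z) \<partial>?p)"
        unfolding inst_sel
        by (subst integral_distr[OF out_measurable m1(1)]) (simp add: case_prod_unfold)
      also have "\<dots> = (\<integral>y. c * sgn_bit y \<partial>map_pmf fst ?p)" by (simp add: integral_map_pmf)
      also have "\<dots> = c * (2 * p - 1)"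
        unfolding fstp using prob_up_bounds[OF s, of "from_nat h" "w = 1"]
        by (simp add: integral_bernoulli_pmf p_def algebra_simps)
      finally show ?thesis .
    qed
    moreover have "\<bar>c * (2 * p - 1)\<bar> \<le> M1"
    proof (cases "from_nat h :: hid")
      case Fresh
      then show ?thesis using c by (simp add: p_def prob_up_def)
    next
      case (Hold u)
      then have "\<bar>2 * p - 1\<bar> = 1 - e" using e0 e1 by (auto simp: p_def prob_up_def)
      then show ?thesis using c by (simp add: abs_mult)
    next
      case (Late n u)
      have "\<bar>2 * p - 1\<bar> \<le> q * \<delta> + (1 - q)"
      proof (cases "n = 0")
        case True
        then show ?thesis using Late q0 q1 d0 by (simp add: p_def prob_up_def)
      next
        case False
        have "2 * p - 1 = q * (s * \<delta> * of_bool (n = L \<and> w = 1)) + (1 - q) * sgn_bit u"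
          using Late False by (simp add: p_def prob_up_def) (simp add: algebra_simps add_divide_distrib)
        also have "\<bar>\<dots>\<bar> \<le> \<bar>q * (s * \<delta> * of_bool (n = L \<and> w = 1))\<bar> + \<bar>(1 - q) * sgn_bit u\<bar>" by (rule abs_triangle_ineq)
        also have "\<dots> \<le> q * \<delta> + (1 - q)"
          using s q0 q1 d0 by (auto simp: abs_mult)
        finally show ?thesis .
      qed
      then have "c * \<bar>2 * p - 1\<bar> \<le> c * (q * \<delta> + (1 - q))" using c by (intro mult_left_mono)
      then show ?thesis using c by (simp add: abs_mult)
    qed
    ultimately show ?thesis using c by simp
  qed
  then show ?thesis by (simp add: moment_bounds_def)
qed

text \<open>The two values of the stored bit cancel except at counter \<open>L\<close>, where the
  recursion of \<open>tilt0\<close> reappears.\<close>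

lemma stat_prob_up:
  assumes "0 \<le> a" "a \<le> 1"
  shows "(\<Sum>h\<in>hids. stat_hid s a h * (2 * prob_up s h True - 1)) = s * tilt0 a"
proof -
  define t k where tk: "t = a * (1 - r) * tilt0 a" "k = surv a L"
  define R where "R = r / q"
  have L0: "stat_hid s a (Late n True) * (2 * prob_up s (Late n True) True - 1)
    + stat_hid s a (Late n False) * (2 * prob_up s (Late n False) True - 1)
    = (if n = L then s * (q * \<delta> * k + (1 - q) * t) else 0)" for n
    using L2 by (simp add: stat_hid_def prob_up_def tk[symmetric])
      (simp add: algebra_simps add_divide_distrib diff_divide_distrib)
  show ?thesis unfolding sum_hids L0
    using tilt0_fix[OF assms]
    by (simp add: stat_hid_def prob_up_def R_def[symmetric] tk) (simp add: algebra_simps add_divide_distrib diff_divide_distrib)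
qed

lemma nn_integral_stationary_inst:
  assumes s: "\<bar>s\<bar> = 1" and g: "g \<in> borel_measurable borel" "\<And>y. 0 \<le> g y"
  shows "(\<integral>\<^sup>+ (x, h, w, y). ennreal (g y) \<partial>stationary_law (inst c s) (two_policy 1))
     = ennreal (g c * ((1 + s * tilt0 1) / 2) + g (- c) * ((1 - s * tilt0 1) / 2))"
proof -
  let ?I = "inst c s" and ?p = "two_policy 1"
  note st = stationary_dist_inst[OF s zero_le_one order_refl, of c]
  have pol: "policy (obs_states ?I) (n_actions ?I) ?p" using policy_two_policy[of 1] by (simp add: inst_sel)
  have F: "(\<lambda>(x, h, w, y). ennreal (g y)) \<in> borel_measurable (obs_space ?I)"
    using g(1) by measurable
  have K: "(\<integral>\<^sup>+ (y, x', h'). ennreal (g y) \<partial>kernel ?I (x, to_nat h, w)) = ennreal (kern_op s h (w = 1) (\<lambda>y _. g (c * sgn_bit y)))" for x h w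
  proof -
    have "(\<lambda>(y, x', h'). ennreal (g y)) \<in> borel_measurable (borel \<Otimes>\<^sub>M (count_space {0} \<Otimes>\<^sub>M count_space (to_nat ` hids)))"
      using g(1) by measurable
    from nn_integral_inst[OF s this, of c "\<lambda>y _. g (c * sgn_bit y)" x "to_nat h" w] show ?thesis using g(2) by simp
  qed
  have "(\<integral>\<^sup>+ (x, h, w, y). ennreal (g y) \<partial>stationary_law ?I ?p) =
     (\<Sum>h\<in>hids. ennreal (stat_hid s 1 h) * ennreal (kern_op s h True (\<lambda>y _. g (c * sgn_bit y))))"
    by (rule trans[OF nn_integral_stationary_law(1)[OF is_pomdp_inst pol st(2) F]],
        unfold states_inst st(1) prod.case inst_sel(3) sum_two K, intro sum.cong refl)
       (simp add: stat_eq two_policy_def)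
  also have "\<dots> = ennreal (\<Sum>h\<in>hids. stat_hid s 1 h * kern_op s h True (\<lambda>y _. g (c * sgn_bit y)))"
    using stat_nonneg[of 1 s] s kern_op_nonneg[OF s] g(2) by (simp add: ennreal_mult sum_ennreal[symmetric])
  also have "(\<Sum>h\<in>hids. stat_hid s 1 h * kern_op s h True (\<lambda>y _. g (c * sgn_bit y)))
     = g c * ((1 + s * tilt0 1) / 2) + g (- c) * ((1 - s * tilt0 1) / 2)"
  proof -
    have "(\<Sum>h\<in>hids. stat_hid s 1 h * kern_op s h True (\<lambda>y _. g (c * sgn_bit y))) =
      (\<Sum>h\<in>hids. (g c - g (- c)) / 2 * (stat_hid s 1 h * (2 * prob_up s h True - 1)) + (g c + g (- c)) / 2 * stat_hid s 1 h)"
      unfolding kern_op_const by (intro sum.cong) (simp_all add: algebra_simps add_divide_distrib diff_divide_distrib)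
    also have "\<dots> = (g c - g (- c)) / 2 * (s * tilt0 1) + (g c + g (- c)) / 2"
      unfolding sum.distrib sum_distrib_left[symmetric] stat_total using stat_prob_up[of 1 s] by simp
    finally show ?thesis by (simp add: algebra_simps add_divide_distrib diff_divide_distrib)
  qed
  finally show ?thesis .
qed

lemma long_term_value_inst:
  assumes s: "\<bar>s\<bar> = 1" and c: "0 \<le> c"
  shows "long_term_value (inst c s) (two_policy 1) = s * (c * tilt0 1)"
proof -
  let ?M = "stationary_law (inst c s) (two_policy 1)"
  define f :: "nat \<times> nat \<times> nat \<times> real \<Rightarrow> real" where f: "f = (\<lambda>(x, h, w, y). y)"
  note st = stationary_dist_inst[OF s zero_le_one order_refl, of c]
  have pol: "policy (obs_states (inst c s)) (n_actions (inst c s)) (two_policy 1)" using policy_two_policy[of 1] by (simp add: inst_sel)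
  have "(\<lambda>(x, h, w, y). y) \<in> borel_measurable (obs_space (inst c s))" by measurable
  then have m: "f \<in> borel_measurable ?M"
    unfolding f using nn_integral_stationary_law(2)[OF is_pomdp_inst pol st(2) measurable_const[of 0]]
    by (subst measurable_cong_sets) auto
  have t: "\<bar>s * tilt0 1\<bar> \<le> 1"
  proof -
    have "surv 1 L \<le> (1 - r) ^ L * 1 ^ L" using L2 by (intro surv_le) auto
    also have "\<dots> \<le> 1" using r0 r1 by (simp add: power_le_one)
    finally have "\<delta> * surv 1 L \<le> 1 * 1" using d0 d1 by (intro mult_mono) (auto simp: surv_nonneg)
    then show ?thesis using tilt0_bounds[of 1] s by (simp add: abs_mult)
  qed
  \<comment> \<open>\<open>ennreal\<close> cuts off negative values. With \<open>max 0\<close> a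
    single formula serves the absolute value as well as the positive and the negative part.\<close>
  have I: "(\<integral>\<^sup>+ z. ennreal (g (f z)) \<partial>?M) = ennreal (max 0 (g c) * ((1 + s * tilt0 1) / 2) + max 0 (g (- c)) * ((1 - s * tilt0 1) / 2))"
    if "g \<in> borel_measurable borel" for g
  proof -
    have "(\<integral>\<^sup>+ z. ennreal (g (f z)) \<partial>?M) = (\<integral>\<^sup>+ (x, h, w, y). ennreal (max 0 (g y)) \<partial>?M)"
      unfolding f by (intro nn_integral_cong) (auto simp: max_def ennreal_neg)
    also have "\<dots> = ennreal (max 0 (g c) * ((1 + s * tilt0 1) / 2) + max 0 (g (- c)) * ((1 - s * tilt0 1) / 2))"
      using that by (intro nn_integral_stationary_inst[OF s]) auto
    finally show ?thesis .
  qed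
  have "integrable ?M f"
    using I[of abs] by (intro integrableI_bounded m) simp
  then have "(\<integral>z. f z \<partial>?M) = enn2real (\<integral>\<^sup>+ z. ennreal (f z) \<partial>?M) - enn2real (\<integral>\<^sup>+ z. ennreal (- f z) \<partial>?M)"
    by (rule real_lebesgue_integral_def)
  also have "\<dots> = c * ((1 + s * tilt0 1) / 2) - c * ((1 - s * tilt0 1) / 2)"
    using I[of "\<lambda>y. y"] I[of uminus] c t by (simp add: abs_le_iff)
  finally show ?thesis unfolding long_term_value_def f by (simp add: algebra_simps add_divide_distrib diff_divide_distrib)
qed

subsection \<open>The law of the data and the two-point bound\<close>

text \<open>Forgets the redraw flags and the virtual letter: the oldest letter is never recorded, so
  \<open>x\<close> belongs to period \<open>Suc (length xs)\<close>.\<close>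

fun dat :: "real \<Rightarrow> letter list \<Rightarrow> nat \<Rightarrow> nat \<times> nat \<times> real" where
  "dat c (x # y # xs) = (dat c (y # xs))(Suc (length xs) := (0, if fst x then 1 else 2, c * sgn_bit (snd (snd x))))"
| "dat c _ = (\<lambda>_. undefined)"

lemma traj_functional_measurable:
  assumes g: "\<And>h. (\<lambda>d. g d h) \<in> borel_measurable (data_space {0} 2 t)"
  shows "(\<lambda>z. g (observed t (fst z)) (from_nat (snd (snd z)) :: hid) :: real) \<in> borel_measurable (traj_space (inst c s) t)"
proof (rule measurable_compose_countable'[where f = "\<lambda>i z. g (observed t (fst z)) (from_nat i)" and g = "\<lambda>z. snd (snd z)" and I = "to_nat ` hids"])
  show "countable (to_nat ` hids)" by simp
  show "(\<lambda>z. snd (snd z)) \<in> measurable (traj_space (inst c s) t) (count_space (to_nat ` hids))"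
    unfolding inst_sel by measurable
  fix i
  have o: "(\<lambda>z. observed t (fst z)) \<in> measurable (traj_space (inst c s) t) (data_space {0} 2 t)"
    unfolding inst_sel by (rule measurable_compose[OF measurable_fst observed_measurable])
  show "(\<lambda>z. g (observed t (fst z)) (from_nat i)) \<in> borel_measurable (traj_space (inst c s) t)"
    by (rule measurable_compose[OF o g])
qed

lemma kern_op_measurable:
  assumes "\<And>y h. (\<lambda>d. G d y h) \<in> borel_measurable M"
  shows "(\<lambda>d. kern_op s h w (G d)) \<in> borel_measurable M"
proof -
  have "(\<lambda>d. next_op h w y (\<lambda>x. G d y x)) \<in> borel_measurable M" for y
    using assms by (cases h; cases w) (auto simp: next_op_def)
  then show ?thesis unfolding kern_op_def by measurable
qed

text \<open>Integrating out the last period turns \<open>g\<close> into a functional of the earlier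
  data and hidden state; \<open>filter_consistent\<close> turns it back into one more letter under
  the base law. The redraw flags average out because \<open>dat\<close> ignores them.\<close>

lemma traj_law_filter:
  assumes s: "\<bar>s\<bar> = 1" and a: "0 \<le> a" "a \<le> 1"
    and g: "\<And>h. (\<lambda>d. g d h) \<in> borel_measurable (data_space {0} 2 t)" and g0: "\<And>d h. 0 \<le> g d h"
  shows "(\<integral>\<^sup>+ z. ennreal (g (observed t (fst z)) (from_nat (snd (snd z)))) \<partial>traj_law (inst c s) (two_policy a) t)
     = ennreal (expect a t (\<lambda>\<xi>. pred (flt s a \<xi>) (g (dat c \<xi>))))"
  using g g0
proof (induction t arbitrary: g)
  case 0
  note st = stationary_dist_inst[OF s a, of c]
  have "(\<lambda>z. ennreal (g (observed 0 (fst z)) (from_nat (snd (snd z))))) \<in> borel_measurable (traj_space (inst c s) 0)"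
    using traj_functional_measurable[of g 0 c s, OF 0(1)] by measurable
  from nn_integral_traj_law_0[OF is_pomdp_inst st(2) this]
  have "(\<integral>\<^sup>+ z. ennreal (g (observed 0 (fst z)) (from_nat (snd (snd z)))) \<partial>traj_law (inst c s) (two_policy a) 0)
     = (\<Sum>h\<in>hids. ennreal (stat_hid s a h) * ennreal (g (observed 0 (\<lambda>_. undefined)) h))"
    unfolding states_inst st(1) by (simp add: stat_eq)
  also have "\<dots> = ennreal (\<Sum>h\<in>hids. stat_hid s a h * g (observed 0 (\<lambda>_. undefined)) h)"
    using stat_nonneg[OF a s] 0(2) by (simp add: ennreal_mult sum_ennreal[symmetric])
  also have "observed 0 (\<lambda>_. undefined) = (\<lambda>_. undefined)" by (simp add: observed_def fun_eq_iff)
  finally show ?case unfolding stat_pred by simp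
next
  case (Suc t)
  note st = stationary_dist_inst[OF s a, of c]
  have pol: "policy (obs_states (inst c s)) (n_actions (inst c s)) (two_policy a)"
    using policy_two_policy[OF a] by (simp add: inst_sel)
  define H where "H d w y = g (d(Suc t := (0, if w then 1 else 2, c * sgn_bit y)))" for d w y
  define g' where "g' d h = a * kern_op s h True (H d True) + (1 - a) * kern_op s h False (H d False)" for d h
  have Hm: "(\<lambda>d. H d w y h) \<in> borel_measurable (data_space {0} 2 t)" for w y h
    unfolding H_def by (rule measurable_compose[OF data_upd_measurable Suc.prems(1)]) auto
  have H0: "0 \<le> H d w y h" for d w y h unfolding H_def by (rule Suc.prems(2))
  have g'm: "(\<lambda>d. g' d h) \<in> borel_measurable (data_space {0} 2 t)" for h
    unfolding g'_def using kern_op_measurable[OF Hm] by measurable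
  have g'0: "0 \<le> g' d h" for d h
    unfolding g'_def using a kern_op_nonneg[OF s, of "H d True"] kern_op_nonneg[OF s, of "H d False"] H0 by simp
  let ?F = "\<lambda>z :: (nat \<Rightarrow> nat \<times> nat \<times> nat \<times> real) \<times> nat \<times> nat. ennreal (g (observed (Suc t) (fst z)) (from_nat (snd (snd z))))"
  have Fm: "?F \<in> borel_measurable (traj_space (inst c s) (Suc t))"
    using traj_functional_measurable[of g "Suc t" c s, OF Suc.prems(1)] by measurable
  have K: "(\<integral>\<^sup>+ (y, x', h'). ?F (fun_upd \<omega> (Suc t) (0, h, w, y), x', h') \<partial>kernel (inst c s) (0, h, w))
     = ennreal (kern_op s (from_nat h) (w = 1) (H (observed t \<omega>) (w = 1)))"
    if w: "w \<in> {1, 2}" and \<omega>: "\<omega> \<in> space (\<Pi>\<^sub>M i\<in>{1..t}. obs_space (inst c s))" and h: "h \<in> to_nat ` hids" for w \<omega> h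
  proof -
    have "(\<lambda>(\<omega>, z). case z of (y, x', h') \<Rightarrow> (fun_upd \<omega> (Suc t) (0, h, w, y), x', h'))
      \<in> measurable ((\<Pi>\<^sub>M i\<in>{1..t}. obs_space (inst c s)) \<Otimes>\<^sub>M (borel \<Otimes>\<^sub>M state_space (inst c s))) (traj_space (inst c s) (Suc t))"
      using w h by (intro traj_upd_measurable) (auto simp: inst_sel)
    from measurable_compose[OF measurable_Pair1'[OF \<omega>] measurable_compose[OF this Fm]]
    have m: "(\<lambda>(y, x', h'). ?F (fun_upd \<omega> (Suc t) (0, h, w, y), x', h')) \<in> borel_measurable (borel \<Otimes>\<^sub>M (count_space {0} \<Otimes>\<^sub>M count_space (to_nat ` hids)))"
      by (simp only: case_prod_unfold inst_sel fst_conv snd_conv prod.collapse)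
    show ?thesis
      by (rule nn_integral_inst[OF s m]) (use w H0 in \<open>auto simp: observed_upd H_def\<close>)
  qed
  have "(\<integral>\<^sup>+ z. ?F z \<partial>traj_law (inst c s) (two_policy a) (Suc t)) =
    (\<integral>\<^sup>+ (\<omega>, x, h). (\<Sum>w\<in>actions (inst c s). ennreal (two_policy a x w) *
      (\<integral>\<^sup>+ (y, x', h'). ?F (fun_upd \<omega> (Suc t) (x, h, w, y), x', h') \<partial>kernel (inst c s) (x, h, w))) \<partial>traj_law (inst c s) (two_policy a) t)"
    by (rule nn_integral_traj_law_Suc[OF is_pomdp_inst pol st(2) Fm])
  also have "\<dots> = (\<integral>\<^sup>+ z. ennreal (g' (observed t (fst z)) (from_nat (snd (snd z)))) \<partial>traj_law (inst c s) (two_policy a) t)"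
  proof (rule nn_integral_cong)
    fix z assume "z \<in> space (traj_law (inst c s) (two_policy a) t)"
    moreover have "space (traj_law (inst c s) (two_policy a) t) = space (traj_space (inst c s) t)"
      using traj_law_prob[OF is_pomdp_inst pol st(2), of t] sets_eq_imp_space_eq unfolding space_prob_algebra by blast
    ultimately obtain \<omega> h where z: "z = (\<omega>, 0, h)" and \<omega>: "\<omega> \<in> space (\<Pi>\<^sub>M i\<in>{1..t}. obs_space (inst c s))" and h: "h \<in> to_nat ` hids"
      by (auto simp: space_pair_measure inst_sel)
    have n: "0 \<le> kern_op s (from_nat h) w (H (observed t \<omega>) w)" for w by (intro kern_op_nonneg[OF s] H0)
    show "(case z of (\<omega>, x, h) \<Rightarrow> (\<Sum>w\<in>actions (inst c s). ennreal (two_policy a x w) *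
      (\<integral>\<^sup>+ (y, x', h'). ?F (fun_upd \<omega> (Suc t) (x, h, w, y), x', h') \<partial>kernel (inst c s) (x, h, w))))
      = ennreal (g' (observed t (fst z)) (from_nat (snd (snd z))))"
      unfolding z prod.case inst_sel(3) sum_two fst_conv snd_conv
      using a n[of True] n[of False] K[OF _ \<omega> h, of 1] K[OF _ \<omega> h, of 2]
      by (simp add: two_policy_def g'_def ennreal_mult)
  qed
  also have "\<dots> = ennreal (expect a t (\<lambda>\<xi>. pred (flt s a \<xi>) (g' (dat c \<xi>))))"
    by (rule Suc.IH[OF g'm g'0])
  also have "expect a t (\<lambda>\<xi>. pred (flt s a \<xi>) (g' (dat c \<xi>))) = expect a (Suc t) (\<lambda>\<xi>. pred (flt s a \<xi>) (g (dat c \<xi>)))"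
    unfolding expect.simps
  proof (rule expect_cong)
    fix \<xi> :: "letter list" assume len: "length \<xi> = Suc t"
    then obtain x xs where \<xi>: "\<xi> = x # xs" by (cases \<xi>) auto
    have d: "g (dat c ((w, m, y) # \<xi>)) = H (dat c \<xi>) w y" for w m y
      using len by (simp add: \<xi> H_def)
    have "pred (flt s a \<xi>) (g' (dat c \<xi>)) = avg a (flt s a \<xi>) (\<lambda>(w, m, y). pred (fstep s (flt s a \<xi>) (w, m, y)) (H (dat c \<xi>) w y))"
      unfolding g'_def by (rule filter_consistent)
    also have "\<dots> = avg a (flt 1 a \<xi>) (\<lambda>(w, m, y). pred (fstep s (flt s a \<xi>) (w, m, y)) (H (dat c \<xi>) w y))"
      by (rule avg_flt) (simp add: \<xi>)
    also have "(\<lambda>(w, m, y). pred (fstep s (flt s a \<xi>) (w, m, y)) (H (dat c \<xi>) w y)) = (\<lambda>x. pred (flt s a (x # \<xi>)) (g (dat c (x # \<xi>))))"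
      by (rule ext) (auto simp only: d flt_Cons split: prod.split, simp only: \<xi> flt.simps)
    finally show "pred (flt s a \<xi>) (g' (dat c \<xi>)) = avg a (flt 1 a \<xi>) (\<lambda>x. pred (flt s a (x # \<xi>)) (g (dat c (x # \<xi>))))" .
  qed
  finally show ?case .
qed

lemma mse_inst:
  assumes s: "\<bar>s\<bar> = 1" and a: "0 \<le> a" "a \<le> 1" and c: "0 \<le> c" and V: "V \<in> borel_measurable (data_space {0} 2 T)"
  shows "mse (inst c s) (two_policy 1) (two_policy a) T V
     = ennreal (expect a T (\<lambda>\<xi>. mass (flt s a \<xi>) * (V (dat c \<xi>) - s * (c * tilt0 1))\<^sup>2))"
proof -
  have "(\<lambda>d. (V d - s * (c * tilt0 1))\<^sup>2) \<in> borel_measurable (data_space {0} 2 T)" using V by measurable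
  from traj_law_filter[OF s a, of "\<lambda>d _. (V d - s * (c * tilt0 1))\<^sup>2" T c, OF this]
  show ?thesis unfolding mse_def long_term_value_inst[OF s c] pred_const by simp
qed

text \<open>Le Cam's method for the values \<open>v\<close> and \<open>- v\<close>: the common part
  of the two likelihood ratios has mass at least \<open>1 / 2\<close>, and on it the two squared
  errors add up to at least \<open>2 * v\<^sup>2\<close>.\<close>

lemma minimax_lower:
  assumes a: "0 < a" "a < 1" and c: "0 \<le> c"
    and cls: "\<And>s. \<bar>s\<bar> = 1 \<Longrightarrow> inst c s \<in> pomdp_class {0} 2 (two_policy 1) (two_policy a) t0 M1 M2"
    and S: "q * \<delta>\<^sup>2 * ((1 - r)\<^sup>2 / (1 - (1 - r)\<^sup>2)) \<le> 9 / 20"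
    and aL: "a ^ L \<le> 1 / 4"
    and T: "real T * a ^ Suc L * ((1 - r)\<^sup>2) ^ L * ((q + (1 - q) * (r\<^sup>2 / q)) * \<delta>\<^sup>2) \<le> 9 / 100"
  shows "ennreal ((c * tilt0 1)\<^sup>2 / 2) \<le> minimax_risk {0} 2 (two_policy 1) (two_policy a) t0 M1 M2 T"
  unfolding minimax_risk_def
proof (rule INF_greatest)
  fix V :: "(nat \<Rightarrow> nat \<times> nat \<times> real) \<Rightarrow> real" assume V: "V \<in> borel_measurable (data_space {0} 2 T)"
  define v where "v = c * tilt0 1"
  have a01: "0 \<le> a" "a \<le> 1" using a by auto
  define R where "R s = expect a T (\<lambda>\<xi>. mass (flt s a \<xi>) * (V (dat c \<xi>) - s * v)\<^sup>2)" for s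
  have mse: "mse (inst c s) (two_policy 1) (two_policy a) T V = ennreal (R s)" if "\<bar>s\<bar> = 1" for s
    unfolding R_def v_def by (rule mse_inst[OF that a01 c V])
  \<comment> \<open>Uses \<open>2 * min x y = x + y - \<bar>x - y\<bar>\<close> and the triangle
    inequality through 1, so that only deviations from 1 enter.\<close>
  have pt: "v\<^sup>2 * ((x + y) + - 1 * (\<bar>x - 1\<bar> + \<bar>y - 1\<bar>)) \<le> x * (u - 1 * v)\<^sup>2 + y * (u - - 1 * v)\<^sup>2"
    if "0 \<le> x" "0 \<le> y" for x y u :: real
  proof -
    have "v\<^sup>2 * ((x + y) + - 1 * (\<bar>x - 1\<bar> + \<bar>y - 1\<bar>)) \<le> v\<^sup>2 * (2 * min x y)"
      by (intro mult_left_mono) (auto simp: min_def abs_if)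
    also have "\<dots> \<le> min x y * ((u - v)\<^sup>2 + (u + v)\<^sup>2)"
    proof -
      have "2 * v\<^sup>2 \<le> (u - v)\<^sup>2 + (u + v)\<^sup>2" by (simp add: power2_eq_square algebra_simps)
      from mult_left_mono[OF this, of "min x y"] that show ?thesis by (simp add: mult_ac)
    qed
    also have "\<dots> \<le> x * (u - v)\<^sup>2 + y * (u + v)\<^sup>2"
      unfolding distrib_left by (intro add_mono mult_right_mono) auto
    finally show ?thesis by simp
  qed
  have "v\<^sup>2 * (2 + - 1 * (1 / 2 + 1 / 2)) \<le> v\<^sup>2 * (2 + - 1 * (expect a T (\<lambda>\<xi>. \<bar>mass (flt 1 a \<xi>) - 1\<bar>) + expect a T (\<lambda>\<xi>. \<bar>mass (flt (- 1) a \<xi>) - 1\<bar>)))"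
    using expect_mass_dev[OF a _ S aL T, of 1] expect_mass_dev[OF a _ S aL T, of "- 1"]
    by (intro mult_left_mono) auto
  also have "\<dots> = expect a T (\<lambda>\<xi>. v\<^sup>2 * ((mass (flt 1 a \<xi>) + mass (flt (- 1) a \<xi>)) + - 1 * (\<bar>mass (flt 1 a \<xi>) - 1\<bar> + \<bar>mass (flt (- 1) a \<xi>) - 1\<bar>)))"
    by (simp only: expect_cmult expect_add expect_mass) simp
  also have "\<dots> \<le> expect a T (\<lambda>\<xi>. mass (flt 1 a \<xi>) * (V (dat c \<xi>) - 1 * v)\<^sup>2 + mass (flt (- 1) a \<xi>) * (V (dat c \<xi>) - - 1 * v)\<^sup>2)"
    by (intro expect_mono a01 pt mass_nonneg valid_flt) auto
  also have "\<dots> = R 1 + R (- 1)" unfolding R_def by (rule expect_add)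
  finally have "v\<^sup>2 / 2 \<le> R 1 \<or> v\<^sup>2 / 2 \<le> R (- 1)" by simp linarith
  then obtain s :: real where s: "\<bar>s\<bar> = 1" "v\<^sup>2 / 2 \<le> R s"
    using that[of 1] that[of "- 1"] by auto
  have "ennreal ((c * tilt0 1)\<^sup>2 / 2) \<le> mse (inst c s) (two_policy 1) (two_policy a) T V"
    unfolding mse[OF s(1)] using s(2) by (intro ennreal_leI) (simp add: v_def)
  also have "\<dots> \<le> (SUP I\<in>pomdp_class {0} 2 (two_policy 1) (two_policy a) t0 M1 M2. mse I (two_policy 1) (two_policy a) T V)"
    by (rule SUP_upper[OF cls[OF s(1)]])
  finally show "ennreal ((c * tilt0 1)\<^sup>2 / 2) \<le> (SUP I\<in>pomdp_class {0} 2 (two_policy 1) (two_policy a) t0 M1 M2. mse I (two_policy 1) (two_policy a) T V)" .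
qed

lemma inst_in_class:
  assumes s: "\<bar>s\<bar> = 1" and a: "0 \<le> a" "a \<le> 1" and r: "1 - r = exp (- 1 / t0)"
    and c: "0 \<le> c" "c * (1 - e) \<le> M1" "c * (q * \<delta> + (1 - q)) \<le> M1" "0 \<le> M1" "c\<^sup>2 \<le> M2"
  shows "inst c s \<in> pomdp_class {0} 2 (two_policy 1) (two_policy a) t0 M1 M2"
  using mixing_inst[OF s _ _ r, of 1 c] mixing_inst[OF s a r, of c] moment_bounds_inst[OF s c] is_pomdp_inst[of c s]
  by (simp add: pomdp_class_def inst_sel)

text \<open>An exact evaluation for the target policy; the choice of \<open>q\<close> keeps the last
  factor at least \<open>4 / 5\<close>.\<close>

lemma tilt0_lower: "tilt0 1 = \<delta> * (1 - r) ^ L * ((q - r) / ((1 - r) * (1 - (1 - r) * (1 - q))))"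
proof -
  have qr: "q * (1 - r / q) = q - r" using q0 by (simp add: right_diff_distrib)
  have "q * \<delta> * ((1 - r / q) * (1 - r) ^ (L - 1)) = \<delta> * (1 - r) ^ (L - 1) * (q * (1 - r / q))"
    by (simp only: mult_ac)
  moreover have "(1 - r) ^ L = (1 - r) * (1 - r) ^ (L - 1)" using L2 by (simp flip: power_Suc)
  ultimately show ?thesis unfolding tilt0_def surv_def qr using r1 L2 by simp
qed

end

section \<open>Choice of the parameters\<close>

text \<open>
  \<open>H\<close> is the real-valued optimal length of a run.  It is rounded down to \<open>L\<close>; scaling \<open>\<delta>\<close> by
  \<open>exp (- (H - L) / t0)\<close> makes up for this without any loss in the constant.
\<close>

lemma minimax_lower_at:
  fixes t0 \<zeta> M1 M2 q c e :: real and T :: nat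
  defines "a \<equiv> exp (- \<zeta>)" and "r \<equiv> 1 - exp (- 1 / t0)" and "\<Lambda> \<equiv> real T * M1\<^sup>2 / (M2 - M1\<^sup>2)"
  defines "H \<equiv> t0 / (t0 * \<zeta> + 2) * ln \<Lambda>"
  assumes t0: "t0 > 0" and \<zeta>: "\<zeta> > 0" and M1: "M1 > 0" and M2: "M2 > M1\<^sup>2"
    and q: "r < q" "q \<le> 1" and e: "0 \<le> e" "e \<le> 1" "(1 - q) * e = 0"
    and c: "M1 \<le> c" "c * (1 - e) \<le> M1" "c * (1 - q) + 3 / 10 * q * M1 \<le> M1" "c\<^sup>2 \<le> M2"
    and S: "q * (M1 / c)\<^sup>2 \<le> 10 * r"
    and B: "(M2 - M1\<^sup>2) / c\<^sup>2 * (q + (1 - q) * (r\<^sup>2 / q)) \<le> 1"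
    and b: "4 / 5 \<le> (q - r) / ((1 - r) * (1 - (1 - r) * (1 - q)))"
    and H: "2 + ln 4 / \<zeta> \<le> H" and T: "0 < T"
  shows "ennreal (18 / 625 * (M1\<^sup>2 * exp (- 2 * H / t0))) \<le>
    minimax_risk {0} 2 (two_policy 1) (two_policy a) t0 M1 M2 T"
proof -
  define L where "L = nat \<lfloor>H\<rfloor>"
  have "0 < ln 4 / \<zeta>" using \<zeta> by simp
  then have H2: "2 \<le> H" using H by linarith
  have L: "real L \<le> H" "H \<le> real L + 1" "2 \<le> L" unfolding L_def using H2 by linarith+
  have r: "0 < r" "r < 1" "1 - r = exp (- 1 / t0)" using t0 by (auto simp: r_def)
  have a: "0 < a" "a < 1" using \<zeta> by (auto simp: a_def)
  have \<Lambda>: "0 < \<Lambda>" using T M1 M2 by (simp add: \<Lambda>_def)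
  have c0: "0 < c" using c M1 by simp
  \<comment> \<open>The factor \<open>M1 / c\<close> makes the shift \<open>c * \<delta>\<close> of
    the mean proportional to \<open>M1\<close>, whatever the outcome scale \<open>c\<close>.\<close>
  define \<delta> where "\<delta> = 3 / 10 * (M1 / c) * exp (- (H - L) / t0)"
  have E1: "exp (- (H - L) / t0) \<le> 1" using L t0 by (simp add: divide_le_0_iff)
  have Mc: "0 \<le> M1 / c" "M1 / c \<le> 1" using M1 c c0 by auto
  have "(M1 / c) * exp (- (H - L) / t0) \<le> 1" using Mc E1 by (intro mult_le_one) auto
  have \<delta>: "0 \<le> \<delta>" "\<delta> \<le> 3 / 10"
  proof -
    have "0 \<le> (M1 / c) * exp (- (H - L) / t0)" using Mc(1) by (intro mult_nonneg_nonneg) auto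
    with \<open>(M1 / c) * exp (- (H - L) / t0) \<le> 1\<close> show "0 \<le> \<delta>" "\<delta> \<le> 3 / 10"
      unfolding \<delta>_def mult.assoc by linarith+
  qed
  have \<delta>2: "\<delta>\<^sup>2 = 9 / 100 * (M1 / c)\<^sup>2 * exp (- 2 * (H - L) / t0)"
  proof -
    have "(exp (- (H - L) / t0))\<^sup>2 = exp (- 2 * (H - L) / t0)"
      by (simp add: power2_eq_square flip: exp_add add_divide_distrib)
    then show ?thesis unfolding \<delta>_def power_mult_distrib by (simp add: power2_eq_square)
  qed
  interpret design r q \<delta> e L
    by unfold_locales (use r q e \<delta> L in auto)
  have "ennreal ((c * tilt0 1)\<^sup>2 / 2) \<le> minimax_risk {0} 2 (two_policy 1) (two_policy a) t0 M1 M2 T"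
  proof (rule minimax_lower[OF a])
    show "0 \<le> c" using c0 by simp
    show "inst c s \<in> pomdp_class {0} 2 (two_policy 1) (two_policy a) t0 M1 M2" if s: "\<bar>s\<bar> = 1" for s
    proof (rule inst_in_class[OF s _ _ r(3)])
      have "c * \<delta> \<le> 3 / 10 * M1"
        using mult_left_mono[OF E1, of "3 / 10 * M1"] M1 c0 by (simp add: \<delta>_def)
      then have "q * (c * \<delta>) \<le> q * (3 / 10 * M1)" using q0 by (intro mult_left_mono) auto
      then show "c * (q * \<delta> + (1 - q)) \<le> M1" using c(3) by (simp add: algebra_simps)
    qed (use a c c0 M1 in auto)
    \<comment> \<open>The bound is the product of \<open>9 / 100\<close> from
      \<open>\<delta>\<^sup>2\<close>, \<open>10 * r\<close> from \<open>S\<close>, and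
      \<open>1 / (2 * r)\<close>.\<close>
    show "q * \<delta>\<^sup>2 * ((1 - r)\<^sup>2 / (1 - (1 - r)\<^sup>2)) \<le> 9 / 20"
    proof -
      have r2: "1 - (1 - r)\<^sup>2 = r * (2 - r)" by (simp add: power2_eq_square algebra_simps)
      have "r * r \<le> r * 1" using r by (intro mult_left_mono) auto
      then have "2 * (1 - r)\<^sup>2 \<le> 2 - r" using r by (simp add: power2_eq_square algebra_simps)
      then have "(1 - r)\<^sup>2 / (1 - (1 - r)\<^sup>2) \<le> 1 / (2 * r)"
        unfolding r2 using r by (simp add: divide_simps)
      moreover have "q * \<delta>\<^sup>2 \<le> 9 / 100 * (10 * r)"
      proof -
        have "exp (- 2 * (H - L) / t0) \<le> 1" using L t0 by (simp add: divide_le_0_iff)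
        then have "q * (M1 / c)\<^sup>2 * exp (- 2 * (H - L) / t0) \<le> 10 * r * 1"
          using q0 r by (intro mult_mono[OF S]) auto
        then show ?thesis by (simp add: \<delta>2)
      qed
      moreover have "0 \<le> (1 - r)\<^sup>2 / (1 - (1 - r)\<^sup>2)" unfolding r2 using r by simp
      moreover have "0 \<le> 9 / 100 * (10 * r)" using r by simp
      ultimately have "q * \<delta>\<^sup>2 * ((1 - r)\<^sup>2 / (1 - (1 - r)\<^sup>2)) \<le> 9 / 100 * (10 * r) * (1 / (2 * r))"
        using mult_mono by blast
      then show ?thesis using r by simp
    qed
    show "a ^ L \<le> 1 / 4"
    proof -
      \<comment> \<open>Rounding down costs at most 1, which the summand 2 in the lower bound on
        \<open>H\<close> covers.\<close>
      have "ln 4 / \<zeta> \<le> real L" using H L by linarith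
      then have "ln 4 \<le> real L * \<zeta>" using \<zeta> by (simp add: divide_le_eq)
      then have "exp (- (real L * \<zeta>)) \<le> exp (- ln 4)" by simp
      also have "exp (- ln 4) = (1 / 4 :: real)" by (simp add: exp_minus inverse_eq_divide)
      finally show ?thesis by (simp add: a_def flip: exp_of_nat_mult)
    qed
    show "real T * a ^ Suc L * ((1 - r)\<^sup>2) ^ L * ((q + (1 - q) * (r\<^sup>2 / q)) * \<delta>\<^sup>2) \<le> 9 / 100"
    proof -
      have "a ^ Suc L = exp (- (real L + 1) * \<zeta>)"
        unfolding a_def exp_of_nat_mult[symmetric] by (simp add: algebra_simps)
      moreover have "((1 - r)\<^sup>2) ^ L = exp (- 2 * real L / t0)"
        unfolding r(3) power_mult[symmetric] exp_of_nat_mult[symmetric] by simp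
      ultimately have "a ^ Suc L * ((1 - r)\<^sup>2) ^ L * exp (- 2 * (H - L) / t0) = exp (- (real L + 1) * \<zeta> - 2 * H / t0)"
        by (simp add: exp_add[symmetric] diff_divide_distrib algebra_simps)
      \<comment> \<open>The exponent \<open>Suc L\<close> matters here: since
        \<open>H \<le> L + 1\<close>, rounding down loses nothing.\<close>
      also have "\<dots> \<le> exp (- H * \<zeta> - 2 * H / t0)"
        using mult_right_mono[OF L(2), of \<zeta>] \<zeta> by (simp add: algebra_simps)
      \<comment> \<open>\<open>H\<close> is defined as the solution of this balance between bias and
        information.\<close>
      also have "- H * \<zeta> - 2 * H / t0 = - ln \<Lambda>"
      proof -
        have p: "t0 * \<zeta> + 2 > 0" using t0 \<zeta> by (simp add: pos_add_strict)
        have "H * \<zeta> + 2 * H / t0 = H * (t0 * \<zeta> + 2) / t0" using t0 by (simp add: field_simps)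
        also have "\<dots> = ln \<Lambda>" unfolding H_def using t0 p by simp
        finally show ?thesis by simp
      qed
      also have "exp (- ln \<Lambda>) = (M2 - M1\<^sup>2) / (real T * M1\<^sup>2)"
        using \<Lambda> by (simp add: exp_minus \<Lambda>_def)
      finally have main: "a ^ Suc L * ((1 - r)\<^sup>2) ^ L * exp (- 2 * (H - L) / t0) \<le> (M2 - M1\<^sup>2) / (real T * M1\<^sup>2)" .
      define \<kappa> where "\<kappa> = q + (1 - q) * (r\<^sup>2 / q)"
      have \<kappa>: "0 \<le> \<kappa>" using q0 q1 by (simp add: \<kappa>_def)
      have "real T * a ^ Suc L * ((1 - r)\<^sup>2) ^ L * (\<kappa> * \<delta>\<^sup>2)
         = (a ^ Suc L * ((1 - r)\<^sup>2) ^ L * exp (- 2 * (H - L) / t0)) * (real T * \<kappa> * (9 / 100 * (M1 / c)\<^sup>2))"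
        unfolding \<delta>2 by (simp only: mult_ac)
      also have "\<dots> \<le> (M2 - M1\<^sup>2) / (real T * M1\<^sup>2) * (real T * \<kappa> * (9 / 100 * (M1 / c)\<^sup>2))"
        using \<kappa> by (intro mult_right_mono main) auto
      also have "\<dots> = 9 / 100 * ((M2 - M1\<^sup>2) / c\<^sup>2 * \<kappa>)"
        using T M1 c0 by (simp add: power_divide)
      also have "\<dots> \<le> 9 / 100 * 1" using B unfolding \<kappa>_def by (intro mult_left_mono) auto
      finally show ?thesis unfolding \<kappa>_def by simp
    qed
  qed
  \<comment> \<open>The constant is \<open>(3 / 10 * (4 / 5))\<^sup>2 / 2\<close>.\<close>
  moreover have "18 / 625 * (M1\<^sup>2 * exp (- 2 * H / t0)) \<le> (c * tilt0 1)\<^sup>2 / 2"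
  proof -
    define w where "w = (q - r) / ((1 - r) * (1 - (1 - r) * (1 - q)))"
    have "c * \<delta> = 3 / 10 * M1 * exp (- (H - L) / t0)" using c0 by (simp add: \<delta>_def)
    then have "c * tilt0 1 = 3 / 10 * M1 * (exp (- (H - L) / t0) * (1 - r) ^ L) * w"
      unfolding tilt0_lower w_def[symmetric] by (simp only: mult.assoc[symmetric])
    also have "exp (- (H - L) / t0) * (1 - r) ^ L = exp (- H / t0)"
      unfolding r(3) exp_of_nat_mult[symmetric] by (simp add: exp_add[symmetric] diff_divide_distrib)
    finally have v: "c * tilt0 1 = 3 / 10 * M1 * exp (- H / t0) * w" .
    have "3 / 10 * M1 * exp (- H / t0) * (4 / 5) \<le> c * tilt0 1"
      unfolding v using b M1 by (intro mult_left_mono) (auto simp: w_def)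
    then have "(3 / 10 * M1 * exp (- H / t0) * (4 / 5))\<^sup>2 \<le> (c * tilt0 1)\<^sup>2"
      using M1 by (intro power_mono) auto
    moreover have "(exp (- H / t0))\<^sup>2 = exp (- 2 * H / t0)"
      by (simp add: power2_eq_square flip: exp_add)
    moreover have "(3 / 10 * M1 * exp (- H / t0) * (4 / 5))\<^sup>2 = 36 / 625 * (M1\<^sup>2 * (exp (- H / t0))\<^sup>2)"
      by (simp add: power2_eq_square)
    ultimately show ?thesis by simp
  qed
  ultimately show ?thesis using ennreal_leI order_trans by blast
qed

text \<open>
  In the case \<open>q < 1\<close> the choice of \<open>q\<close> makes \<open>q / (1 - q) = 9 r / (1 - r)\<close>, which fixes the proportion
  of late states among the survivors at \<open>8 / 9\<close>.
\<close>

theorem theorem3p1: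
  fixes t0 \<zeta> M1 M2 :: real
  assumes "t0 > 0" and "\<zeta> > 0" and "M1 \<ge> 0" and "M2 > M1\<^sup>2"
  shows "\<exists>(X :: nat set) (A :: nat) (\<pi> :: nat \<Rightarrow> nat \<Rightarrow> real) (\<pi>0 :: nat \<Rightarrow> nat \<Rightarrow> real).
    finite X \<and> X \<noteq> {} \<and> A \<ge> 1 \<and> policy X A \<pi> \<and> policy X A \<pi>0 \<and>
    (\<forall>x\<in>X. \<forall>a\<in>{1..A}. (\<pi>0 x a = 0 \<longrightarrow> \<pi> x a = 0) \<and> \<pi> x a / \<pi>0 x a \<le> exp \<zeta>) \<and>
    (\<exists>T\<^sub>l :: real. \<forall>T :: nat. real T > T\<^sub>l \<longrightarrow>
       minimax_risk X A \<pi> \<pi>0 t0 M1 M2 T \<ge>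
       ennreal ((M1\<^sup>2) powr (t0 * \<zeta> / (t0 * \<zeta> + 2))
                  / (16 * exp 1 * (M2 - M1\<^sup>2) powr (- 2 / (t0 * \<zeta> + 2)))
                * real T powr (- 2 / (t0 * \<zeta> + 2))))"
proof -
  define a where "a = exp (- \<zeta>)"
  define r where "r = 1 - exp (- 1 / t0)"
  define \<alpha> where "\<alpha> = t0 * \<zeta>"
  define \<sigma> where "\<sigma> = M2 - M1\<^sup>2"
  have \<alpha>: "0 < \<alpha>" using assms by (simp add: \<alpha>_def)
  have \<sigma>: "0 < \<sigma>" using assms by (simp add: \<sigma>_def)
  have a: "0 < a" "a < 1" using assms by (auto simp: a_def)
  have r: "0 < r" "r < 1" using assms by (auto simp: r_def)
  let ?R = "\<lambda>T. (M1\<^sup>2) powr (\<alpha> / (\<alpha> + 2)) / (16 * exp 1 * \<sigma> powr (- 2 / (\<alpha> + 2))) * real T powr (- 2 / (\<alpha> + 2))"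
  have "\<exists>T\<^sub>l. \<forall>T. real T > T\<^sub>l \<longrightarrow> ennreal (?R T) \<le> minimax_risk {0} 2 (two_policy 1) (two_policy a) t0 M1 M2 T"
  proof (cases "M1 = 0")
    case True
    \<comment> \<open>The claimed lower bound is 0 here.\<close>
    then show ?thesis by simp
  next
    case False
    then have M1: "0 < M1" using assms by simp
    have M2: "0 < M2" using M1 assms(4) by (simp add: order_less_trans[of 0 "M1\<^sup>2"])
    obtain q c e where q: "r < q" "q \<le> 1" and e: "0 \<le> e" "e \<le> 1" "(1 - q) * e = 0"
      and c: "M1 \<le> c" "c * (1 - e) \<le> M1" "c * (1 - q) + 3 / 10 * q * M1 \<le> M1" "c\<^sup>2 \<le> M2"
      and S: "q * (M1 / c)\<^sup>2 \<le> 10 * r"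
      and B: "\<sigma> / c\<^sup>2 * (q + (1 - q) * (r\<^sup>2 / q)) \<le> 1"
      and b: "4 / 5 \<le> (q - r) / ((1 - r) * (1 - (1 - r) * (1 - q)))"
    \<comment> \<open>If resets are frequent, every bit is redrawn and \<open>c = sqrt M2\<close>
      exhausts the second moment. Otherwise bits are kept, and \<open>c = M1\<close> respects the
      bound on conditional means.\<close>
    proof (cases "M1\<^sup>2 / M2 \<le> 10 * r")
      case True
      have "M1 \<le> sqrt M2" using assms by (simp add: real_le_rsqrt)
      moreover have "M2 - M1\<^sup>2 \<le> M2" by simp
      ultimately show ?thesis
        using True r M1 M2 by (intro that[of 1 1 "sqrt M2"]) (auto simp: power_divide \<sigma>_def)
    next
      case False
      define q where "q = 9 * r / (1 + 8 * r)"
      have q9: "q \<le> 9 * r" using r by (simp add: q_def divide_le_eq)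
      have rq: "r < q" using r by (simp add: q_def less_divide_eq)
      have q1: "q \<le> 1" using r by (simp add: q_def divide_le_eq)
      have "\<sigma> / M1\<^sup>2 * (q + (1 - q) * (r\<^sup>2 / q)) \<le> \<sigma> / M1\<^sup>2 * (M1\<^sup>2 / M2)"
      proof (rule mult_left_mono)
        have "r\<^sup>2 / q \<le> r" using r rq by (simp add: power2_eq_square divide_le_eq)
        moreover have "(1 - q) * (r\<^sup>2 / q) \<le> 1 * (r\<^sup>2 / q)" using r rq by (intro mult_right_mono) auto
        \<comment> \<open>The left-hand side is at most \<open>9 * r + r\<close>, which the failed
          case condition bounds.\<close>
        ultimately show "q + (1 - q) * (r\<^sup>2 / q) \<le> M1\<^sup>2 / M2" using q9 False by linarith
      qed (use \<sigma> in simp)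
      also have "\<dots> \<le> 1" using M1 M2 by (simp add: \<sigma>_def divide_le_eq)
      finally have B: "\<sigma> / M1\<^sup>2 * (q + (1 - q) * (r\<^sup>2 / q)) \<le> 1" .
      have p: "0 < 1 + 8 * r" using r by simp
      have "q - r = 8 * r * (1 - r) / (1 + 8 * r)"
        unfolding q_def using p by (simp add: field_simps)
      moreover have "1 - (1 - r) * (1 - q) = r * (10 - r) / (1 + 8 * r)"
        unfolding q_def using p by (simp add: field_simps)
      ultimately have "(q - r) / ((1 - r) * (1 - (1 - r) * (1 - q))) = 8 / (10 - r)"
        using p r by simp
      moreover have "4 / 5 \<le> 8 / (10 - r)" using r by (simp add: le_divide_eq)
      ultimately have b: "4 / 5 \<le> (q - r) / ((1 - r) * (1 - (1 - r) * (1 - q)))" by simp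
      have "M1 * (1 - q) + 3 / 10 * q * M1 = M1 - 7 / 10 * (q * M1)" by (simp add: algebra_simps)
      also have "\<dots> \<le> M1" using r rq M1 by simp
      finally have "M1 * (1 - q) + 3 / 10 * q * M1 \<le> M1" .
      then show ?thesis
        using that[of q 0 M1] rq q1 q9 r M1 assms B b by simp
    qed
    \<comment> \<open>Beyond this horizon \<open>H\<close> reaches
      \<open>2 + ln 4 / \<zeta>\<close>.\<close>
    define T\<^sub>l where "T\<^sub>l = \<sigma> / M1\<^sup>2 * exp ((2 + ln 4 / \<zeta>) * (\<alpha> + 2) / t0)"
    have "ennreal (?R T) \<le> minimax_risk {0} 2 (two_policy 1) (two_policy a) t0 M1 M2 T" if T: "real T > T\<^sub>l" for T
    proof -
      define \<Lambda> where "\<Lambda> = real T * M1\<^sup>2 / \<sigma>"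
      define H where "H = t0 / (\<alpha> + 2) * ln \<Lambda>"
      define \<beta> where "\<beta> = 2 / (\<alpha> + 2)"
      have "0 < T\<^sub>l" using \<sigma> M1 by (simp add: T\<^sub>l_def)
      then have T0: "0 < T" using T by linarith
      have \<Lambda>0: "0 < \<Lambda>" using T0 M1 \<sigma> by (simp add: \<Lambda>_def)
      have "exp ((2 + ln 4 / \<zeta>) * (\<alpha> + 2) / t0) < \<Lambda>"
        using T M1 \<sigma> by (simp add: \<Lambda>_def T\<^sub>l_def field_simps)
      then have "(2 + ln 4 / \<zeta>) * (\<alpha> + 2) / t0 \<le> ln \<Lambda>"
        using \<Lambda>0 by (simp add: ln_ge_iff)
      then have Hge: "2 + ln 4 / \<zeta> \<le> H" using assms(1) \<alpha> by (simp add: H_def field_simps)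
      have "- 2 * H / t0 = - \<beta> * ln \<Lambda>" using assms(1) by (simp add: H_def \<beta>_def)
      then have "exp (- 2 * H / t0) = \<Lambda> powr - \<beta>" using \<Lambda>0 by (simp add: powr_def)
      also have "\<dots> = real T powr - \<beta> * (M1\<^sup>2) powr - \<beta> * \<sigma> powr \<beta>"
        unfolding \<Lambda>_def powr_divide powr_mult powr_minus_divide[of \<sigma> \<beta>]
        by (simp only: divide_divide_eq_right div_by_1)
      finally have E: "exp (- 2 * H / t0) = real T powr - \<beta> * (M1\<^sup>2) powr - \<beta> * \<sigma> powr \<beta>" .
      have "\<alpha> / (\<alpha> + 2) = 1 + - \<beta>" using \<alpha> by (simp add: \<beta>_def field_simps)
      then have P: "(M1\<^sup>2) powr (\<alpha> / (\<alpha> + 2)) = M1\<^sup>2 * (M1\<^sup>2) powr - \<beta>"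
        using M1 by (simp only: powr_add) simp
      have \<beta>': "- 2 / (\<alpha> + 2) = - \<beta>" by (simp add: \<beta>_def)
      \<comment> \<open>The claimed rate is exactly \<open>M1\<^sup>2 * exp (- 2 * H / t0)\<close>,
        so only constants remain to be compared.\<close>
      have R: "?R T = (M1\<^sup>2 * exp (- 2 * H / t0)) / (16 * exp 1)"
        unfolding E P \<beta>' powr_minus_divide[of \<sigma> \<beta>] by (simp add: mult_ac)
      \<comment> \<open>This suffices because \<open>16 * (5 / 2) = 40\<close> exceeds
        \<open>625 / 18\<close>.\<close>
      have "(5 :: real) / 2 \<le> exp 1" using exp_lower_Taylor_quadratic[of 1] by simp
      then have "1 / (16 * exp 1) \<le> (18 / 625 :: real)" by (simp add: divide_le_eq)
      from mult_left_mono[OF this, of "M1\<^sup>2 * exp (- 2 * H / t0)"]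
      have "?R T \<le> 18 / 625 * (M1\<^sup>2 * exp (- 2 * H / t0))" unfolding R by simp
      then have "ennreal (?R T) \<le> ennreal (18 / 625 * (M1\<^sup>2 * exp (- 2 * H / t0)))" by (rule ennreal_leI)
      also have "\<dots> \<le> minimax_risk {0} 2 (two_policy 1) (two_policy a) t0 M1 M2 T"
        using minimax_lower_at[OF assms(1,2) M1 assms(4), folded r_def a_def \<sigma>_def \<alpha>_def, folded \<Lambda>_def, folded H_def,
            OF q e c S B b] Hge T0 by (simp add: \<Lambda>_def H_def)
      finally show ?thesis .
    qed
    then show ?thesis by blast
  qed
  \<comment> \<open>The ratio is \<open>exp \<zeta>\<close> at action 1 and 0 at action 2.\<close>
  moreover have "\<forall>x\<in>{0}. \<forall>w\<in>{1..2}. (two_policy a x w = 0 \<longrightarrow> two_policy 1 x w = 0) \<and> two_policy 1 x w / two_policy a x w \<le> exp \<zeta>"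
    using a by (auto simp: two_policy_def a_def exp_minus inverse_eq_divide)
  ultimately show ?thesis
    using policy_two_policy[of 1] policy_two_policy[of a] a
    unfolding \<alpha>_def \<sigma>_def
    by (intro exI[of _ "{0}"] exI[of _ 2] exI[of _ "two_policy 1"] exI[of _ "two_policy a"]) simp
qed

end
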